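(* Let $\Omega\subset\mathbb{R}^d$ be a compact set with tiling complexity index $N_\Omega$, and let $$k=k_\Omega:=\operatorname*{ess\,sup}_{\omega\in[-1/2,1/2]^d}\ \sum_{\ell\in\mathbb{Z}^d}\chi_\Omega(\omega+\ell).$$ Let $x_1,\dots,x_m$ be independent random variables uniformly distributed in $[-1/2,1/2]^d$, let $\varepsilon>0$, $0<\alpha<1$, and $$m\ \ge\ \frac{10}{\alpha^2}\cdot k\cdot\log\left(\frac{2N_\Omega k}{\varepsilon}\right).$$ Then, with probability at least $1-\varepsilon$, the inequalities $$m(1-\alpha)\|f\|^2\ \le\ \sum_{r=1}^m\sum_{\ell\in\mathbb{Z}^d}|f(x_r+\ell)|^2\ \le\ m(1+\alpha)\|f\|^2$$ hold for every $f\in PW_\Omega$.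
   Context: The Fourier transform is $\hat f(\omega)=\int_{\mathbb{R}^d}f(x)e^{-2\pi \mathrm{i}\langle x,\omega\rangle}\,dx$ (extended to $L^2$), $\|\cdot\|$ is the $L^2(\mathbb{R}^d)$ norm, and $\chi_\Omega$ is the indicator function of $\Omega$. For a compact set $\Omega\subset\mathbb{R}^d$, the Paley-Wiener space is $PW_\Omega=\{f\in L^2(\mathbb{R}^d): \mathrm{Supp}(\hat f)\subseteq\Omega\}$; its elements are identified with their continuous representatives. The tiling complexity index $N_\Omega$ of a compact set $\Omega\subset\mathbb{R}^d$ is the minimum number $N\in\mathbb{N}=\{1,2,\dots\}$ for which there exist disjoint measurable sets $Q_1,\dots,Q_N\subseteq[-1/2,1/2]^d$ and sets $B_1,\dots,B_N\subseteq\mathbb{Z}^d$ such that $\Omega=\bigcup_{n=1}^N(Q_n+B_n)$ up to Lebesgue-null sets, where $Q_n+B_n=\{q+b: q\in Q_n,\ b\in B_n\}$. *)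

theory Defs
  imports "HOL-Probability.Probability"
begin

definition int_lattice :: "(real ^ 'd) set" where
  "int_lattice = {l. \<forall>i. l $ i \<in> \<int>}"

definition unit_cube :: "(real ^ 'd) set" where
  "unit_cube = cbox (\<chi> i. - 1 / 2) (\<chi> i. 1 / 2)"

definition square_integrable :: "(real ^ 'd \<Rightarrow> complex) \<Rightarrow> bool" where
  "square_integrable f \<longleftrightarrow>
     f \<in> borel_measurable lebesgue \<and> integrable lebesgue (\<lambda>x. (cmod (f x))\<^sup>2)"

definition L2_norm :: "(real ^ 'd \<Rightarrow> complex) \<Rightarrow> real" where
  "L2_norm f = sqrt (LINT x|lebesgue. (cmod (f x))\<^sup>2)"

definition L2_tendsto :: "(nat \<Rightarrow> real ^ 'd \<Rightarrow> complex) \<Rightarrow> (real ^ 'd \<Rightarrow> complex) \<Rightarrow> bool" where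
  "L2_tendsto s f \<longleftrightarrow>
     (\<lambda>n. \<integral>\<^sup>+ x. ennreal ((cmod (s n x - f x))\<^sup>2) \<partial>lebesgue) \<longlonglongrightarrow> 0"

definition fourier :: "(real ^ 'd \<Rightarrow> complex) \<Rightarrow> real ^ 'd \<Rightarrow> complex" where
  "fourier f \<omega> = (LINT x|lebesgue. f x * exp (- 2 * of_real pi * \<i> * of_real (x \<bullet> \<omega>)))"

text \<open>
  The extension of the Fourier transform to \<open>L\<^sup>2\<close> by density of \<open>L\<^sup>1 \<inter> L\<^sup>2\<close>. It is a relation
  because \<open>g\<close> is determined by \<open>f\<close> only up to null sets.
\<close>
definition has_L2_fourier :: "(real ^ 'd \<Rightarrow> complex) \<Rightarrow> (real ^ 'd \<Rightarrow> complex) \<Rightarrow> bool" where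
  "has_L2_fourier f g \<longleftrightarrow> square_integrable f \<and> square_integrable g \<and>
     (\<exists>s. (\<forall>n. integrable lebesgue (s n) \<and> square_integrable (s n)) \<and>
          L2_tendsto s f \<and> L2_tendsto (\<lambda>n. fourier (s n)) g)"

text \<open>
  The support of a function class: the complement of the largest open set on which the
  function vanishes almost everywhere.
\<close>
definition ess_support :: "(real ^ 'd \<Rightarrow> complex) \<Rightarrow> (real ^ 'd) set" where
  "ess_support g = - \<Union>{U. open U \<and> (AE \<omega> in lebesgue. \<omega> \<in> U \<longrightarrow> g \<omega> = 0)}"

text \<open>Continuity selects the continuous representative of each element.\<close>
definition Paley_Wiener :: "(real ^ 'd) set \<Rightarrow> (real ^ 'd \<Rightarrow> complex) set" where
  "Paley_Wiener \<Omega> = {f. continuous_on UNIV f \<and> square_integrable f \<and>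
     (\<exists>g. has_L2_fourier f g \<and> ess_support g \<subseteq> \<Omega>)}"

definition tiling_decomposition :: "(real ^ 'd) set \<Rightarrow> nat \<Rightarrow> bool" where
  "tiling_decomposition \<Omega> N \<longleftrightarrow>
     (\<exists>Q B. disjoint_family_on Q {1..N} \<and>
        (\<forall>n\<in>{1..N}. Q n \<in> sets lebesgue \<and> Q n \<subseteq> unit_cube \<and> B n \<subseteq> int_lattice) \<and>
        sym_diff \<Omega> (\<Union>n\<in>{1..N}. {q + b | q b. q \<in> Q n \<and> b \<in> B n}) \<in> null_sets lebesgue)"

text \<open>
  The minimum exists for compact \<open>\<Omega>\<close>: only finitely many sets \<open>{l. \<omega> + l \<in> \<Omega>}\<close>
  occur as \<open>\<omega>\<close> ranges over the cube.
\<close>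
definition tiling_complexity :: "(real ^ 'd) set \<Rightarrow> nat" where
  "tiling_complexity \<Omega> = (LEAST N. 1 \<le> N \<and> tiling_decomposition \<Omega> N)"

text \<open>
  The essential supremum is taken in the extended nonnegative reals, where the lattice sum is
  always meaningful; it is finite for bounded \<open>\<Omega>\<close>.
\<close>
definition tiling_multiplicity :: "(real ^ 'd) set \<Rightarrow> real" where
  "tiling_multiplicity \<Omega> =
     enn2real (esssup (restrict_space lebesgue unit_cube)
       (\<lambda>\<omega>. \<Sum>\<^sub>\<infinity>l\<in>int_lattice. indicator \<Omega> (\<omega> + l)))"

end

(*
The proof periodizes in frequency. A function f in PW has the form f(x) = \<integral> g(\<omega>) e(<x,\<omega>>) d\<omega> with g
supported in \<Omega>, and by Parseval on the cube
  sum_l |f(x+l)|^2 = \<integral>_cube |sum_j g(\<omega>+j) e(<j,x>)|^2 d\<omega>.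
For almost every \<omega> in a tile Q_n only the shifts j in B_n contribute, so the two inequalities for all
f follow from spectral bounds m(1 \<plusminus> \<alpha>) for finitely many random matrices sum_r a_r a_r^H, one for
each tile that is not a null set, where a_r = (e(-<b,x_r>))_{b \<in> B_n}. These bounds are a matrix
Chernoff inequality. Instead of traces of exponentials it uses traces of high powers of the
shifted matrices c + sum_r a_r a_r^H and c - sum_r a_r a_r^H: since K^q has log-convex moments for a
positive matrix K, a rank-one update satisfies
<(K + a a^H)^q a, a> <= (1 + |a|^2/l)^q <K^q a, a> whenever K >= l,
which replaces the Golden-Thompson inequality in the recursion for the expected traces. The event
is measurable because it is closed in the sample points: each lattice sum is continuous in x.
*)
theory Submission imports Defs begin

subsection \<open>Positive operators on finite-dimensional spaces\<close>

text \<open>The bounds must hold for all f, hence for all vectors u, at once, so the exceptional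
  event is fixed without reference to u: the trace of a high even power of c + S or c - S is too
  large, where S is the sum of the a_r a_r^H. One step of the trace recursion produces <K^q a_r,
  a_r> with a K that still contains a_r. Deleting a_r from K makes K independent of a_r, and since
  the mean of a a^H is the identity, the expectation becomes a trace again; the rank-one comparison
  is the price of the deletion. For c - S deletion increases the matrix, so the same comparison is
  read backwards. The shift c is proportional to m |B| / \<alpha>, large enough to keep the price at
  most 1 + 3 \<alpha> / 4 in the upper tail over all 4 m powers. The constant 10 is 8 from this
  shift plus 2 from the threshold (1 + \<alpha>) m. Inside the logarithm, 2 counts the tails, k
  bounds the trace of the identity and N counts the tiles. A separate obstacle is that samples are
  point values while the Fourier transform is only an L^2 limit: continuity and Gaussian summation
  give inversion at every point.\<close>

lemma log_convex_ratio_mono: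
  fixes s :: "nat \<Rightarrow> real"
  assumes pos: "\<And>n. 0 < s n" and lc: "\<And>n. (s (Suc n))\<^sup>2 \<le> s n * s (Suc (Suc n))"
    and "i \<le> j"
  shows "s (Suc i) / s i \<le> s (Suc j) / s j"
proof -
  have "mono (\<lambda>n. s (Suc n) / s n)"
    unfolding mono_iff_le_Suc
    using lc pos by (simp add: divide_le_eq pos_le_divide_eq power2_eq_square mult.commute)
  then show ?thesis using \<open>i \<le> j\<close> by (auto dest: monoD)
qed

text \<open>Passing from i to i + 1 multiplies the left side by a ratio of consecutive terms at i
  and the right side by the one at i + j, which is at least as large. For moments this is
  Chebyshev's inequality for powers.\<close>

lemma log_convex_mult_le:
  fixes s :: "nat \<Rightarrow> real"
  assumes pos: "\<And>n. 0 < s n" and lc: "\<And>n. (s (Suc n))\<^sup>2 \<le> s n * s (Suc (Suc n))"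
  shows "s i * s j \<le> s 0 * s (i + j)"
proof (induction i)
  case (Suc i)
  have r: "s (Suc i) / s i \<le> s (Suc (i + j)) / s (i + j)"
    by (rule log_convex_ratio_mono[of s, OF pos lc]) simp
  have "s (Suc i) * s j = (s (Suc i) / s i) * (s i * s j)"
    using pos[of i] by simp
  also have "\<dots> \<le> (s (Suc i) / s i) * (s 0 * s (i + j))"
    using Suc pos[of i] pos[of "Suc i"] by (intro mult_left_mono) (auto simp: less_imp_le)
  also have "\<dots> \<le> (s (Suc (i + j)) / s (i + j)) * (s 0 * s (i + j))"
    using r pos[of 0] pos[of "i + j"] by (intro mult_right_mono) (auto simp: less_imp_le)
  also have "\<dots> = s 0 * s (Suc i + j)"
    using pos[of "i + j"] by simp
  finally show ?case .
qed simp

lemma log_convex_ratio_ge: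
  fixes s :: "nat \<Rightarrow> real"
  assumes pos: "\<And>n. 0 < s n" and lc: "\<And>n. (s (Suc n))\<^sup>2 \<le> s n * s (Suc (Suc n))"
    and c: "c * s 0 \<le> s 1"
  shows "c * s n \<le> s (Suc n)"
proof -
  have "c \<le> s (Suc 0) / s 0" using c pos[of 0] by (simp add: pos_le_divide_eq)
  also have "\<dots> \<le> s (Suc n) / s n"
    by (rule log_convex_ratio_mono[of s, OF pos lc]) simp
  finally show ?thesis using pos[of n] by (simp add: pos_le_divide_eq)
qed

lemma log_convex_power_le:
  fixes s :: "nat \<Rightarrow> real"
  assumes pos: "\<And>n. 0 < s n" and lc: "\<And>n. (s (Suc n))\<^sup>2 \<le> s n * s (Suc (Suc n))"
    and c: "c * s 0 \<le> s 1" "0 \<le> c"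
  shows "c ^ n * s 0 \<le> s n"
proof (induction n)
  case (Suc n)
  have "c ^ Suc n * s 0 \<le> c * s n" using Suc c by (simp add: mult.assoc mult_left_mono)
  also have "\<dots> \<le> s (Suc n)" by (rule log_convex_ratio_ge[of s, OF pos lc c(1)])
  finally show ?case .
qed simp

lemma nonneg_quadratic_imp_discriminant_le:
  fixes a b c :: real
  assumes nn: "\<And>t. 0 \<le> a + 2 * t * b + t\<^sup>2 * c" and "0 \<le> c"
  shows "b\<^sup>2 \<le> a * c"
proof (cases "c = 0")
  case True
  have "b = 0"
  proof (rule ccontr)
    assume b: "b \<noteq> 0"
    \<comment> \<open>With c = 0 the quadratic is affine, and at this t it takes the value
      -1.\<close>
    from nn[of "- (a + 1) / (2 * b)"] True b show False by (simp add: field_simps)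
  qed
  then show ?thesis using True by simp
next
  case False
  then have c: "0 < c" using \<open>0 \<le> c\<close> by simp
  from nn[of "- b / c"] c show ?thesis
    by (simp add: field_simps power2_eq_square)
qed

text \<open>Vectors are total functions of which only the values on \<open>B\<close> count, and
  operators are plain maps on them. Statements go through \<open>ip\<close>, which sees nothing
  outside \<open>B\<close>; so the dimension can vary from tile to tile within one type.\<close>

locale finite_index =
  fixes B :: "'b set"
  assumes finite_B: "finite B"
begin

definition ip :: "('b \<Rightarrow> complex) \<Rightarrow> ('b \<Rightarrow> complex) \<Rightarrow> complex" where
  "ip u v = (\<Sum>b\<in>B. u b * cnj (v b))"

definition sqnorm :: "('b \<Rightarrow> complex) \<Rightarrow> real" where
  "sqnorm u = (\<Sum>b\<in>B. (cmod (u b))\<^sup>2)"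

definition unit_vec :: "'b \<Rightarrow> 'b \<Rightarrow> complex" where
  "unit_vec b = (\<lambda>c. if c = b then 1 else 0)"

definition trace :: "(('b \<Rightarrow> complex) \<Rightarrow> 'b \<Rightarrow> complex) \<Rightarrow> real" where
  "trace T = (\<Sum>b\<in>B. Re (ip (T (unit_vec b)) (unit_vec b)))"

text \<open>This also stands in for linearity: an operator is moved to the other slot of
  \<open>ip\<close>, where sums and scalars can be expanded.\<close>

definition self_adj :: "(('b \<Rightarrow> complex) \<Rightarrow> 'b \<Rightarrow> complex) \<Rightarrow> bool" where
  "self_adj T \<longleftrightarrow> (\<forall>u v. ip (T u) v = ip u (T v))"

lemma ip_self: "ip u u = of_real (sqnorm u)"
  by (simp add: ip_def sqnorm_def complex_norm_square[symmetric] del: of_real_power)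

lemma ip_commute: "ip u v = cnj (ip v u)"
  by (simp add: ip_def mult.commute)

lemma ip_add_left: "ip (\<lambda>b. u b + v b) w = ip u w + ip v w"
  by (simp add: ip_def algebra_simps sum.distrib)

lemma ip_add_right: "ip w (\<lambda>b. u b + v b) = ip w u + ip w v"
  by (simp add: ip_def algebra_simps sum.distrib)

lemma ip_scale_left: "ip (\<lambda>b. c * u b) w = c * ip u w"
  by (simp add: ip_def algebra_simps sum_distrib_left)

lemma ip_scale_right: "ip w (\<lambda>b. c * u b) = cnj c * ip w u"
  by (simp add: ip_def algebra_simps sum_distrib_left)

lemma ip_sum_left: "ip (\<lambda>b. \<Sum>r\<in>R. u r b) w = (\<Sum>r\<in>R. ip (u r) w)"
  unfolding ip_def sum_distrib_right by (rule sum.swap)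

lemma ip_cong: "(\<And>b. b \<in> B \<Longrightarrow> u b = u' b) \<Longrightarrow> (\<And>b. b \<in> B \<Longrightarrow> v b = v' b) \<Longrightarrow> ip u v = ip u' v'"
  by (simp add: ip_def)

lemma ip_unit_right: "b \<in> B \<Longrightarrow> ip u (unit_vec b) = u b"
  using finite_B by (simp add: ip_def unit_vec_def if_distrib[of cnj] if_distrib[of "\<lambda>x. _ * x"] cong: if_cong)

lemma ip_unit_left: "b \<in> B \<Longrightarrow> ip (unit_vec b) u = cnj (u b)"
  by (subst ip_commute) (simp add: ip_unit_right)

lemma sqnorm_nonneg: "0 \<le> sqnorm u"
  by (simp add: sqnorm_def sum_nonneg)

lemma sqnorm_unit_vec: "b \<in> B \<Longrightarrow> sqnorm (unit_vec b) = 1"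
  using ip_self[of "unit_vec b"] by (simp add: ip_unit_right) (simp add: unit_vec_def complex_eq_iff)

lemma self_adjD: "self_adj T \<Longrightarrow> ip (T u) v = ip u (T v)"
  by (simp add: self_adj_def)

lemma self_adj_funpow: "self_adj T \<Longrightarrow> self_adj (T ^^ n)"
  by (induction n) (auto simp: self_adj_def funpow_swap1)

lemma ip_funpow_add:
  assumes "self_adj T"
  shows "ip ((T ^^ i) u) ((T ^^ j) v) = ip ((T ^^ (j + i)) u) v"
  using self_adj_funpow[OF assms, of j] by (simp add: self_adj_def funpow_add)

lemma self_adj_ip_real:
  assumes "self_adj T"
  shows "ip (T u) u = of_real (Re (ip (T u) u))"
proof -
  have "ip (T u) u = cnj (ip (T u) u)"
    using ip_commute[of "T u" u] self_adjD[OF assms, of u u] by simp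
  then have "Im (ip (T u) u) = 0" by (metis Im_complex_of_real Reals_cnj_iff complex_is_Real_iff)
  then show ?thesis by (simp add: complex_eq_iff)
qed

text \<open>The form <T w, w> at w = u + t v is a nonnegative quadratic polynomial in the real
  variable t, so its discriminant is controlled. It is needed for a general \<open>T\<close> because
  odd moments use the semi-inner product <T u, v>.\<close>

lemma psd_cauchy_schwarz:
  assumes sa: "self_adj T" and pos: "\<And>u. 0 \<le> Re (ip (T u) u)"
  shows "(Re (ip (T u) v))\<^sup>2 \<le> Re (ip (T u) u) * Re (ip (T v) v)"
proof (rule nonneg_quadratic_imp_discriminant_le)
  fix t :: real
  let ?w = "\<lambda>b. u b + of_real t * v b"
  have "ip (T ?w) ?w = ip (T ?w) u + of_real t * ip (T ?w) v"
    by (simp add: ip_add_right ip_scale_right)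
  also have "\<dots> = ip u (T u) + of_real t * ip v (T u)
      + of_real t * (ip u (T v) + of_real t * ip v (T v))"
    by (simp add: self_adjD[OF sa] ip_add_left ip_scale_left)
  also have "ip v (T u) = cnj (ip (T u) v)" by (rule ip_commute)
  finally have "Re (ip (T ?w) ?w) = Re (ip (T u) u) + 2 * t * Re (ip (T u) v) + t\<^sup>2 * Re (ip (T v) v)"
    by (simp add: self_adjD[OF sa, symmetric] power2_eq_square algebra_simps)
  then show "0 \<le> Re (ip (T u) u) + 2 * t * Re (ip (T u) v) + t\<^sup>2 * Re (ip (T v) v)"
    using pos[of ?w] by simp
qed (rule pos)

lemma cauchy_schwarz: "(Re (ip u v))\<^sup>2 \<le> sqnorm u * sqnorm v"
  using psd_cauchy_schwarz[of "\<lambda>u. u" u v] by (simp add: self_adj_def ip_self sqnorm_nonneg)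

text \<open>Multiplying \<open>u\<close> by the conjugate phase of \<open>ip u v\<close> makes the
  inner product real without changing \<open>sqnorm u\<close>, so the bound on the real part
  applies.\<close>

lemma cmod_ip_le: "(cmod (ip u v))\<^sup>2 \<le> sqnorm u * sqnorm v"
proof (cases "ip u v = 0")
  case True
  then show ?thesis by (simp add: sqnorm_nonneg)
next
  case False
  define c where "c = cnj (sgn (ip u v))"
  have c1: "cmod c = 1" using False by (simp add: c_def norm_sgn)
  have "ip (\<lambda>b. c * u b) v = of_real (cmod (ip u v))"
  proof -
    have "cnj (ip u v) * ip u v = of_real (cmod (ip u v)) * of_real (cmod (ip u v))"
      by (metis complex_norm_square mult.commute of_real_mult power2_eq_square)
    then show ?thesis using False by (simp only: ip_scale_left) (simp add: c_def sgn_eq)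
  qed
  moreover have "sqnorm (\<lambda>b. c * u b) = sqnorm u" by (simp add: sqnorm_def norm_mult c1)
  ultimately show ?thesis using cauchy_schwarz[of "\<lambda>b. c * u b" v] by simp
qed

text \<open>This is the n-th moment of the spectral measure of \<open>T\<close> at \<open>u\<close>.
  Working with moments makes diagonalization unnecessary.\<close>

definition moment :: "(('b \<Rightarrow> complex) \<Rightarrow> 'b \<Rightarrow> complex) \<Rightarrow> ('b \<Rightarrow> complex) \<Rightarrow> nat \<Rightarrow> real" where
  "moment T u n = Re (ip ((T ^^ n) u) u)"

lemma moment_0: "moment T u 0 = sqnorm u"
  by (simp add: moment_def ip_self)

lemma moment_eq: "self_adj T \<Longrightarrow> ip ((T ^^ n) u) u = of_real (moment T u n)"
  unfolding moment_def by (rule self_adj_ip_real) (rule self_adj_funpow)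

lemma trace_moment: "trace (T ^^ n) = (\<Sum>b\<in>B. moment T (unit_vec b) n)"
  by (simp add: trace_def moment_def)

end

locale positive_op = finite_index B for B :: "'b set" +
  fixes T :: "('b \<Rightarrow> complex) \<Rightarrow> 'b \<Rightarrow> complex" and l :: real
  assumes sa: "self_adj T" and l_pos: "0 < l"
    and lower: "\<And>u. l * sqnorm u \<le> Re (ip (T u) u)"
begin

lemma nonneg: "0 \<le> Re (ip (T u) u)"
  using lower[of u] l_pos sqnorm_nonneg[of u] by (meson mult_nonneg_nonneg less_imp_le order_trans)

text \<open>Cauchy-Schwarz after splitting the power evenly between the two slots. For n = 2a the
  vectors are \<open>(T ^^ a) u\<close> and \<open>(T ^^ Suc a) u\<close> in the plain inner
  product; for n = 2a + 1 they are the same vectors in the form <T u, v>.\<close>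

lemma moment_log_convex: "(moment T u (Suc n))\<^sup>2 \<le> moment T u n * moment T u (Suc (Suc n))"
proof (cases "even n")
  case True
  then obtain a where n: "n = a + a" by (metis evenE mult_2)
  have "(Re (ip ((T ^^ a) u) ((T ^^ Suc a) u)))\<^sup>2 \<le> sqnorm ((T ^^ a) u) * sqnorm ((T ^^ Suc a) u)"
    by (rule cauchy_schwarz)
  moreover have sq: "sqnorm ((T ^^ i) u) = moment T u (i + i)" for i
    using ip_funpow_add[OF sa, of i u i u] by (simp add: moment_def ip_self) (metis Re_complex_of_real)
  moreover have "Re (ip ((T ^^ a) u) ((T ^^ Suc a) u)) = moment T u (Suc n)"
    unfolding ip_funpow_add[OF sa] by (simp add: n moment_def)
  ultimately show ?thesis unfolding sq by (simp add: n)
next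
  case False
  then obtain a where n: "n = Suc (a + a)" by (metis oddE mult_2 Suc_eq_plus1)
  have "(Re (ip (T ((T ^^ a) u)) ((T ^^ Suc a) u)))\<^sup>2
      \<le> Re (ip (T ((T ^^ a) u)) ((T ^^ a) u)) * Re (ip (T ((T ^^ Suc a) u)) ((T ^^ Suc a) u))"
    by (rule psd_cauchy_schwarz[OF sa nonneg])
  moreover have e: "ip (T ((T ^^ i) u)) ((T ^^ j) u) = ip ((T ^^ (j + Suc i)) u) u" for i j
    using ip_funpow_add[OF sa, of "Suc i" u j u] by simp
  ultimately show ?thesis
    unfolding e by (simp add: n moment_def)
qed

text \<open>Two consecutive positive moments make the next one positive by log-convexity. The ratios
  of consecutive moments need this strictness.\<close>

lemma moment_pos:
  assumes "0 < sqnorm u"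
  shows "0 < moment T u n"
proof -
  have "0 < moment T u n \<and> 0 < moment T u (Suc n)"
  proof (induction n)
    case 0
    have "0 < l * sqnorm u" using l_pos assms by simp
    then show ?case using lower[of u] assms by (simp add: moment_def ip_self)
  next
    case (Suc n)
    have "0 < (moment T u (Suc n))\<^sup>2" using Suc by simp
    also have "\<dots> \<le> moment T u n * moment T u (Suc (Suc n))" by (rule moment_log_convex)
    finally show ?case using Suc by (simp add: zero_less_mult_iff)
  qed
  then show ?thesis ..
qed

lemma ip_zero_left: "sqnorm u = 0 \<Longrightarrow> ip u v = 0"
  using cmod_ip_le[of u v] by simp

lemma moment_zero: "sqnorm u = 0 \<Longrightarrow> moment T u n = 0"
  by (subst moment_def, subst self_adjD[OF self_adj_funpow[OF sa]]) (simp add: ip_zero_left)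

lemma moment_nonneg: "0 \<le> moment T u n"
  using moment_pos[of u n] moment_zero[of u n] sqnorm_nonneg[of u] by linarith

lemma moment_mult_le: "moment T u i * moment T u j \<le> sqnorm u * moment T u (i + j)"
proof (cases "sqnorm u = 0")
  case True then show ?thesis by (simp add: moment_zero)
next
  case False
  then have "0 < sqnorm u" using sqnorm_nonneg[of u] by simp
  then show ?thesis
    using log_convex_mult_le[of "moment T u" i j] moment_pos moment_log_convex by (simp add: moment_0)
qed

text \<open>Jensen's inequality for the n-th power: ratios of consecutive moments never fall below
  the first one, which is at least \<open>c\<close>.\<close>

lemma moment_power_le:
  assumes "c * sqnorm u \<le> Re (ip (T u) u)" "0 \<le> c"
  shows "c ^ n * sqnorm u \<le> moment T u n"
proof (cases "sqnorm u = 0")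
  case True then show ?thesis by (simp add: moment_zero)
next
  case False
  then have "0 < sqnorm u" using sqnorm_nonneg[of u] by simp
  then show ?thesis
    using log_convex_power_le[of "moment T u" c n] moment_pos moment_log_convex assms
    by (simp add: moment_0) (simp add: moment_def)
qed

lemma moment_Suc_ge: "l * moment T u n \<le> moment T u (Suc n)"
proof (cases "sqnorm u = 0")
  case True then show ?thesis by (simp add: moment_zero)
next
  case False
  then have "0 < sqnorm u" using sqnorm_nonneg[of u] by simp
  then show ?thesis
    using log_convex_ratio_ge[of "moment T u" l n] moment_pos moment_log_convex lower[of u]
    by (simp add: moment_0) (simp add: moment_def)
qed

lemma sqnorm_funpow: "sqnorm ((T ^^ n) u) = moment T u (2 * n)"
  using ip_funpow_add[OF sa, of n u n u] by (simp add: moment_def ip_self mult_2) (metis Re_complex_of_real)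

text \<open>For an even power the moment is the squared norm of \<open>(T ^^ n) u\<close>, and the
  trace is the squared Hilbert-Schmidt norm of \<open>T ^^ n\<close>. Cauchy-Schwarz is applied to
  each coordinate.\<close>

lemma moment_even_le_trace: "moment T u (2 * n) \<le> trace (T ^^ (2 * n)) * sqnorm u"
proof -
  have le: "(cmod (((T ^^ n) u) b))\<^sup>2 \<le> moment T (unit_vec b) (2 * n) * sqnorm u" if "b \<in> B" for b
  proof -
    have "((T ^^ n) u) b = ip ((T ^^ n) u) (unit_vec b)" using that by (simp add: ip_unit_right)
    also have "\<dots> = ip u ((T ^^ n) (unit_vec b))" by (rule self_adjD[OF self_adj_funpow[OF sa]])
    finally show ?thesis
      using cmod_ip_le[of u "(T ^^ n) (unit_vec b)"] by (simp add: sqnorm_funpow mult.commute)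
  qed
  have "moment T u (2 * n) = (\<Sum>b\<in>B. (cmod (((T ^^ n) u) b))\<^sup>2)"
    by (simp only: sqnorm_funpow[symmetric] sqnorm_def)
  also have "\<dots> \<le> (\<Sum>b\<in>B. moment T (unit_vec b) (2 * n) * sqnorm u)"
    by (rule sum_mono) (rule le)
  finally show ?thesis by (simp add: trace_moment sum_distrib_right)
qed

end

section \<open>Powers of a positive operator under a rank-one update\<close>

locale rank_one_update = positive_op B T l for B :: "'b set" and T l +
  fixes X :: "('b \<Rightarrow> complex) \<Rightarrow> 'b \<Rightarrow> complex" and a :: "'b \<Rightarrow> complex"
  assumes X: "\<And>u b. b \<in> B \<Longrightarrow> X u b = T u b + ip u a * a b"
begin

lemma ip_X: "ip (X u) v = ip (T u) v + ip u a * ip a v"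
proof -
  have "ip (X u) v = ip (\<lambda>b. T u b + ip u a * a b) v" by (rule ip_cong) (simp_all add: X)
  then show ?thesis by (simp add: ip_add_left ip_scale_left)
qed

lemma sa_X: "self_adj X"
proof -
  have "ip u (X v) = ip u (T v) + ip u a * ip a v" for u v
    using ip_X[of v u] ip_commute[of u "X v"] ip_commute[of u "T v"] ip_commute[of u a] ip_commute[of a v]
    by (simp add: mult.commute)
  then show ?thesis unfolding self_adj_def by (simp add: ip_X self_adjD[OF sa])
qed

lemma positive_op_X: "positive_op B X l"
proof
  show "self_adj X" by (rule sa_X)
  fix u
  have "ip u a * ip a u = of_real ((cmod (ip u a))\<^sup>2)"
    using ip_commute[of a u] by (simp add: complex_norm_square del: of_real_power)
  then have "Re (ip (X u) u) = Re (ip (T u) u) + (cmod (ip u a))\<^sup>2" by (simp add: ip_X)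
  then show "l * sqnorm u \<le> Re (ip (X u) u)" using lower[of u] by (simp add: add_increasing2)
qed (use l_pos in auto)

text \<open>Telescoping without commutation: X^q - T^q is the sum of T^(q-1-j) a a^H X^j over j < q.
  The vector \<open>v\<close> is arbitrary in the induction because each step moves \<open>T\<close>
  onto it.\<close>

lemma ip_X_funpow:
  "ip ((X ^^ q) u) v = ip ((T ^^ q) u) v
     + (\<Sum>j<q. ip ((X ^^ j) u) a * ip ((T ^^ (q - 1 - j)) a) v)"
proof (induction q arbitrary: v)
  case (Suc q)
  have "ip ((X ^^ Suc q) u) v = ip ((X ^^ q) u) (T v) + ip ((X ^^ q) u) a * ip a v"
    by (simp add: ip_X self_adjD[OF sa])
  also have "\<dots> = ip ((T ^^ Suc q) u) v
     + (\<Sum>j<q. ip ((X ^^ j) u) a * ip ((T ^^ Suc (q - 1 - j)) a) v) + ip ((X ^^ q) u) a * ip a v"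
    unfolding Suc by (simp add: self_adjD[OF sa, symmetric])
  also have "(\<Sum>j<q. ip ((X ^^ j) u) a * ip ((T ^^ Suc (q - 1 - j)) a) v)
      = (\<Sum>j<q. ip ((X ^^ j) u) a * ip ((T ^^ (Suc q - 1 - j)) a) v)"
    by (intro sum.cong refl) (simp add: Suc_diff_Suc[symmetric] Suc_diff_le)
  finally show ?case by simp
qed simp

text \<open>With both vectors equal to \<open>a\<close> the telescoped sum involves only moments at
  \<open>a\<close>, which closes it into a scalar recursion.\<close>

lemma moment_X:
  "moment X a q = moment T a q + (\<Sum>j<q. moment X a j * moment T a (q - 1 - j))"
proof -
  have "complex_of_real (moment X a q)
      = of_real (moment T a q + (\<Sum>j<q. moment X a j * moment T a (q - 1 - j)))"
    using ip_X_funpow[of q a a] by (simp add: moment_eq sa sa_X)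
  then show ?thesis by (simp only: of_real_eq_iff)
qed

lemma moment_X_nonneg: "0 \<le> moment X u q"
  by (rule positive_op.moment_nonneg[OF positive_op_X])

text \<open>If \<open>T\<close> commuted with the rank-one update, this would follow from
  \<open>T + sqnorm a \<le> (1 + sqnorm a / l) T\<close>; log-convexity of the moments replaces commutation.\<close>
lemma moment_X_le: "moment X a q \<le> (1 + sqnorm a / l) ^ q * moment T a q"
proof (induction q rule: less_induct)
  case (less q)
  define \<sigma> where "\<sigma> = 1 + sqnorm a / l"
  have \<sigma>0: "0 \<le> \<sigma>" using l_pos sqnorm_nonneg[of a] by (simp add: \<sigma>_def)
  \<comment> \<open>\<open>moment_mult_le\<close> merges two moments of total order q - 1 into one,
    and \<open>moment_Suc_ge\<close> raises that order to q at the cost 1 / l. The resulting factor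
    \<open>sqnorm a / l\<close> is \<sigma> - 1, exactly what makes the geometric sum below collapse
    to \<sigma>^q - 1.\<close>
  have *: "moment X a j * moment T a (q - 1 - j) \<le> \<sigma> ^ j * ((\<sigma> - 1) * moment T a q)" if "j < q" for j
  proof -
    have "moment X a j * moment T a (q - 1 - j) \<le> \<sigma> ^ j * moment T a j * moment T a (q - 1 - j)"
      using less[OF that] by (intro mult_right_mono) (simp_all add: \<sigma>_def moment_nonneg)
    also have "\<dots> \<le> \<sigma> ^ j * (sqnorm a * moment T a (q - 1))"
      using moment_mult_le[of a j "q - 1 - j"] that \<sigma>0 by (simp add: mult.assoc mult_left_mono)
    also have "sqnorm a * moment T a (q - 1) \<le> sqnorm a * (moment T a q / l)"
      using moment_Suc_ge[of a "q - 1"] that l_pos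
      by (intro mult_left_mono sqnorm_nonneg) (simp add: pos_le_divide_eq mult.commute)
    also have "\<dots> = (\<sigma> - 1) * moment T a q" by (simp add: \<sigma>_def)
    finally show ?thesis using \<sigma>0 by (simp add: mult_left_mono)
  qed
  have "moment X a q \<le> moment T a q + (\<Sum>j<q. \<sigma> ^ j * ((\<sigma> - 1) * moment T a q))"
    unfolding moment_X[of q] using * by (intro add_left_mono sum_mono) simp
  also have "\<dots> = moment T a q + ((\<sigma> - 1) * (\<Sum>j<q. \<sigma> ^ j)) * moment T a q"
    by (simp add: sum_distrib_left sum_distrib_right mult_ac)
  also have "(\<sigma> - 1) * (\<Sum>j<q. \<sigma> ^ j) = \<sigma> ^ q - 1"
    by (rule power_diff_1_eq[symmetric])
  finally show ?case by (simp add: \<sigma>_def algebra_simps)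
qed

text \<open>The trace of each telescoped term T^i a a^H X^j is <T^i a, X^j a>. A product of two
  positive operators can have a negative quadratic form, but these two differ only by a a^H:
  expanding X^j once more leaves products of nonnegative moments at \<open>a\<close>.\<close>

lemma trace_X_ge: "trace (T ^^ q) \<le> trace (X ^^ q)"
proof -
  have sum_eq: "(\<Sum>b\<in>B. ip ((X ^^ j) (unit_vec b)) a * ip ((T ^^ i) a) (unit_vec b))
      = ip ((T ^^ i) a) ((X ^^ j) a)" for i j
    unfolding ip_def[of "(T ^^ i) a" "(X ^^ j) a"]
    by (intro sum.cong refl)
       (simp add: self_adjD[OF self_adj_funpow[OF sa_X]] ip_unit_left ip_unit_right mult.commute)
  have nn: "0 \<le> Re (ip ((T ^^ i) a) ((X ^^ j) a))" for i j
  proof -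
    have e: "ip ((T ^^ n) a) ((T ^^ i) a) = of_real (moment T a (i + n))" for n
      by (simp add: ip_funpow_add[OF sa] moment_eq[OF sa])
    have "ip ((X ^^ j) a) ((T ^^ i) a) = of_real (moment T a (i + j)
        + (\<Sum>k<j. moment X a k * moment T a (i + (j - 1 - k))))"
      by (subst ip_X_funpow) (simp add: e moment_eq[OF sa_X])
    then have "Re (ip ((X ^^ j) a) ((T ^^ i) a)) \<ge> 0"
      by (auto intro!: add_nonneg_nonneg sum_nonneg mult_nonneg_nonneg moment_nonneg moment_X_nonneg)
    then show ?thesis using ip_commute[of "(T ^^ i) a" "(X ^^ j) a"] by simp
  qed
  have "(\<Sum>b\<in>B. ip ((X ^^ q) (unit_vec b)) (unit_vec b))
      = (\<Sum>b\<in>B. ip ((T ^^ q) (unit_vec b)) (unit_vec b))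
        + (\<Sum>j<q. ip ((T ^^ (q - 1 - j)) a) ((X ^^ j) a))"
    unfolding ip_X_funpow[of q] sum.distrib sum_eq[symmetric] by (simp add: sum.swap[of _ B])
  then have "trace (X ^^ q) = trace (T ^^ q) + (\<Sum>j<q. Re (ip ((T ^^ (q - 1 - j)) a) ((X ^^ j) a)))"
    by (simp add: trace_def flip: Re_sum)
  then show ?thesis using nn by (simp add: sum_nonneg)
qed

end

lemma borel_measurable_cnj [measurable (raw)]:
  "f \<in> borel_measurable M \<Longrightarrow> (\<lambda>x. cnj (f x)) \<in> borel_measurable M"
  using measurable_compose[of f M borel cnj borel]
  by (simp add: borel_measurable_continuous_onI continuous_on_cnj)

context positive_op
begin

text \<open>A vector violating the bound would, by Jensen, have a moment of order 2n of at least
  c^(2n) times its squared norm, which the trace forbids. One scalar condition thus controls all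
  \<open>u\<close> simultaneously.\<close>

lemma quadratic_form_le_of_trace:
  assumes tr: "trace (T ^^ (2 * n)) < c ^ (2 * n)" and c: "0 \<le> c"
  shows "Re (ip (T u) u) \<le> c * sqnorm u"
proof (rule ccontr)
  assume *: "\<not> ?thesis"
  have "sqnorm u \<noteq> 0"
  proof
    assume 0: "sqnorm u = 0" 
    have "ip (T u) u = 0"
      unfolding self_adjD[OF sa] by (rule ip_zero_left) fact
    then show False using * by (simp add: 0)
  qed
  then have u: "0 < sqnorm u" using sqnorm_nonneg[of u] by linarith
  have 1: "c * sqnorm u \<le> Re (ip (T u) u)" using * by linarith
  have "c ^ (2 * n) * sqnorm u \<le> moment T u (2 * n)"
    by (rule moment_power_le[OF 1 c])
  also have "\<dots> \<le> trace (T ^^ (2 * n)) * sqnorm u"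
    by (rule moment_even_le_trace)
  finally have "c ^ (2 * n) \<le> trace (T ^^ (2 * n))"
    by (rule mult_right_le_imp_le) (rule u)
  then show False using tr by linarith
qed

end

text \<open>Unimodular entries make the squared norm of every sample equal to \<open>card B\<close>;
  \<open>isotropic\<close> says that the mean of a a^H is the identity.\<close>

locale isotropic_vectors = finite_index B + prob_space \<mu> for B :: "'b set" and \<mu> :: "'x measure" +
  fixes a :: "'x \<Rightarrow> 'b \<Rightarrow> complex"
  assumes measurable_a: "\<And>b. b \<in> B \<Longrightarrow> (\<lambda>x. a x b) \<in> borel_measurable \<mu>"
    and cmod_a: "\<And>x b. b \<in> B \<Longrightarrow> cmod (a x b) = 1"
    and isotropic: "\<And>b c. b \<in> B \<Longrightarrow> c \<in> B \<Longrightarrow>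
      (LINT x|\<mu>. a x b * cnj (a x c)) = (if b = c then 1 else 0)"
begin

text \<open>The sign \<open>s\<close> is 1 for the upper tail and -1 for the lower one. The index
  set \<open>R\<close> is explicit so that a single summand can be left out while \<open>x\<close>
  stays the same.\<close>

definition frame_op :: "real \<Rightarrow> real \<Rightarrow> nat set \<Rightarrow> (nat \<Rightarrow> 'x) \<Rightarrow> ('b \<Rightarrow> complex) \<Rightarrow> 'b \<Rightarrow> complex" where
  "frame_op c s R x u = (\<lambda>b. of_real c * u b + of_real s * (\<Sum>r\<in>R. ip u (a (x r)) * a (x r) b))"

lemma sqnorm_a: "sqnorm (a y) = real (card B)"
  by (simp add: sqnorm_def cmod_a)

lemma ip_frame_op:
  "ip (frame_op c s R x u) v = of_real c * ip u v + of_real s * (\<Sum>r\<in>R. ip u (a (x r)) * ip (a (x r)) v)"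
  by (simp add: frame_op_def ip_add_left ip_scale_left ip_sum_left)

lemma self_adj_frame_op: "self_adj (frame_op c s R x)"
proof -
  have "ip u (frame_op c s R x v) = of_real c * ip u v + of_real s * (\<Sum>r\<in>R. ip u (a (x r)) * ip (a (x r)) v)"
    for u v
  proof -
    have "ip u (frame_op c s R x v) = cnj (ip (frame_op c s R x v) u)" by (rule ip_commute)
    also have "\<dots> = of_real c * cnj (ip v u) + of_real s * (\<Sum>r\<in>R. cnj (ip v (a (x r))) * cnj (ip (a (x r)) u))"
      by (simp add: ip_frame_op)
    finally show ?thesis by (simp add: ip_commute[symmetric] mult.commute)
  qed
  then show ?thesis by (simp add: self_adj_def ip_frame_op)
qed

lemma quadratic_form_frame_op:
  "Re (ip (frame_op c s R x u) u) = c * sqnorm u + s * (\<Sum>r\<in>R. (cmod (ip u (a (x r))))\<^sup>2)"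
proof -
  have "ip u (a y) * ip (a y) u = of_real ((cmod (ip u (a y)))\<^sup>2)" for y
    using ip_commute[of "a y" u] by (simp add: complex_norm_square del: of_real_power)
  then show ?thesis by (simp add: ip_frame_op ip_self del: of_real_power flip: of_real_sum)
qed

lemma positive_op_add:
  assumes "0 < c"
  shows "positive_op B (frame_op c 1 R x) c"
  by standard (use assms in \<open>simp_all add: self_adj_frame_op quadratic_form_frame_op sum_nonneg\<close>)

text \<open>Each a a^H is at most |a|^2 = \<open>card B\<close> times the identity, so subtracting
  \<open>card R\<close> of them from \<open>c\<close> leaves this lower bound.\<close>

lemma positive_op_diff:
  assumes "real (card R) * real (card B) < c"
  shows "positive_op B (frame_op c (- 1) R x) (c - real (card R) * real (card B))"
proof
  fix u
  have "(\<Sum>r\<in>R. (cmod (ip u (a (x r))))\<^sup>2) \<le> (\<Sum>r\<in>R. real (card B) * sqnorm u)"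
    using cmod_ip_le[of u "a _"] by (intro sum_mono) (simp add: sqnorm_a mult.commute)
  then show "(c - real (card R) * real (card B)) * sqnorm u \<le> Re (ip (frame_op c (- 1) R x u) u)"
    by (simp add: quadratic_form_frame_op algebra_simps)
qed (use assms in \<open>simp_all add: self_adj_frame_op\<close>)

lemma rank_one_add:
  assumes "0 < c" "finite I" "r \<in> I"
  shows "rank_one_update B (frame_op c 1 (I - {r}) x) c (frame_op c 1 I x) (a (x r))"
proof -
  interpret positive_op B "frame_op c 1 (I - {r}) x" c by (rule positive_op_add) fact
  show ?thesis by standard (use assms in \<open>simp add: frame_op_def sum.remove[of I r]\<close>)
qed

text \<open>With the minus sign, deleting a summand adds a a^H. Hence the full operator is the base
  of the update and the reduced operator is its result, opposite to
  \<open>rank_one_add\<close>.\<close>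

lemma rank_one_diff:
  assumes "real (card I) * real (card B) < c" "finite I" "r \<in> I"
  shows "rank_one_update B (frame_op c (- 1) I x) (c - real (card I) * real (card B))
           (frame_op c (- 1) (I - {r}) x) (a (x r))"
proof -
  interpret positive_op B "frame_op c (- 1) I x" "c - real (card I) * real (card B)"
    by (rule positive_op_diff) fact
  show ?thesis by standard (use assms in \<open>simp add: frame_op_def sum.remove[of I r] algebra_simps\<close>)
qed

text \<open>Only the outermost factor is written out; cyclicity of the trace turns its summand a a^H
  into <X^q a, a>.\<close>

lemma trace_frame_op_Suc:
  "trace (frame_op c s I x ^^ Suc q)
     = c * trace (frame_op c s I x ^^ q) + s * (\<Sum>r\<in>I. moment (frame_op c s I x) (a (x r)) q)"
proof -
  let ?X = "frame_op c s I x"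
  have sa: "self_adj (?X ^^ q)" by (rule self_adj_funpow) (rule self_adj_frame_op)
  have *: "(\<Sum>b\<in>B. ip ((?X ^^ q) (unit_vec b)) v * ip v (unit_vec b)) = ip ((?X ^^ q) v) v" for v
    unfolding self_adjD[OF sa] ip_def[of v "(?X ^^ q) v"]
    by (intro sum.cong refl) (simp add: ip_unit_left ip_unit_right)
  have "(\<Sum>b\<in>B. ip ((?X ^^ Suc q) (unit_vec b)) (unit_vec b))
      = of_real c * (\<Sum>b\<in>B. ip ((?X ^^ q) (unit_vec b)) (unit_vec b))
        + of_real s * (\<Sum>r\<in>I. \<Sum>b\<in>B. ip ((?X ^^ q) (unit_vec b)) (a (x r)) * ip (a (x r)) (unit_vec b))"
    by (simp add: ip_frame_op sum.distrib sum_distrib_left sum.swap[of _ I])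
  then have "Re (\<Sum>b\<in>B. ip ((?X ^^ Suc q) (unit_vec b)) (unit_vec b))
      = Re (of_real c * (\<Sum>b\<in>B. ip ((?X ^^ q) (unit_vec b)) (unit_vec b))
        + of_real s * (\<Sum>r\<in>I. ip ((?X ^^ q) (a (x r))) (a (x r))))"
    unfolding * by simp
  then show ?thesis by (simp add: trace_def moment_def)
qed

text \<open>This separates the entries of \<open>v\<close> from the matrix entries of T^q. When
  \<open>T\<close> is independent of \<open>v\<close>, the expectation factors through the second
  moments of \<open>v\<close>.\<close>

lemma moment_expand:
  assumes "self_adj T"
  shows "moment T v q = Re (\<Sum>c\<in>B. \<Sum>b\<in>B. v b * cnj (v c) * cnj ((T ^^ q) (unit_vec c) b))"
proof -
  have "ip ((T ^^ q) v) v = (\<Sum>c\<in>B. (T ^^ q) v c * cnj (v c))" by (simp add: ip_def)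
  also have "\<dots> = (\<Sum>c\<in>B. ip v ((T ^^ q) (unit_vec c)) * cnj (v c))"
    using self_adjD[OF self_adj_funpow[OF assms]] by (intro sum.cong refl) (metis ip_unit_right)
  also have "\<dots> = (\<Sum>c\<in>B. \<Sum>b\<in>B. v b * cnj (v c) * cnj ((T ^^ q) (unit_vec c) b))"
    by (simp add: ip_def sum_distrib_left sum_distrib_right mult_ac)
  finally show ?thesis by (simp add: moment_def)
qed

lemma trace_expand:
  assumes "self_adj T"
  shows "trace (T ^^ q) = Re (\<Sum>c\<in>B. cnj ((T ^^ q) (unit_vec c) c))"
  by (simp add: trace_def ip_unit_right)

lemma measurable_a_component:
  assumes "r \<in> I" "b \<in> B"
  shows "(\<lambda>x. a (x r) b) \<in> borel_measurable (PiM I (\<lambda>_. \<mu>))"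
  using measurable_compose[OF measurable_component_singleton[OF assms(1), of "\<lambda>_. \<mu>"] measurable_a[OF assms(2)]] .

lemma measurable_frame_op:
  assumes "R \<subseteq> I" "b \<in> B"
  shows "(\<lambda>x. (frame_op c s R x ^^ q) u b) \<in> borel_measurable (PiM I (\<lambda>_. \<mu>))"
  using assms(2)
proof (induction q arbitrary: b)
  case (Suc q)
  have [measurable]: "(\<lambda>x. a (x r) b) \<in> borel_measurable (PiM I (\<lambda>_. \<mu>))" if "r \<in> R" "b \<in> B" for r b
    by (rule measurable_a_component) (use that assms in auto)
  have [measurable]: "(\<lambda>x. (frame_op c s R x ^^ q) u b) \<in> borel_measurable (PiM I (\<lambda>_. \<mu>))" if "b \<in> B" for b
    using that by (rule Suc.IH)
  have "(\<lambda>x. of_real c * (frame_op c s R x ^^ q) u b + of_real s *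
      (\<Sum>r\<in>R. (\<Sum>b\<in>B. (frame_op c s R x ^^ q) u b * cnj (a (x r) b)) * a (x r) b))
    \<in> borel_measurable (PiM I (\<lambda>_. \<mu>))"
    using Suc.prems
    by (intro borel_measurable_add borel_measurable_times borel_measurable_sum borel_measurable_const
        borel_measurable_cnj) measurable
  then show ?case
    by (simp add: frame_op_def[of c s R _ "(frame_op c s R _ ^^ q) u"] ip_def)
qed simp

text \<open>The bound is uniform in \<open>x\<close> because the entries of \<open>a\<close> are
  unimodular; on a probability space boundedness and measurability settle all integrability
  questions.\<close>

lemma bounded_frame_op: "\<exists>C\<ge>0. \<forall>x. \<forall>b\<in>B. cmod ((frame_op c s R x ^^ q) u b) \<le> C"
proof (induction q)
  case 0
  have "\<forall>b\<in>B. cmod (u b) \<le> (\<Sum>b\<in>B. cmod (u b))"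
    using finite_B by (auto intro: member_le_sum)
  then show ?case by (auto intro!: exI[of _ "\<Sum>b\<in>B. cmod (u b)"] sum_nonneg)
next
  case (Suc q)
  then obtain C where C: "C \<ge> 0" "\<And>x b. b \<in> B \<Longrightarrow> cmod ((frame_op c s R x ^^ q) u b) \<le> C" by blast
  define D where "D = \<bar>c\<bar> * C + \<bar>s\<bar> * (real (card R) * (real (card B) * C))"
  have "cmod ((frame_op c s R x ^^ Suc q) u b) \<le> D" if b: "b \<in> B" for x b
  proof -
    have ip: "cmod (ip ((frame_op c s R x ^^ q) u) (a (x r))) \<le> real (card B) * C" for r
    proof -
      have "cmod (ip ((frame_op c s R x ^^ q) u) (a (x r))) \<le> (\<Sum>b\<in>B. C)"
        unfolding ip_def using C by (intro sum_norm_le) (simp add: norm_mult cmod_a)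
      then show ?thesis by simp
    qed
    have "cmod (\<Sum>r\<in>R. ip ((frame_op c s R x ^^ q) u) (a (x r)) * a (x r) b) \<le> (\<Sum>r\<in>R. real (card B) * C)"
      using ip b by (intro sum_norm_le) (simp add: norm_mult cmod_a)
    then have 1: "\<bar>s\<bar> * cmod (\<Sum>r\<in>R. ip ((frame_op c s R x ^^ q) u) (a (x r)) * a (x r) b)
        \<le> \<bar>s\<bar> * (real (card R) * (real (card B) * C))"
      by (intro mult_left_mono) simp_all
    have 2: "\<bar>c\<bar> * cmod ((frame_op c s R x ^^ q) u b) \<le> \<bar>c\<bar> * C"
      using C(2)[OF b] by (intro mult_left_mono) simp_all
    have "(frame_op c s R x ^^ Suc q) u b = of_real c * (frame_op c s R x ^^ q) u b
        + of_real s * (\<Sum>r\<in>R. ip ((frame_op c s R x ^^ q) u) (a (x r)) * a (x r) b)"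
      by (simp add: frame_op_def[of c s R x "(frame_op c s R x ^^ q) u"])
    then have "cmod ((frame_op c s R x ^^ Suc q) u b) \<le> \<bar>c\<bar> * cmod ((frame_op c s R x ^^ q) u b)
        + \<bar>s\<bar> * cmod (\<Sum>r\<in>R. ip ((frame_op c s R x ^^ q) u) (a (x r)) * a (x r) b)"
      using norm_triangle_ineq[of "of_real c * (frame_op c s R x ^^ q) u b"
          "of_real s * (\<Sum>r\<in>R. ip ((frame_op c s R x ^^ q) u) (a (x r)) * a (x r) b)"]
      by (simp only: norm_mult norm_of_real)
    also have "\<dots> \<le> D" unfolding D_def by (rule add_mono[OF 2 1])
    finally show ?thesis .
  qed
  moreover have "D \<ge> 0" using C by (simp add: D_def)
  ultimately show ?case by blast
qed

lemma integrable_frame_op: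
  assumes "R \<subseteq> I" "b \<in> B" "finite I"
  shows "integrable (PiM I (\<lambda>_. \<mu>)) (\<lambda>x. (frame_op c s R x ^^ q) u b)"
proof -
  interpret P: prob_space "PiM I (\<lambda>_. \<mu>)" by (rule prob_space_PiM) (rule prob_space_axioms)
  obtain C where "\<And>x. cmod ((frame_op c s R x ^^ q) u b) \<le> C"
    using bounded_frame_op[where c = c and s = s and R = R and q = q and u = u] assms(2) by blast
  then show ?thesis
    by (intro P.integrable_const_bound[of _ C] measurable_frame_op assms) simp
qed

lemma integrable_trace_frame_op:
  assumes "R \<subseteq> I" "finite I"
  shows "integrable (PiM I (\<lambda>_. \<mu>)) (\<lambda>x. trace (frame_op c s R x ^^ q))"
  unfolding trace_expand[OF self_adj_frame_op]
  by (intro integrable_Re Bochner_Integration.integrable_sum integrable_cnj integrable_frame_op)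
     (use assms in auto)

lemma integrable_weighted_frame_op:
  assumes "R \<subseteq> I" "b \<in> B" "d \<in> B" "e \<in> B" "finite I" "r \<in> I"
  shows "integrable (PiM I (\<lambda>_. \<mu>)) (\<lambda>x. a (x r) b * cnj (a (x r) d) * cnj ((frame_op c s R x ^^ q) u e))"
proof -
  interpret P: prob_space "PiM I (\<lambda>_. \<mu>)" by (rule prob_space_PiM) (rule prob_space_axioms)
  obtain C where "\<And>x. cmod ((frame_op c s R x ^^ q) u e) \<le> C"
    using bounded_frame_op[where c = c and s = s and R = R and q = q and u = u] assms by blast
  moreover have [measurable]: "(\<lambda>x. a (x r) b) \<in> borel_measurable (PiM I (\<lambda>_. \<mu>))" if "b \<in> B" for b
    by (rule measurable_a_component) (use that assms in auto)
  moreover have [measurable]: "(\<lambda>x. (frame_op c s R x ^^ q) u e) \<in> borel_measurable (PiM I (\<lambda>_. \<mu>))"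
    by (rule measurable_frame_op) fact+
  ultimately show ?thesis
    using assms(2,3) by (intro P.integrable_const_bound[of _ C]) (simp_all add: norm_mult cmod_a)
qed

lemma integrable_moment_frame_op:
  assumes "R \<subseteq> I" "finite I" "r \<in> I"
  shows "integrable (PiM I (\<lambda>_. \<mu>)) (\<lambda>x. moment (frame_op c s R x) (a (x r)) q)"
  unfolding moment_expand[OF self_adj_frame_op]
  by (intro integrable_Re Bochner_Integration.integrable_sum integrable_weighted_frame_op) (use assms in auto)

text \<open>As r is not in \<open>R\<close>, the operator does not depend on the coordinate x r.
  Integrating that coordinate first replaces a a^H by the identity, and <X^q a, a> becomes the trace
  of X^q.\<close>

lemma expectation_moment:
  assumes "finite I" "r \<in> I" "R \<subseteq> I" "r \<notin> R"
  shows "(LINT x|PiM I (\<lambda>_. \<mu>). moment (frame_op c s R x) (a (x r)) q)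
       = (LINT x|PiM I (\<lambda>_. \<mu>). trace (frame_op c s R x ^^ q))"
proof -
  interpret P: product_prob_space "\<lambda>_. \<mu>" I by standard
  let ?J = "I - {r}" and ?F = "\<lambda>d b x. cnj ((frame_op c s R x ^^ q) (unit_vec d) b)"
  have I: "I = insert r ?J" and J: "finite ?J" "r \<notin> ?J" using assms by auto
  have F: "?F d b (x(r := y)) = ?F d b x" for d b x y
  proof -
    have "frame_op c s R (x(r := y)) = frame_op c s R x"
      unfolding frame_op_def using assms(4) by (intro ext) (auto intro!: sum.cong)
    then show ?thesis by simp
  qed
  have split: "(LINT x|PiM I (\<lambda>_. \<mu>). f x) = (LINT x|PiM ?J (\<lambda>_. \<mu>). LINT y|\<mu>. f (x(r := y)))"
    if "integrable (PiM I (\<lambda>_. \<mu>)) f" for f :: "_ \<Rightarrow> complex"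
    using P.product_integral_insert[OF J, of f] that I by simp
  have int_F: "(LINT x|PiM I (\<lambda>_. \<mu>). ?F d b x) = (LINT x|PiM ?J (\<lambda>_. \<mu>). ?F d b x)" if "b \<in> B" for d b
    by (subst split) (use that assms in \<open>simp_all add: F integrable_cnj integrable_frame_op prob_space\<close>)
  have main: "(LINT x|PiM I (\<lambda>_. \<mu>). a (x r) b * cnj (a (x r) d) * ?F d b x)
      = (if b = d then LINT x|PiM I (\<lambda>_. \<mu>). ?F d b x else 0)" if "b \<in> B" "d \<in> B" for b d
  proof -
    have "(LINT x|PiM I (\<lambda>_. \<mu>). a (x r) b * cnj (a (x r) d) * ?F d b x)
        = (LINT x|PiM ?J (\<lambda>_. \<mu>). LINT y|\<mu>. a y b * cnj (a y d) * ?F d b x)"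
      by (subst split) (use that assms in \<open>simp_all add: F integrable_weighted_frame_op\<close>)
    also have "\<dots> = (LINT x|PiM ?J (\<lambda>_. \<mu>). (if b = d then 1 else 0) * ?F d b x)"
      using isotropic[OF that] by simp
    finally show ?thesis unfolding int_F[OF that(1)] by (cases "b = d") simp_all
  qed
  have "(LINT x|PiM I (\<lambda>_. \<mu>). moment (frame_op c s R x) (a (x r)) q)
      = Re (\<Sum>d\<in>B. \<Sum>b\<in>B. LINT x|PiM I (\<lambda>_. \<mu>). a (x r) b * cnj (a (x r) d) * ?F d b x)"
    unfolding moment_expand[OF self_adj_frame_op]
    by (subst integral_Re)
       (use assms in \<open>simp_all add: integrable_weighted_frame_op Bochner_Integration.integral_sum\<close>)
  also have "\<dots> = Re (\<Sum>d\<in>B. \<Sum>b\<in>B. if b = d then LINT x|PiM I (\<lambda>_. \<mu>). ?F d b x else 0)"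
    by (intro arg_cong[of _ _ Re] sum.cong refl main)
  also have "\<dots> = Re (\<Sum>d\<in>B. LINT x|PiM I (\<lambda>_. \<mu>). ?F d d x)"
    using finite_B by simp
  also have "\<dots> = (LINT x|PiM I (\<lambda>_. \<mu>). trace (frame_op c s R x ^^ q))"
    unfolding trace_expand[OF self_adj_frame_op]
    by (subst integral_Re)
       (use assms in \<open>simp_all add: integrable_cnj integrable_frame_op Bochner_Integration.integral_sum del: Complex.Re_sum\<close>)
  finally show ?thesis .
qed

end

subsection \<open>A matrix Chernoff inequality\<close>

context isotropic_vectors
begin

definition expected_trace :: "nat \<Rightarrow> real \<Rightarrow> real \<Rightarrow> nat \<Rightarrow> real" where
  "expected_trace m c s q = (LINT x|PiM {1..m} (\<lambda>_. \<mu>). trace (frame_op c s {1..m} x ^^ q))"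

lemma expected_trace_0: "expected_trace m c s 0 = real (card B)"
proof -
  interpret P: prob_space "PiM {1..m} (\<lambda>_. \<mu>)" by (rule prob_space_PiM) (rule prob_space_axioms)
  have "trace (T ^^ 0) = real (card B)" for T
    by (simp only: trace_moment moment_0) (simp add: sqnorm_unit_vec)
  then show ?thesis by (simp add: expected_trace_def P.prob_space del: One_nat_def)
qed

lemma expected_trace_Suc:
  "expected_trace m c s (Suc q) = c * expected_trace m c s q
     + s * (\<Sum>r=1..m. LINT x|PiM {1..m} (\<lambda>_. \<mu>). moment (frame_op c s {1..m} x) (a (x r)) q)"
  unfolding expected_trace_def trace_frame_op_Suc
  by (subst Bochner_Integration.integral_add)
     (auto intro!: integrable_mult_right Bochner_Integration.integrable_sum
       simp: integrable_trace_frame_op integrable_moment_frame_op Bochner_Integration.integral_sum)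

text \<open>For each r: drop a_r from the operator at the cost of a q-th power
  (\<open>moment_X_le\<close>), average over x r (\<open>expectation_moment\<close>), then put a_r
  back, which can only increase the trace (\<open>trace_X_ge\<close>).\<close>

lemma expected_trace_add_Suc_le:
  assumes c: "0 < c"
  shows "expected_trace m c 1 (Suc q)
    \<le> (c + real m * (1 + real (card B) / c) ^ q) * expected_trace m c 1 q"
proof -
  let ?I = "{1..m}" and ?\<sigma> = "1 + real (card B) / c"
  have "(LINT x|PiM ?I (\<lambda>_. \<mu>). moment (frame_op c 1 ?I x) (a (x r)) q) \<le> ?\<sigma> ^ q * expected_trace m c 1 q"
    if r: "r \<in> ?I" for r
  proof -
    have "(LINT x|PiM ?I (\<lambda>_. \<mu>). moment (frame_op c 1 ?I x) (a (x r)) q)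
        \<le> (LINT x|PiM ?I (\<lambda>_. \<mu>). ?\<sigma> ^ q * moment (frame_op c 1 (?I - {r}) x) (a (x r)) q)"
    proof (rule integral_mono)
      fix x
      interpret rank_one_update B "frame_op c 1 (?I - {r}) x" c "frame_op c 1 ?I x" "a (x r)"
        by (rule rank_one_add) (use c r in auto)
      show "moment (frame_op c 1 ?I x) (a (x r)) q \<le> ?\<sigma> ^ q * moment (frame_op c 1 (?I - {r}) x) (a (x r)) q"
        using moment_X_le[of q] by (simp only: sqnorm_a)
    qed (use r in \<open>auto intro!: integrable_moment_frame_op integrable_mult_right\<close>)
    also have "\<dots> = ?\<sigma> ^ q * (LINT x|PiM ?I (\<lambda>_. \<mu>). trace (frame_op c 1 (?I - {r}) x ^^ q))"
      using r by (simp add: expectation_moment)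
    also have "\<dots> \<le> ?\<sigma> ^ q * expected_trace m c 1 q"
      unfolding expected_trace_def
    proof (intro mult_left_mono integral_mono)
      fix x
      interpret rank_one_update B "frame_op c 1 (?I - {r}) x" c "frame_op c 1 ?I x" "a (x r)"
        by (rule rank_one_add) (use c r in auto)
      show "trace (frame_op c 1 (?I - {r}) x ^^ q) \<le> trace (frame_op c 1 ?I x ^^ q)"
        by (rule trace_X_ge)
    qed (use c in \<open>auto intro!: integrable_trace_frame_op\<close>)
    finally show ?thesis .
  qed
  then have "(\<Sum>r=1..m. LINT x|PiM ?I (\<lambda>_. \<mu>). moment (frame_op c 1 ?I x) (a (x r)) q)
      \<le> (\<Sum>r=1..m. ?\<sigma> ^ q * expected_trace m c 1 q)"
    by (rule sum_mono)
  then show ?thesis by (simp add: expected_trace_Suc algebra_simps)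
qed

text \<open>The sum over r now enters with a minus sign, so the moments need lower bounds. Deleting
  a_r raises the trace, and the deleted operator's moment exceeds the full one's by at most the q-th
  power of 1 + \<open>card B\<close> / h; both comparisons point the right way.\<close>

lemma expected_trace_diff_Suc_le:
  assumes h: "0 < h" and c: "c = h + real m * real (card B)"
  shows "expected_trace m c (- 1) (Suc q)
    \<le> (c - real m * (1 / (1 + real (card B) / h)) ^ q) * expected_trace m c (- 1) q"
proof -
  let ?I = "{1..m}" and ?\<rho> = "1 / (1 + real (card B) / h)"
  have pos: "0 < 1 + real (card B) / h" using h by (simp add: add_pos_nonneg)
  have up: "rank_one_update B (frame_op c (- 1) ?I x) h (frame_op c (- 1) (?I - {r}) x) (a (x r))"
    if "r \<in> ?I" for r x
    using rank_one_diff[of ?I c r x] that h c by simp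
  have "?\<rho> ^ q * expected_trace m c (- 1) q \<le> (LINT x|PiM ?I (\<lambda>_. \<mu>). moment (frame_op c (- 1) ?I x) (a (x r)) q)"
    if r: "r \<in> ?I" for r
  proof -
    have "?\<rho> ^ q * expected_trace m c (- 1) q
       \<le> ?\<rho> ^ q * (LINT x|PiM ?I (\<lambda>_. \<mu>). trace (frame_op c (- 1) (?I - {r}) x ^^ q))"
      unfolding expected_trace_def
    proof (intro mult_left_mono integral_mono)
      fix x
      interpret rank_one_update B "frame_op c (- 1) ?I x" h "frame_op c (- 1) (?I - {r}) x" "a (x r)"
        by (rule up) fact
      show "trace (frame_op c (- 1) ?I x ^^ q) \<le> trace (frame_op c (- 1) (?I - {r}) x ^^ q)"
        by (rule trace_X_ge)
    qed (use pos in \<open>auto intro!: integrable_trace_frame_op\<close>)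
    also have "\<dots> = (LINT x|PiM ?I (\<lambda>_. \<mu>). ?\<rho> ^ q * moment (frame_op c (- 1) (?I - {r}) x) (a (x r)) q)"
      using r by (simp add: expectation_moment)
    also have "\<dots> \<le> (LINT x|PiM ?I (\<lambda>_. \<mu>). moment (frame_op c (- 1) ?I x) (a (x r)) q)"
    proof (rule integral_mono)
      fix x
      interpret rank_one_update B "frame_op c (- 1) ?I x" h "frame_op c (- 1) (?I - {r}) x" "a (x r)"
        by (rule up) fact
      have "?\<rho> ^ q * moment (frame_op c (- 1) (?I - {r}) x) (a (x r)) q
          \<le> ?\<rho> ^ q * ((1 + real (card B) / h) ^ q * moment (frame_op c (- 1) ?I x) (a (x r)) q)"
        using moment_X_le[of q] pos by (intro mult_left_mono) (simp_all only: sqnorm_a, simp)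
      also have "\<dots> = (?\<rho> * (1 + real (card B) / h)) ^ q * moment (frame_op c (- 1) ?I x) (a (x r)) q"
        by (simp only: power_mult_distrib mult.assoc)
      also have "?\<rho> * (1 + real (card B) / h) = 1" using pos by simp
      finally show "?\<rho> ^ q * moment (frame_op c (- 1) (?I - {r}) x) (a (x r)) q
          \<le> moment (frame_op c (- 1) ?I x) (a (x r)) q" by simp
    qed (use r in \<open>auto intro!: integrable_moment_frame_op integrable_mult_right\<close>)
    finally show ?thesis .
  qed
  then have "(\<Sum>r=1..m. ?\<rho> ^ q * expected_trace m c (- 1) q)
      \<le> (\<Sum>r=1..m. LINT x|PiM ?I (\<lambda>_. \<mu>). moment (frame_op c (- 1) ?I x) (a (x r)) q)"
    by (rule sum_mono)
  then show ?thesis by (simp add: expected_trace_Suc algebra_simps)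
qed

lemma expected_trace_nonneg:
  assumes "\<And>x. positive_op B (frame_op c s {1..m} x) l"
  shows "0 \<le> expected_trace m c s q"
  unfolding expected_trace_def trace_moment
  by (intro Bochner_Integration.integral_nonneg sum_nonneg positive_op.moment_nonneg) (rule assms)

lemma power_le_of_step:
  fixes T :: "nat \<Rightarrow> real"
  assumes "\<And>q. q < p \<Longrightarrow> T (Suc q) \<le> C * T q" "0 \<le> C"
  shows "T p \<le> C ^ p * T 0"
proof -
  have "q \<le> p \<Longrightarrow> T q \<le> C ^ q * T 0" for q
  proof (induction q)
    case (Suc q)
    have "T (Suc q) \<le> C * T q" using Suc by (intro assms) simp
    also have "\<dots> \<le> C * (C ^ q * T 0)" using Suc assms(2) by (intro mult_left_mono) auto
    finally show ?case by (simp add: mult.assoc)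
  qed simp
  then show ?thesis by simp
qed

text \<open>All p steps use the largest factor, the one with exponent p; the trace of the identity
  contributes \<open>card B\<close>.\<close>

lemma expected_trace_add_le:
  assumes c: "0 < c"
  shows "expected_trace m c 1 p \<le> (c + real m * (1 + real (card B) / c) ^ p) ^ p * real (card B)"
proof -
  let ?\<sigma> = "1 + real (card B) / c"
  have "expected_trace m c 1 (Suc q) \<le> (c + real m * ?\<sigma> ^ p) * expected_trace m c 1 q" if "q < p" for q
  proof -
    have "?\<sigma> ^ q \<le> ?\<sigma> ^ p" using that c by (intro power_increasing) auto
    then have "c + real m * ?\<sigma> ^ q \<le> c + real m * ?\<sigma> ^ p" by (simp add: mult_left_mono)
    then show ?thesis
      using expected_trace_add_Suc_le[OF c, of m q] expected_trace_nonneg[OF positive_op_add[OF c]]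
      by (meson mult_right_mono order_trans)
  qed
  from power_le_of_step[of p "expected_trace m c 1", OF this] show ?thesis
    using c by (simp add: expected_trace_0)
qed

lemma expected_trace_diff_le:
  assumes h: "0 < h" and c: "c = h + real m * real (card B)" and B: "B \<noteq> {}"
  shows "expected_trace m c (- 1) p
    \<le> (c - real m * (1 / (1 + real (card B) / h)) ^ p) ^ p * real (card B)"
proof -
  let ?\<rho> = "1 / (1 + real (card B) / h)"
  have \<rho>: "0 \<le> ?\<rho>" "?\<rho> \<le> 1"
    using h by (simp_all add: divide_le_eq_1 add_pos_nonneg)
  have nn: "0 \<le> expected_trace m c (- 1) q" for q
    by (rule expected_trace_nonneg[of _ _ _ h]) (use positive_op_diff[of "{1..m}" c] h c in simp)
  have step: "expected_trace m c (- 1) (Suc q) \<le> (c - real m * ?\<rho> ^ p) * expected_trace m c (- 1) q" if "q < p" for q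
  proof -
    have "?\<rho> ^ p \<le> ?\<rho> ^ q" using that \<rho> by (intro power_decreasing) auto
    then have "c - real m * ?\<rho> ^ q \<le> c - real m * ?\<rho> ^ p" by (simp add: mult_left_mono)
    then show ?thesis
      using expected_trace_diff_Suc_le[OF h c, of q] nn[of q]
      by (meson mult_right_mono order_trans)
  qed
  \<comment> \<open>Iterating the step needs a nonnegative factor; for nonempty \<open>B\<close> the
    subtracted amount is at most m \<open>card B\<close>, which is below \<open>c\<close>.\<close>
  have "real m * ?\<rho> ^ p \<le> real m * real (card B)"
  proof (rule mult_left_mono)
    have "?\<rho> ^ p \<le> 1" using \<rho> by (rule power_le_one)
    also have "1 \<le> real (card B)" using B finite_B by (simp add: Suc_le_eq card_gt_0_iff)
    finally show "?\<rho> ^ p \<le> real (card B)" .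
  qed simp
  then have "0 \<le> c - real m * ?\<rho> ^ p" using c h by simp
  from power_le_of_step[of p "expected_trace m c (- 1)", OF step this] show ?thesis
    by (simp add: expected_trace_0)
qed

lemma trace_markov:
  assumes nn: "\<And>x. positive_op B (frame_op c s {1..m} x) l" and d: "0 < d"
    and le: "expected_trace m c s p \<le> C ^ p * real (card B)"
  shows "measure (PiM {1..m} (\<lambda>_. \<mu>)) {x \<in> space (PiM {1..m} (\<lambda>_. \<mu>)). d ^ p \<le> trace (frame_op c s {1..m} x ^^ p)}
    \<le> real (card B) * (C / d) ^ p"
proof -
  have "measure (PiM {1..m} (\<lambda>_. \<mu>)) {x \<in> space (PiM {1..m} (\<lambda>_. \<mu>)). d ^ p \<le> trace (frame_op c s {1..m} x ^^ p)}
      \<le> expected_trace m c s p / d ^ p"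
    unfolding expected_trace_def
  proof (rule integral_Markov_inequality_measure[where A = "{}"])
    show "AE x in PiM {1..m} (\<lambda>_. \<mu>). 0 \<le> trace (frame_op c s {1..m} x ^^ p)"
      unfolding trace_moment by (intro AE_I2 sum_nonneg positive_op.moment_nonneg[OF nn])
  qed (use d in \<open>auto intro!: integrable_trace_frame_op\<close>)
  also have "\<dots> \<le> C ^ p * real (card B) / d ^ p"
    using le d by (intro divide_right_mono) auto
  finally show ?thesis by (simp add: power_divide mult.commute)
qed

text \<open>With c = 8 m \<kappa> / \<alpha> the 4m-th power of 1 + \<kappa> / c is at most exp
  (\<alpha> / 2), hence at most 1 + 3 \<alpha> / 4. The numerator thus falls short of the
  denominator by at least m \<alpha> / 4, and this relative gap is amplified by the outer 4m-th
  power.\<close>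

lemma chernoff_upper_rate:
  fixes m \<kappa> \<alpha> :: real
  assumes "1 \<le> n" "1 \<le> \<kappa>" "0 < \<alpha>" "\<alpha> < 1" and m: "m = real n" and c: "c = 8 * m * \<kappa> / \<alpha>"
  shows "((c + m * (1 + \<kappa> / c) ^ (4 * n)) / (c + (1 + \<alpha>) * m)) ^ (4 * n) \<le> exp (- (m * \<alpha>\<^sup>2 / (10 * \<kappa>)))"
proof -
  have m1: "1 \<le> m" using assms by simp
  have c0: "0 < c" using assms m1 by simp
  define t where "t = \<alpha> / 2"
  have \<kappa>c: "\<kappa> / c = \<alpha> / (8 * m)" using assms m1 by (simp add: c field_simps)
  have "(1 + \<kappa> / c) ^ (4 * n) \<le> exp (\<kappa> / c) ^ (4 * n)"
    using assms c0 by (intro power_mono exp_ge_add_one_self) auto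
  also have "\<dots> = exp t"
    using m1 by (simp add: \<kappa>c t_def m flip: exp_of_nat_mult)
  also have "\<dots> \<le> 1 + t + t\<^sup>2" using assms by (intro exp_bound) (auto simp: t_def)
  also have "\<dots> \<le> 1 + 3 * \<alpha> / 4"
  proof -
    have "\<alpha> * \<alpha> \<le> \<alpha> * 1" using assms by (intro mult_left_mono) auto
    then show ?thesis by (simp add: t_def power2_eq_square)
  qed
  finally have s: "(1 + \<kappa> / c) ^ (4 * n) \<le> 1 + 3 * \<alpha> / 4" .
  define d where "d = c + (1 + \<alpha>) * m"
  have d0: "0 < d" using c0 m1 assms by (simp add: d_def add_pos_pos)
  have "(c + m * (1 + \<kappa> / c) ^ (4 * n)) / d \<le> (d - m * (\<alpha> / 4)) / d"
  proof (rule divide_right_mono)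
    have "m * (1 + \<kappa> / c) ^ (4 * n) \<le> m * (1 + 3 * \<alpha> / 4)" using s m1 by (intro mult_left_mono) auto
    then show "c + m * (1 + \<kappa> / c) ^ (4 * n) \<le> d - m * (\<alpha> / 4)" by (simp add: d_def algebra_simps)
  qed (use d0 in simp)
  also have "\<dots> = 1 + (- (m * \<alpha> / (4 * d)))" using d0 by (simp add: field_simps)
  also have "\<dots> \<le> exp (- (m * \<alpha> / (4 * d)))" by (rule exp_ge_add_one_self)
  finally have "((c + m * (1 + \<kappa> / c) ^ (4 * n)) / d) ^ (4 * n) \<le> exp (- (m * \<alpha> / (4 * d))) ^ (4 * n)"
    using c0 d0 m1 assms by (intro power_mono) (auto intro!: divide_nonneg_nonneg add_nonneg_nonneg mult_nonneg_nonneg)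
  also have "\<dots> = exp (- (m * m * \<alpha> / d))"
    by (simp add: m flip: exp_of_nat_mult)
  also have "\<dots> \<le> exp (- (m * \<alpha>\<^sup>2 / (10 * \<kappa>)))"
  proof -
    \<comment> \<open>Origin of the constant 10: \<alpha> c contributes 8 m \<kappa>, and \<alpha>
      (1 + \<alpha>) m is at most 2 m, hence at most 2 m \<kappa>.\<close>
    have "\<alpha> * d = 8 * m * \<kappa> + \<alpha> * (1 + \<alpha>) * m" using assms by (simp add: d_def c field_simps)
    also have "\<alpha> * (1 + \<alpha>) \<le> 1 * 2" using assms by (intro mult_mono) auto
    then have "8 * m * \<kappa> + \<alpha> * (1 + \<alpha>) * m \<le> 8 * m * \<kappa> + 2 * m" using m1 by (simp add: mult_right_mono)
    also have "m * 1 \<le> m * \<kappa>" using m1 assms by (intro mult_left_mono) auto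
    then have "8 * m * \<kappa> + 2 * m \<le> 10 * \<kappa> * m" by (simp add: algebra_simps)
    finally have ad: "\<alpha> * d \<le> 10 * \<kappa> * m" by simp
    have "m * \<alpha>\<^sup>2 * d = (m * \<alpha>) * (\<alpha> * d)" by (simp add: power2_eq_square)
    also have "\<dots> \<le> (m * \<alpha>) * (10 * \<kappa> * m)" using ad m1 assms by (intro mult_left_mono) auto
    finally have "m * \<alpha>\<^sup>2 / (10 * \<kappa>) \<le> m * m * \<alpha> / d"
      using d0 assms by (simp add: divide_simps mult_ac)
    then show ?thesis by simp
  qed
  finally show ?thesis by (simp add: d_def)
qed

text \<open>The spectral floor is h = c - m \<kappa>, at least 7 m \<kappa> / \<alpha>. Bernoulli's
  inequality then keeps the 4m-th power of \<rho> above 1 - 4 \<alpha> / 7, leaving a gap of 3 m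
  \<alpha> / 7 in the numerator.\<close>

lemma chernoff_lower_rate:
  fixes m \<kappa> \<alpha> :: real
  assumes "1 \<le> n" "1 \<le> \<kappa>" "0 < \<alpha>" "\<alpha> < 1" and m: "m = real n" and c: "c = 8 * m * \<kappa> / \<alpha>"
    and h: "h = c - m * \<kappa>"
  shows "((c - m * (1 / (1 + \<kappa> / h)) ^ (4 * n)) / (c - (1 - \<alpha>) * m)) ^ (4 * n) \<le> exp (- (m * \<alpha>\<^sup>2 / (10 * \<kappa>)))"
proof -
  have m1: "1 \<le> m" using assms by simp
  have c0: "0 < c" using assms m1 by simp
  have "m * \<kappa> * \<alpha> \<le> m * \<kappa> * 1" using m1 assms by (intro mult_left_mono) auto
  then have h7: "7 * m * \<kappa> / \<alpha> \<le> h" using assms by (simp add: h c field_simps)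
  then have h0: "0 < h" using m1 assms by (intro less_le_trans[OF _ h7]) simp
  have hm: "7 * m * \<kappa> \<le> h * \<alpha>" using h7 assms by (simp add: divide_le_eq)
  define \<rho> where "\<rho> = 1 / (1 + \<kappa> / h)"
  have \<rho>_eq: "\<rho> = h / (h + \<kappa>)" using h0 by (simp add: \<rho>_def field_simps)
  have \<rho>01: "0 \<le> \<rho>" "\<rho> \<le> 1" using h0 assms by (auto simp: \<rho>_eq divide_le_eq)
  have "\<kappa> / h * (7 * m) \<le> \<alpha>" using hm h0 by (simp add: field_simps)
  from mult_right_mono[OF this, of "4 / 7"] have \<kappa>h: "4 * m * (\<kappa> / h) \<le> 4 * \<alpha> / 7"
    by (simp add: mult_ac)
  have "1 - 4 * \<alpha> / 7 \<le> 1 + real (4 * n) * (- (\<kappa> / h))" using \<kappa>h by (simp add: m)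
  also have "\<dots> \<le> (1 + - (\<kappa> / h)) ^ (4 * n)"
  proof (rule Bernoulli_inequality)
    have "4 * (\<kappa> / h) \<le> 4 * m * (\<kappa> / h)" using m1 h0 assms by (intro mult_right_mono) auto
    then show "- 1 \<le> - (\<kappa> / h)" using \<kappa>h assms by simp
  qed
  also have "\<dots> \<le> \<rho> ^ (4 * n)"
  proof (rule power_mono)
    have "(1 + - (\<kappa> / h)) * (h + \<kappa>) = h - \<kappa> * \<kappa> / h" using h0 by (simp add: field_simps)
    also have "\<dots> \<le> h" using h0 by simp
    finally show "1 + - (\<kappa> / h) \<le> \<rho>"
      unfolding \<rho>_eq using h0 \<open>1 \<le> \<kappa>\<close> by (subst pos_le_divide_eq) auto
    have "4 * (\<kappa> / h) \<le> 4 * m * (\<kappa> / h)" using m1 h0 assms by (intro mult_right_mono) auto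
    then show "0 \<le> 1 + - (\<kappa> / h)" using \<kappa>h assms by simp
  qed
  finally have s: "1 - 4 * \<alpha> / 7 \<le> \<rho> ^ (4 * n)" .
  define d where "d = c - (1 - \<alpha>) * m"
  have "m * 1 \<le> m * \<kappa>" using m1 assms by (intro mult_left_mono) auto
  then have mk: "m \<le> c" using h0 h by simp
  have "0 < \<alpha> * m" using m1 assms by simp
  then have d0: "0 < d" using mk by (simp add: d_def left_diff_distrib)
  have dc: "d \<le> c" using m1 assms by (simp add: d_def)
  have "(c - m * \<rho> ^ (4 * n)) / d \<le> (d - m * (3 * \<alpha> / 7)) / d"
  proof (rule divide_right_mono)
    have "m * (1 - 4 * \<alpha> / 7) \<le> m * \<rho> ^ (4 * n)" using s m1 by (intro mult_left_mono) auto
    then show "c - m * \<rho> ^ (4 * n) \<le> d - m * (3 * \<alpha> / 7)" by (simp add: d_def algebra_simps)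
  qed (use d0 in simp)
  also have "\<dots> = 1 + (- (m * (3 * \<alpha> / 7) / d))" using d0 by (simp add: field_simps)
  also have "\<dots> \<le> exp (- (m * (3 * \<alpha> / 7) / d))" by (rule exp_ge_add_one_self)
  also have "\<dots> \<le> exp (- (m * (3 * \<alpha> / 7) / c))"
  proof -
    have "m * (3 * \<alpha> / 7) / c \<le> m * (3 * \<alpha> / 7) / d"
      using dc d0 c0 m1 \<open>0 < \<alpha>\<close> by (intro divide_left_mono) auto
    then show ?thesis by simp
  qed
  also have "m * (3 * \<alpha> / 7) / c = 3 * \<alpha>\<^sup>2 / (56 * \<kappa>)"
    using m1 assms by (simp add: c field_simps power2_eq_square)
  finally have *: "(c - m * \<rho> ^ (4 * n)) / d \<le> exp (- (3 * \<alpha>\<^sup>2 / (56 * \<kappa>)))" .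
  have "m * \<rho> ^ (4 * n) \<le> m * 1" using power_le_one[OF \<rho>01] m1 by (intro mult_left_mono) auto
  then have "0 \<le> (c - m * \<rho> ^ (4 * n)) / d" using mk d0 by simp
  with * have "((c - m * \<rho> ^ (4 * n)) / d) ^ (4 * n) \<le> exp (- (3 * \<alpha>\<^sup>2 / (56 * \<kappa>))) ^ (4 * n)"
    by (rule power_mono)
  also have "\<dots> = exp (- (m * \<alpha>\<^sup>2 / \<kappa> * (12 / 56)))"
    by (simp add: m field_simps flip: exp_of_nat_mult)
  \<comment> \<open>The rate 12/56 is better than 1/10; it is weakened to match the upper
    tail.\<close>
  also have "\<dots> \<le> exp (- (m * \<alpha>\<^sup>2 / \<kappa> * (1 / 10)))"
    using m1 assms by (simp only: exp_le_cancel_iff neg_le_iff_le) (rule mult_left_mono, auto)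
  also have "m * \<alpha>\<^sup>2 / \<kappa> * (1 / 10) = m * \<alpha>\<^sup>2 / (10 * \<kappa>)" by simp
  finally show ?thesis by (simp only: d_def \<rho>_def)
qed

text \<open>The exceptional set is delivered as an explicit measurable set, cut out by two trace
  conditions, because the bounds themselves range over uncountably many \<open>u\<close>.\<close>

lemma frame_concentration:
  assumes \<alpha>: "0 < \<alpha>" "\<alpha> < 1"
  obtains Bad where "Bad \<in> sets (PiM {1..m} (\<lambda>_. \<mu>))"
    and "measure (PiM {1..m} (\<lambda>_. \<mu>)) Bad \<le> 2 * real (card B) * exp (- (real m * \<alpha>\<^sup>2 / (10 * real (card B))))"
    and "\<And>x u. x \<in> space (PiM {1..m} (\<lambda>_. \<mu>)) \<Longrightarrow> x \<notin> Bad \<Longrightarrow>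
      real m * (1 - \<alpha>) * sqnorm u \<le> (\<Sum>r=1..m. (cmod (ip u (a (x r))))\<^sup>2) \<and>
      (\<Sum>r=1..m. (cmod (ip u (a (x r))))\<^sup>2) \<le> real m * (1 + \<alpha>) * sqnorm u"
proof (cases "m = 0 \<or> B = {}")
  case True
  show ?thesis
    by (rule that[of "{}"]) (use True in \<open>auto simp: ip_def sqnorm_def\<close>)
next
  case False
  let ?P = "PiM {1..m} (\<lambda>_. \<mu>)" and ?\<kappa> = "real (card B)"
  interpret P: prob_space ?P by (rule prob_space_PiM) (rule prob_space_axioms)
  have m: "1 \<le> m" and \<kappa>: "1 \<le> ?\<kappa>"
    using False finite_B by (auto simp: Suc_le_eq card_gt_0_iff)
  \<comment> \<open>\<open>c = p * \<kappa> / t\<close> with exponent \<open>p = 4 * m\<close> and \<open>t = \<alpha> / 2\<close>, so that \<open>(1 \<plusminus> A / c) ^ p\<close>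
    imitates \<open>exp (\<plusminus> t * A / \<kappa>)\<close>.\<close>
  define c where "c = 8 * real m * ?\<kappa> / \<alpha>"
  define h where "h = c - real m * ?\<kappa>"
  have "real m * ?\<kappa> * \<alpha> < real m * ?\<kappa> * 8" using m \<kappa> \<alpha> by (intro mult_strict_left_mono) auto
  then have h: "0 < h" using \<alpha> by (simp add: h_def c_def field_simps)
  have c: "0 < c" using m \<kappa> \<alpha> by (simp add: c_def)
  have ch: "c = h + real m * ?\<kappa>" by (simp add: h_def)
  have pos_add: "positive_op B (frame_op c 1 {1..m} x) c" for x by (rule positive_op_add) (rule c)
  have pos_diff: "positive_op B (frame_op c (- 1) {1..m} x) h" for x
    using positive_op_diff[of "{1..m}" c] h ch by simp
  \<comment> \<open>The thresholds are the shifted targets: c + S <= \<open>cU\<close> says S <= (1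
    + \<alpha>) m, and c - S <= \<open>cL\<close> says S >= (1 - \<alpha>) m.\<close>
  define cU where "cU = c + (1 + \<alpha>) * real m"
  define cL where "cL = c - (1 - \<alpha>) * real m"
  have cU: "0 < cU" using c m \<alpha> by (simp add: cU_def add_pos_pos)
  have "real m * 1 \<le> real m * ?\<kappa>" using \<kappa> by (intro mult_left_mono) auto
  moreover have "0 < \<alpha> * real m" using m \<alpha> by simp
  ultimately have cL: "0 < cL" using h by (simp add: cL_def ch left_diff_distrib)
  define p where "p = 4 * m"
  define BadU where "BadU = {x \<in> space ?P. cU ^ p \<le> trace (frame_op c 1 {1..m} x ^^ p)}"
  define BadL where "BadL = {x \<in> space ?P. cL ^ p \<le> trace (frame_op c (- 1) {1..m} x ^^ p)}"
  have meas: "BadU \<in> sets ?P" "BadL \<in> sets ?P"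
    unfolding BadU_def BadL_def
    by (intro borel_measurable_le borel_measurable_const borel_measurable_integrable
        integrable_trace_frame_op; simp)+
  have "measure ?P BadU \<le> ?\<kappa> * ((c + real m * (1 + ?\<kappa> / c) ^ p) / cU) ^ p"
    unfolding BadU_def by (rule trace_markov[OF pos_add cU expected_trace_add_le[OF c]])
  also have "\<dots> \<le> ?\<kappa> * exp (- (real m * \<alpha>\<^sup>2 / (10 * ?\<kappa>)))"
    unfolding p_def cU_def by (intro mult_left_mono chernoff_upper_rate[OF m \<kappa> \<alpha>]) (auto simp: c_def)
  finally have U: "measure ?P BadU \<le> ?\<kappa> * exp (- (real m * \<alpha>\<^sup>2 / (10 * ?\<kappa>)))" .
  have "measure ?P BadL \<le> ?\<kappa> * ((c - real m * (1 / (1 + ?\<kappa> / h)) ^ p) / cL) ^ p"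
    unfolding BadL_def by (rule trace_markov[OF pos_diff cL expected_trace_diff_le[OF h ch]]) (use False in simp)
  also have "\<dots> \<le> ?\<kappa> * exp (- (real m * \<alpha>\<^sup>2 / (10 * ?\<kappa>)))"
    unfolding p_def cL_def by (intro mult_left_mono chernoff_lower_rate[OF m \<kappa> \<alpha>]) (auto simp: c_def h_def)
  finally have L: "measure ?P BadL \<le> ?\<kappa> * exp (- (real m * \<alpha>\<^sup>2 / (10 * ?\<kappa>)))" .
  \<comment> \<open>\<open>quadratic_form_le_of_trace\<close> applies to even exponents.\<close>
  have p: "p = 2 * (2 * m)" by (simp add: p_def)
  show ?thesis
  proof (rule that[of "BadU \<union> BadL"])
    show "BadU \<union> BadL \<in> sets ?P" using meas by simp
    show "measure ?P (BadU \<union> BadL) \<le> 2 * ?\<kappa> * exp (- (real m * \<alpha>\<^sup>2 / (10 * ?\<kappa>)))"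
      using measure_Un_le[OF meas] U L by linarith
    fix x u assume x: "x \<in> space ?P" "x \<notin> BadU \<union> BadL"
    have "Re (ip (frame_op c 1 {1..m} x u) u) \<le> cU * sqnorm u"
      by (rule positive_op.quadratic_form_le_of_trace[OF pos_add, of "2 * m"])
         (use x cU in \<open>auto simp: BadU_def p not_le\<close>)
    moreover have "Re (ip (frame_op c (- 1) {1..m} x u) u) \<le> cL * sqnorm u"
      by (rule positive_op.quadratic_form_le_of_trace[OF pos_diff, of "2 * m"])
         (use x cL in \<open>auto simp: BadL_def p not_le\<close>)
    ultimately show "real m * (1 - \<alpha>) * sqnorm u \<le> (\<Sum>r=1..m. (cmod (ip u (a (x r))))\<^sup>2) \<and>
      (\<Sum>r=1..m. (cmod (ip u (a (x r))))\<^sup>2) \<le> real m * (1 + \<alpha>) * sqnorm u"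
      by (simp add: quadratic_form_frame_op cU_def cL_def algebra_simps)
  qed
qed

end

subsection \<open>Measure-theoretic preliminaries\<close>

text \<open>After enumerating \<open>A\<close>, every finite index set lies in an initial segment,
  so the supremum over finite sets is the supremum of partial sums.\<close>

lemma infsum_ennreal_eq_suminf:
  fixes f :: "'a \<Rightarrow> ennreal"
  assumes "countable A" "infinite A"
  shows "(\<Sum>\<^sub>\<infinity>l\<in>A. f l) = (\<Sum>n. f (from_nat_into A n))"
proof -
  let ?g = "\<lambda>n. f (from_nat_into A n)"
  have bij: "bij_betw (from_nat_into A) UNIV A"
    using assms by (rule bij_betw_from_nat_into)
  have "(\<Sum>\<^sub>\<infinity>l\<in>A. f l) = infsum ?g UNIV"
    by (rule infsum_reindex_bij_betw[OF bij, symmetric])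
  also have "\<dots> = (SUP F\<in>{F. finite F \<and> F \<subseteq> UNIV}. sum ?g F)"
    by (rule nonneg_infsum_complete) simp
  also have "\<dots> = (SUP n. sum ?g {..<n})"
  proof (rule antisym)
    show "(SUP F\<in>{F. finite F \<and> F \<subseteq> UNIV}. sum ?g F) \<le> (SUP n. sum ?g {..<n})"
    proof (rule SUP_least)
      fix F :: "nat set" assume "F \<in> {F. finite F \<and> F \<subseteq> UNIV}"
      then obtain n where "F \<subseteq> {..<n}" using finite_nat_iff_bounded by auto
      then have "sum ?g F \<le> sum ?g {..<n}" by (intro sum_mono2) auto
      also have "\<dots> \<le> (SUP n. sum ?g {..<n})" by (rule SUP_upper) simp
      finally show "sum ?g F \<le> (SUP n. sum ?g {..<n})" .
    qed
    show "(SUP n. sum ?g {..<n}) \<le> (SUP F\<in>{F. finite F \<and> F \<subseteq> UNIV}. sum ?g F)"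
      by (rule SUP_least, rule SUP_upper) simp
  qed
  also have "\<dots> = (\<Sum>n. ?g n)" by (rule suminf_eq_SUP[symmetric])
  finally show ?thesis .
qed

lemma infsum_eq_nn_integral_count_space:
  fixes f :: "'a \<Rightarrow> ennreal"
  assumes "countable A"
  shows "(\<Sum>\<^sub>\<infinity>l\<in>A. f l) = (\<integral>\<^sup>+l. f l \<partial>count_space A)"
proof (cases "finite A")
  case True
  then show ?thesis by (simp add: nn_integral_count_space_finite)
next
  case False
  have "bij_betw (from_nat_into A) UNIV A"
    using assms False by (rule bij_betw_from_nat_into)
  from nn_integral_bij_count_space[OF this, of f] show ?thesis
    using infsum_ennreal_eq_suminf[OF assms False, of f] by (simp add: nn_integral_count_space_nat)
qed

lemma infsum_nn_integral_swap:
  fixes f :: "'i \<Rightarrow> 'a \<Rightarrow> ennreal"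
  assumes "countable I" "\<And>i. i \<in> I \<Longrightarrow> f i \<in> borel_measurable M"
  shows "(\<integral>\<^sup>+x. (\<Sum>\<^sub>\<infinity>i\<in>I. f i x) \<partial>M) = (\<Sum>\<^sub>\<infinity>i\<in>I. \<integral>\<^sup>+x. f i x \<partial>M)"
  using nn_integral_count_space_nn_integral[of I f M] assms
  by (simp add: infsum_eq_nn_integral_count_space)

lemma infsum_ennreal_measurable:
  fixes f :: "'i \<Rightarrow> 'a \<Rightarrow> ennreal"
  assumes "countable I" "\<And>i. i \<in> I \<Longrightarrow> f i \<in> borel_measurable M"
  shows "(\<lambda>x. \<Sum>\<^sub>\<infinity>i\<in>I. f i x) \<in> borel_measurable M"
proof (cases "finite I")
  case True
  then show ?thesis using assms(2) by simp
next
  case False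
  have [measurable]: "f (from_nat_into I n) \<in> borel_measurable M" for n
    using False by (intro assms(2) from_nat_into) auto
  show ?thesis unfolding infsum_ennreal_eq_suminf[OF assms(1) False] by measurable
qed

text \<open>\<open>lborel\<close> is the image of a product measure indexed by \<open>Basis\<close>;
  the vectors \<open>axis i 1\<close> identify that index set with the coordinates, so Fubini for
  product functions carries over.\<close>

lemma lborel_integral_prod_vec:
  fixes f :: "'d::finite \<Rightarrow> real \<Rightarrow> complex"
  assumes int: "\<And>i. integrable lborel (f i)"
  shows "integrable lborel (\<lambda>x::real^'d. \<Prod>i\<in>UNIV. f i (x $ i))"
    and "(LINT x|lborel. (\<Prod>i\<in>UNIV. f i ((x::real^'d) $ i))) = (\<Prod>i\<in>UNIV. LINT t|lborel. f i t)"
proof -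
  interpret product_sigma_finite "\<lambda>_::real^'d. lborel :: real measure" by standard
  let ?ax = "\<lambda>i. axis i 1 :: real^'d"
  have inj: "inj ?ax" by (auto simp: inj_on_def axis_eq_axis)
  have Basis: "(Basis :: (real^'d) set) = range ?ax" by (auto simp: Basis_vec_def)
  define g where "g b = f (inv ?ax b)" for b
  have g: "g (?ax i) = f i" for i by (simp add: g_def inv_f_f[OF inj])
  have intg: "integrable lborel (g b)" for b by (simp add: g_def int)
  have meas[measurable]: "f i \<in> borel_measurable borel" for i using int[of i] by auto
  let ?P = "PiM (Basis :: (real^'d) set) (\<lambda>_. lborel :: real measure)"
  let ?T = "\<lambda>F. \<Sum>b\<in>Basis. F b *\<^sub>R (b::real^'d)"
  have T: "?T \<in> ?P \<rightarrow>\<^sub>M borel" by measurable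
  have eq: "(\<Prod>i\<in>UNIV. f i (?T F $ i)) = (\<Prod>b\<in>Basis. g b (F b))" for F
  proof -
    have "?T F $ i = F (?ax i)" for i
    proof -
      have "?T F $ i = ?T F \<bullet> ?ax i" by (simp add: cart_eq_inner_axis)
      also have "\<dots> = F (?ax i)" by (rule inner_sum_left_Basis) (simp add: Basis)
      finally show ?thesis .
    qed
    then show ?thesis unfolding Basis by (simp add: prod.reindex[OF inj] g)
  qed
  have m: "(\<lambda>x::real^'d. \<Prod>i\<in>UNIV. f i (x $ i)) \<in> borel_measurable borel" by measurable
  have "integrable ?P (\<lambda>F. \<Prod>b\<in>Basis. g b (F b))"
    by (rule product_integrable_prod) (auto intro: intg)
  then show "integrable lborel (\<lambda>x::real^'d. \<Prod>i\<in>UNIV. f i (x $ i))"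
    by (subst lborel_eq, subst integrable_distr_eq[OF T m]) (simp only: eq)
  have "(LINT x|lborel. (\<Prod>i\<in>UNIV. f i ((x::real^'d) $ i)))
      = (LINT F|?P. (\<Prod>b\<in>Basis. g b (F b)))"
    by (subst lborel_eq, subst integral_distr[OF T m]) (simp only: eq)
  also have "\<dots> = (\<Prod>b\<in>Basis. LINT t|lborel. g b t)"
    by (rule product_integral_prod) (auto intro: intg)
  also have "\<dots> = (\<Prod>i\<in>UNIV. LINT t|lborel. f i t)"
    unfolding Basis by (simp add: prod.reindex[OF inj] g)
  finally show "(LINT x|lborel. (\<Prod>i\<in>UNIV. f i ((x::real^'d) $ i))) = (\<Prod>i\<in>UNIV. LINT t|lborel. f i t)" .
qed

subsection \<open>The integer lattice and the unit cube\<close>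

lemma countable_int_lattice: "countable (int_lattice :: (real^'d) set)"
proof -
  have "(int_lattice :: (real^'d) set) \<subseteq> range (\<lambda>k::int^'d. \<chi> i. of_int (k $ i))"
  proof
    fix l :: "real^'d" assume "l \<in> int_lattice"
    then have "l = (\<chi> i. of_int ((\<chi> i. \<lfloor>l $ i\<rfloor>) $ i))"
      by (auto simp: int_lattice_def vec_eq_iff elim!: allE Ints_cases)
    then show "l \<in> range (\<lambda>k::int^'d. \<chi> i. of_int (k $ i))" by blast
  qed
  then show ?thesis by (rule countable_subset) simp
qed

lemma int_lattice_add: "l \<in> int_lattice \<Longrightarrow> k \<in> int_lattice \<Longrightarrow> l + k \<in> int_lattice"
  by (simp add: int_lattice_def)

lemma int_lattice_diff: "l \<in> int_lattice \<Longrightarrow> k \<in> int_lattice \<Longrightarrow> l - k \<in> int_lattice"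
  by (simp add: int_lattice_def)

lemma int_lattice_minus: "l \<in> int_lattice \<Longrightarrow> - l \<in> int_lattice"
  by (simp add: int_lattice_def)

lemma zero_int_lattice: "0 \<in> int_lattice"
  by (simp add: int_lattice_def)

lemma int_lattice_inner: "l \<in> int_lattice \<Longrightarrow> k \<in> int_lattice \<Longrightarrow> l \<bullet> k \<in> \<int>"
  by (auto simp: int_lattice_def inner_vec_def)

lemma mem_unit_cube: "x \<in> unit_cube \<longleftrightarrow> (\<forall>i. - 1 / 2 \<le> x $ i \<and> x $ i \<le> 1 / 2)"
  by (simp add: unit_cube_def mem_box_cart)

lemma unit_cube_measurable [measurable]: "unit_cube \<in> sets borel"
  by (simp add: unit_cube_def)

lemma emeasure_unit_cube: "emeasure lborel (unit_cube :: (real^'d) set) = 1"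
proof -
  have "(\<chi> i. - 1 / 2) \<bullet> b \<le> ((\<chi> i. 1 / 2) :: real^'d) \<bullet> b" if "b \<in> Basis" for b
    using that by (auto simp: Basis_vec_def inner_axis)
  moreover have "((\<chi> i. 1 / 2) - (\<chi> i. - 1 / 2)) \<bullet> b = (1::real)" if "b \<in> (Basis :: (real^'d) set)" for b
    using that by (auto simp: Basis_vec_def inner_axis inner_diff_left)
  ultimately show ?thesis
    unfolding unit_cube_def by (subst emeasure_lborel_cbox) (simp_all add: inner_diff_left)
qed

text \<open>One measure for two roles: the law of each sample point and the measure for Fourier
  series in the frequency variable.\<close>

definition cube_measure :: "(real^'d) measure" where
  "cube_measure = uniform_measure lborel unit_cube"

lemma sets_cube_measure [simp, measurable_cong]: "sets cube_measure = sets borel"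
  by (simp add: cube_measure_def)

lemma space_cube_measure [simp]: "space cube_measure = UNIV"
  by (simp add: cube_measure_def)

lemma prob_space_cube_measure: "prob_space (cube_measure :: (real^'d) measure)"
  unfolding cube_measure_def by (rule prob_space_uniform_measure) (simp_all add: emeasure_unit_cube)

lemma cube_measure_density: "cube_measure = density lborel (indicator unit_cube)"
  unfolding cube_measure_def uniform_measure_def emeasure_unit_cube
  by (rule arg_cong[of _ _ "density lborel"]) (simp add: fun_eq_iff divide_ennreal_def)

lemma nn_integral_cube_measure:
  assumes "f \<in> borel_measurable borel"
  shows "(\<integral>\<^sup>+x. f x \<partial>cube_measure) = (\<integral>\<^sup>+x. f x * indicator unit_cube x \<partial>lborel)"
  unfolding cube_measure_density using assms by (simp add: nn_integral_density mult.commute)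

lemma integral_cube_measure:
  fixes f :: "real^'d \<Rightarrow> complex"
  assumes "f \<in> borel_measurable borel"
  shows "(LINT x|cube_measure. f x) = (LINT x|lborel. indicator unit_cube x *\<^sub>R f x)"
proof -
  have *: "(cube_measure :: (real^'d) measure) = density lborel (\<lambda>x. ennreal (indicator unit_cube x))"
    by (simp add: cube_measure_density ennreal_indicator)
  show ?thesis unfolding * using assms by (subst integral_density) auto
qed

text \<open>Half-integer coordinates are where lattice translates of the closed cube touch.
  Discarding these countably many hyperplanes makes the tiling unambiguous.\<close>

lemma AE_not_half_integer: "AE x in lborel. \<forall>i. \<forall>n::int. (x::real^'d) $ i \<noteq> of_int n + 1 / 2"
proof -
  have "AE x in lborel. (x::real^'d) $ i \<noteq> c" for i c
  proof -
    have "negligible {x::real^'d. x \<bullet> axis i 1 = c}"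
      by (rule negligible_standard_hyperplane) (auto simp: Basis_vec_def)
    then have "{x::real^'d. x $ i = c} \<in> null_sets lebesgue"
      by (simp add: negligible_iff_null_sets inner_axis)
    moreover have "{x::real^'d. x $ i = c} \<in> sets lborel" by simp
    ultimately have "{x::real^'d. x $ i = c} \<in> null_sets lborel"
      by (simp add: null_sets_def)
    then show ?thesis by (rule AE_I') auto
  qed
  then show ?thesis by (simp add: AE_all_countable)
qed

definition cube_interior :: "(real^'d) set" where
  "cube_interior = {x. \<forall>i. - 1 / 2 < x $ i \<and> x $ i < 1 / 2}"

lemma cube_interior_if_not_boundary:
  assumes "x \<in> unit_cube" "\<And>i. x $ i \<noteq> - 1 / 2" "\<And>i. x $ i \<noteq> 1 / 2"
  shows "x \<in> cube_interior"
  unfolding cube_interior_def mem_Collect_eq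
proof
  fix i
  have "- 1 / 2 \<le> x $ i \<and> x $ i \<le> 1 / 2" using assms(1) by (simp add: mem_unit_cube)
  then show "- 1 / 2 < x $ i \<and> x $ i < 1 / 2" using assms(2)[of i] assms(3)[of i] by linarith
qed

lemma open_cube_interior: "open (cube_interior :: (real^'d) set)"
proof -
  have *: "(cube_interior :: (real^'d) set) = box (\<chi> i. - 1 / 2) (\<chi> i. 1 / 2)"
    by (auto simp: cube_interior_def mem_box_cart)
  show ?thesis unfolding * by (rule open_box)
qed

lemma AE_cube_measure_interior: "AE x in cube_measure. x \<in> cube_interior"
proof -
  have "AE x in lborel. (x::real^'d) \<in> unit_cube \<longrightarrow> x \<in> cube_interior"
    using AE_not_half_integer
  proof eventually_elim
    case (elim x)
    have "x $ i \<noteq> - 1 / 2" "x $ i \<noteq> 1 / 2" for i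
      using elim[rule_format, of i "-1"] elim[rule_format, of i 0] by auto
    then show ?case by (auto intro: cube_interior_if_not_boundary)
  qed
  then show ?thesis
    unfolding cube_measure_density by (subst AE_density) (auto simp: indicator_eq_0_iff elim!: eventually_mono)
qed

text \<open>Strict inequalities at one of the two points already force the integer coordinates of l
  - k to have modulus below 1.\<close>

lemma cube_interior_lattice_unique:
  assumes "x \<in> cube_interior" "y \<in> unit_cube" "x + l = y + k" "l \<in> int_lattice" "k \<in> int_lattice"
  shows "x = y" "l = k"
proof -
  have "l $ i = k $ i" for i
  proof -
    have "x $ i + l $ i = y $ i + k $ i" using assms(3) by (metis vector_add_component)
    moreover have "- 1 / 2 < x $ i \<and> x $ i < 1 / 2" "- 1 / 2 \<le> y $ i \<and> y $ i \<le> 1 / 2"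
      using assms(1,2) by (simp_all add: cube_interior_def mem_unit_cube)
    ultimately have "\<bar>l $ i - k $ i\<bar> < 1" by linarith
    moreover have "l $ i - k $ i \<in> \<int>" using assms(4,5) by (simp add: int_lattice_def)
    ultimately have "l $ i - k $ i = 0" by (rule Ints_nonzero_abs_less1[rotated])
    then show ?thesis by simp
  qed
  then show "l = k" by (simp add: vec_eq_iff)
  then show "x = y" using assms(3) by simp
qed

lemma lattice_translate_exists:
  fixes x :: "real^'d"
  obtains l where "l \<in> int_lattice" "x - l \<in> unit_cube"
proof
  let ?l = "(\<chi> i. real_of_int \<lfloor>x $ i + 1 / 2\<rfloor>) :: real^'d"
  show "?l \<in> int_lattice" by (simp add: int_lattice_def)
  have "- 1 / 2 \<le> t - of_int \<lfloor>t + 1 / 2\<rfloor> \<and> t - of_int \<lfloor>t + 1 / 2\<rfloor> \<le> 1 / 2" for t :: real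
    by linarith
  then show "x - ?l \<in> unit_cube" by (simp add: mem_unit_cube)
qed

lemma nn_integral_lborel_translate:
  assumes "f \<in> borel_measurable borel"
  shows "(\<integral>\<^sup>+x. f (x + l) \<partial>lborel) = (\<integral>\<^sup>+x. f x \<partial>(lborel :: (real^'d) measure))"
proof -
  have "(\<integral>\<^sup>+x. f x \<partial>lborel) = (\<integral>\<^sup>+x. f x \<partial>distr lborel borel ((+) l))"
    by (simp add: lborel_distr_plus)
  also have "\<dots> = (\<integral>\<^sup>+x. f (l + x) \<partial>lborel)"
    using assms by (intro nn_integral_distr) auto
  finally show ?thesis by (simp add: add.commute)
qed

lemma AE_lattice_translate_unique:
  "AE x in lborel. \<exists>l\<in>int_lattice. \<forall>k\<in>int_lattice. (x :: real^'d) - k \<in> unit_cube \<longleftrightarrow> k = l"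
  using AE_not_half_integer
proof eventually_elim
  case (elim x)
  obtain l where l: "l \<in> int_lattice" "x - l \<in> unit_cube" by (rule lattice_translate_exists)
  have int: "x - k \<in> cube_interior" if k: "k \<in> int_lattice" "x - k \<in> unit_cube" for k
  proof -
    have "(x - k) $ i \<noteq> - 1 / 2 \<and> (x - k) $ i \<noteq> 1 / 2" for i
    proof -
      obtain n where n: "k $ i = of_int n" using k(1) by (auto simp: int_lattice_def elim: Ints_cases)
      show ?thesis
        using elim[rule_format, of i "n - 1"] elim[rule_format, of i n] n by auto
    qed
    then show ?thesis by (intro cube_interior_if_not_boundary k) auto
  qed
  have "k = l" if "k \<in> int_lattice" "x - k \<in> unit_cube" for k
    using cube_interior_lattice_unique(2)[of "x - k" "x - l" k l] int[OF that] l that by simp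
  then show ?case using l by blast
qed

text \<open>Almost every point lies in exactly one translate of the cube, so \<open>f\<close> is the
  sum of its restrictions to the translates; each restriction is then shifted back to the
  cube.\<close>

lemma nn_integral_lattice_tiling:
  fixes f :: "real^'d \<Rightarrow> ennreal"
  assumes [measurable]: "f \<in> borel_measurable borel"
  shows "(\<integral>\<^sup>+x. f x \<partial>lborel) = (\<integral>\<^sup>+x. (\<Sum>\<^sub>\<infinity>l\<in>int_lattice. f (x + l)) \<partial>cube_measure)"
proof -
  have "AE x in lborel. f x = (\<Sum>\<^sub>\<infinity>l\<in>int_lattice. f x * indicator unit_cube (x - l))"
    using AE_lattice_translate_unique
  proof eventually_elim
    case (elim x)
    then obtain l where l: "l \<in> int_lattice" "\<And>k. k \<in> int_lattice \<Longrightarrow> x - k \<in> unit_cube \<longleftrightarrow> k = l" by blast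
    have "(\<Sum>\<^sub>\<infinity>k\<in>int_lattice. f x * indicator unit_cube (x - k))
        = (\<Sum>\<^sub>\<infinity>k\<in>{l}. f x * indicator unit_cube (x - k))"
    proof (rule infsum_cong_neutral)
      fix k assume "k \<in> int_lattice - {l}"
      then have "x - k \<notin> unit_cube" using l(2)[of k] by blast
      then show "f x * indicator unit_cube (x - k) = 0" by simp
    qed (use l(1) in auto)
    then show ?case using l(1) l(2)[of l] by simp
  qed
  then have "(\<integral>\<^sup>+x. f x \<partial>lborel)
      = (\<integral>\<^sup>+x. (\<Sum>\<^sub>\<infinity>l\<in>int_lattice. f x * indicator unit_cube (x - l)) \<partial>lborel)"
    by (rule nn_integral_cong_AE)
  also have "\<dots> = (\<Sum>\<^sub>\<infinity>l\<in>int_lattice. \<integral>\<^sup>+x. f x * indicator unit_cube (x - l) \<partial>lborel)"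
    by (rule infsum_nn_integral_swap[OF countable_int_lattice]) measurable
  also have "\<dots> = (\<Sum>\<^sub>\<infinity>l\<in>int_lattice. \<integral>\<^sup>+x. f (x + l) \<partial>cube_measure)"
  proof (rule infsum_cong)
    fix l :: "real^'d"
    have "(\<integral>\<^sup>+x. f x * indicator unit_cube (x - l) \<partial>lborel) = (\<integral>\<^sup>+x. f (x + l) * indicator unit_cube (x + l - l) \<partial>lborel)"
      by (rule nn_integral_lborel_translate[symmetric]) measurable
    then show "(\<integral>\<^sup>+x. f x * indicator unit_cube (x - l) \<partial>lborel) = (\<integral>\<^sup>+x. f (x + l) \<partial>cube_measure)"
      by (simp add: nn_integral_cube_measure)
  qed
  also have "\<dots> = (\<integral>\<^sup>+x. (\<Sum>\<^sub>\<infinity>l\<in>int_lattice. f (x + l)) \<partial>cube_measure)"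
    by (rule infsum_nn_integral_swap[OF countable_int_lattice, symmetric]) measurable
  finally show ?thesis .
qed

subsection \<open>Characters\<close>

text \<open>The sign is that of the inverse transform, so the forward transform carries
  \<open>cnj (chi x \<omega>)\<close>.\<close>

definition chi :: "real^'d \<Rightarrow> real^'d \<Rightarrow> complex" where
  "chi x \<omega> = cis (2 * pi * (x \<bullet> \<omega>))"

lemma chi_commute: "chi x \<omega> = chi \<omega> x" by (simp add: chi_def inner_commute)
lemma norm_chi [simp]: "cmod (chi x \<omega>) = 1" by (simp add: chi_def)
lemma chi_add_left: "chi (x + y) \<omega> = chi x \<omega> * chi y \<omega>"
  by (simp add: chi_def inner_add_left cis_mult algebra_simps)
lemma chi_add_right: "chi x (\<omega> + \<eta>) = chi x \<omega> * chi x \<eta>"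
  by (simp add: chi_def inner_add_right cis_mult algebra_simps)
lemma cnj_chi: "cnj (chi x \<omega>) = chi (- x) \<omega>" by (simp add: chi_def cis_cnj)
lemma chi_zero [simp]: "chi 0 \<omega> = 1" by (simp add: chi_def)

lemma chi_lattice: "l \<in> int_lattice \<Longrightarrow> k \<in> int_lattice \<Longrightarrow> chi l k = 1"
  unfolding chi_def by (intro cis_multiple_2pi int_lattice_inner)

lemma continuous_on_chi [continuous_intros]:
  "continuous_on S f \<Longrightarrow> continuous_on S g \<Longrightarrow> continuous_on S (\<lambda>x. chi (f x) (g x))"
  unfolding chi_def cis_conv_exp by (intro continuous_intros)

lemma measurable_chi [measurable (raw)]:
  assumes "f \<in> borel_measurable M" "g \<in> borel_measurable M"
  shows "(\<lambda>x. chi (f x) (g x)) \<in> borel_measurable M"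
proof -
  have "(\<lambda>p. chi (fst p) (snd p)) \<in> borel_measurable (borel :: ((real^'d) \<times> (real^'d)) measure)"
    by (intro borel_measurable_continuous_onI continuous_intros)
  from measurable_compose[OF borel_measurable_Pair[OF assms] this] show ?thesis by simp
qed

lemma chi_prod: "chi x \<omega> = (\<Prod>i\<in>UNIV. cis (2 * pi * (x $ i * \<omega> $ i)))"
proof -
  have "chi x \<omega> = exp (\<Sum>i\<in>UNIV. \<i> * of_real (2 * pi * (x $ i * \<omega> $ i)))"
    by (simp add: chi_def cis_conv_exp inner_vec_def sum_distrib_left)
  then show ?thesis by (simp add: exp_sum cis_conv_exp)
qed

lemma fourier_eq: "fourier f \<omega> = (LINT x|lebesgue. f x * cnj (chi x \<omega>))"
  unfolding fourier_def chi_def cis_cnj by (simp add: cis_conv_exp algebra_simps)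

lemma integral_cis_interval:
  fixes n :: int
  assumes "n \<noteq> 0"
  shows "(LINT t|lborel. indicator {-1/2..1/2} t *\<^sub>R cis (2 * pi * (of_int n * t))) = 0"
proof -
  define c where "c = \<i> * of_real (2 * pi * of_int n)"
  have c: "c \<noteq> 0" using assms by (simp add: c_def)
  have cis: "cis (2 * pi * (of_int n * t)) = exp (c * of_real t)" for t
    by (simp add: cis_conv_exp c_def algebra_simps)
  have "(LINT t|lborel. indicator {-1/2..1/2} t *\<^sub>R exp (c * of_real t))
      = exp (c * of_real (1/2)) / c - exp (c * of_real (-1/2)) / c"
  proof (rule integral_FTC_atLeastAtMost)
    fix t :: real
    have "((\<lambda>z. exp (c * z) / c) has_field_derivative exp (c * of_real t)) (at (of_real t))"
      using c by (auto intro!: derivative_eq_intros)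
    then show "((\<lambda>t. exp (c * of_real t) / c) has_vector_derivative exp (c * of_real t)) (at t within {-1/2..1/2})"
      by (rule has_vector_derivative_real_field)
  qed (auto intro!: continuous_intros)
  \<comment> \<open>The endpoint values differ by the factor exp c, which is 1 because n is an
    integer.\<close>
  also have "exp (c * of_real (1/2)) = exp (c * of_real (-1/2))"
  proof -
    have "exp (c * of_real (1/2)) = exp (c * of_real (-1/2)) * exp c"
      by (simp add: exp_add[symmetric] algebra_simps)
    moreover have "exp c = 1"
    proof -
      have "exp c = cis (2 * pi * of_int n)" by (simp add: c_def cis_conv_exp)
      also have "\<dots> = 1" by (rule cis_multiple_2pi) simp
      finally show ?thesis .
    qed
    ultimately show ?thesis by simp
  qed
  finally show ?thesis by (simp add: cis)
qed

text \<open>The integral factors over the coordinates, and a nonzero coordinate of \<open>l\<close>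
  yields a full-period integral that vanishes.\<close>

lemma integral_cube_chi:
  fixes l :: "real^'d"
  assumes "l \<in> int_lattice"
  shows "(LINT x|cube_measure. chi l x) = (if l = 0 then 1 else 0)"
proof (cases "l = 0")
  case True
  interpret prob_space "cube_measure :: (real^'d) measure" by (rule prob_space_cube_measure)
  show ?thesis using True prob_space by simp
next
  case False
  then obtain j where j: "l $ j \<noteq> 0" by (auto simp: vec_eq_iff)
  let ?f = "\<lambda>i t. indicator {-1/2..1/2} t *\<^sub>R cis (2 * pi * (l $ i * t))"
  have int: "integrable lborel (?f i)" for i
  proof -
    have "set_integrable lborel {-1/2..1/2} (\<lambda>t. cis (2 * pi * (l $ i * t)))"
      unfolding cis_conv_exp by (rule borel_integrable_atLeastAtMost') (intro continuous_intros)
    then show ?thesis by (simp add: set_integrable_def)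
  qed
  have "(LINT x|cube_measure. chi l x) = (LINT x|lborel. indicator unit_cube x *\<^sub>R chi l x)"
    by (rule integral_cube_measure) measurable
  also have "(\<lambda>x. indicator unit_cube x *\<^sub>R chi l x) = (\<lambda>x. \<Prod>i\<in>UNIV. ?f i (x $ i))"
    by (auto simp: fun_eq_iff chi_prod indicator_def mem_unit_cube)
  also have "(LINT x|lborel. (\<Prod>i\<in>UNIV. ?f i ((x::real^'d) $ i))) = (\<Prod>i\<in>UNIV. LINT t|lborel. ?f i t)"
    by (rule lborel_integral_prod_vec(2)) (rule int)
  also have "\<dots> = 0"
  proof -
    obtain n where n: "l $ j = of_int n" using assms by (auto simp: int_lattice_def elim: Ints_cases)
    have "(LINT t|lborel. ?f j t) = 0" using integral_cis_interval[of n] j n by simp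
    then show ?thesis by (intro prod_zero) auto
  qed
  finally show ?thesis using False by simp
qed

subsection \<open>Trigonometric polynomials and Parseval's identity on the cube\<close>

text \<open>The inductive form makes closure under sums and products immediate; distinct frequencies
  with collected coefficients are recovered in \<open>trig_poly_normal_form\<close>.\<close>

inductive trig_poly :: "(real^'d \<Rightarrow> complex) \<Rightarrow> bool" where
  zero: "trig_poly (\<lambda>_. 0)"
| add_monomial: "l \<in> int_lattice \<Longrightarrow> trig_poly p \<Longrightarrow> trig_poly (\<lambda>\<omega>. a * chi l \<omega> + p \<omega>)"

lemma trig_poly_monomial: "l \<in> int_lattice \<Longrightarrow> trig_poly (\<lambda>\<omega>. a * chi l \<omega>)"
  using add_monomial[OF _ zero, of l a] by simp

lemma trig_poly_const: "trig_poly (\<lambda>_. a)"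
  using trig_poly_monomial[OF zero_int_lattice, of a] by simp

lemma trig_poly_add: "trig_poly p \<Longrightarrow> trig_poly q \<Longrightarrow> trig_poly (\<lambda>\<omega>. p \<omega> + q \<omega>)"
  by (induction rule: trig_poly.induct) (auto simp: add.assoc intro: trig_poly.intros)

lemma trig_poly_mult_monomial:
  assumes "trig_poly q" "k \<in> int_lattice"
  shows "trig_poly (\<lambda>\<omega>. a * chi k \<omega> * q \<omega>)"
  using assms
proof (induction rule: trig_poly.induct)
  case zero
  then show ?case by (simp add: trig_poly.zero)
next
  case (add_monomial l p b)
  have "trig_poly (\<lambda>\<omega>. (a * b) * chi (k + l) \<omega> + a * chi k \<omega> * p \<omega>)"
    by (rule trig_poly.add_monomial) (use add_monomial in \<open>auto intro: int_lattice_add\<close>)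
  then show ?case by (simp add: chi_add_left algebra_simps)
qed

lemma trig_poly_mult: "trig_poly p \<Longrightarrow> trig_poly q \<Longrightarrow> trig_poly (\<lambda>\<omega>. p \<omega> * q \<omega>)"
  by (induction rule: trig_poly.induct)
     (auto simp: distrib_right trig_poly.zero intro: trig_poly_add trig_poly_mult_monomial)

lemma trig_poly_cmult: "trig_poly p \<Longrightarrow> trig_poly (\<lambda>\<omega>. a * p \<omega>)"
  by (rule trig_poly_mult[OF trig_poly_const])

lemma trig_poly_measurable [measurable_dest]: "trig_poly p \<Longrightarrow> p \<in> borel_measurable borel"
  by (induction rule: trig_poly.induct) measurable

lemma trig_poly_normal_form:
  assumes "trig_poly p"
  obtains L a where "finite L" "L \<subseteq> int_lattice" "p = (\<lambda>\<omega>. \<Sum>l\<in>L. a l * chi l \<omega>)"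
proof -
  have "\<exists>L a. finite L \<and> L \<subseteq> int_lattice \<and> p = (\<lambda>\<omega>. \<Sum>l\<in>L. a l * chi l \<omega>)"
    using assms
  proof (induction rule: trig_poly.induct)
    case zero
    show ?case by (rule exI[of _ "{}"]) simp
  next
    case (add_monomial k p b)
    then obtain L a where L: "finite L" "L \<subseteq> int_lattice" "p = (\<lambda>\<omega>. \<Sum>l\<in>L. a l * chi l \<omega>)" by blast
    \<comment> \<open>The frequency k may already occur in \<open>L\<close>, so its coefficients are
      added.\<close>
    define a' where "a' l = (if l \<in> L then a l else 0) + (if l = k then b else 0)" for l
    have "b * chi k \<omega> + p \<omega> = (\<Sum>l\<in>insert k L. a' l * chi l \<omega>)" for \<omega>
    proof -
      have "(\<Sum>l\<in>insert k L. a' l * chi l \<omega>)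
          = (\<Sum>l\<in>insert k L. (if l \<in> L then a l else 0) * chi l \<omega>)
            + (\<Sum>l\<in>insert k L. (if l = k then b else 0) * chi l \<omega>)"
        by (simp add: a'_def distrib_right sum.distrib)
      also have "(\<Sum>l\<in>insert k L. (if l \<in> L then a l else 0) * chi l \<omega>) = (\<Sum>l\<in>L. a l * chi l \<omega>)"
        by (rule sum.mono_neutral_cong_right) (use L in auto)
      also have "(\<Sum>l\<in>insert k L. (if l = k then b else 0) * chi l \<omega>) = (\<Sum>l\<in>{k}. b * chi l \<omega>)"
        by (rule sum.mono_neutral_cong_right) (use L in auto)
      finally show ?thesis by (simp add: L(3))
    qed
    then show ?case
      using L add_monomial by (intro exI[of _ "insert k L"] exI[of _ a']) auto
  qed
  then show ?thesis using that by blast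
qed

section \<open>Density of trigonometric polynomials in L^2 of the cube\<close>

definition sqdist :: "(real^'d \<Rightarrow> complex) \<Rightarrow> (real^'d \<Rightarrow> complex) \<Rightarrow> ennreal" where
  "sqdist f g = (\<integral>\<^sup>+\<omega>. ennreal ((cmod (f \<omega> - g \<omega>))\<^sup>2) \<partial>cube_measure)"

lemma norm_add_sq_le: "(norm (u + v))\<^sup>2 \<le> 2 * (norm u)\<^sup>2 + 2 * (norm (v :: 'a :: real_normed_vector))\<^sup>2"
proof -
  have "(norm (u + v))\<^sup>2 \<le> (norm u + norm v)\<^sup>2" by (intro power_mono norm_triangle_ineq) simp
  also have "\<dots> \<le> 2 * (norm u)\<^sup>2 + 2 * (norm v)\<^sup>2"
    using zero_le_power2[of "norm u - norm v"] by (simp add: power2_eq_square algebra_simps)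
  finally show ?thesis .
qed

lemma sqdist_triangle:
  assumes [measurable]: "f \<in> borel_measurable borel" "g \<in> borel_measurable borel" "h \<in> borel_measurable borel"
  shows "sqdist f h \<le> 2 * sqdist f g + 2 * sqdist g h"
proof -
  have "sqdist f h \<le> (\<integral>\<^sup>+\<omega>. 2 * ennreal ((cmod (f \<omega> - g \<omega>))\<^sup>2) + 2 * ennreal ((cmod (g \<omega> - h \<omega>))\<^sup>2) \<partial>cube_measure)"
    unfolding sqdist_def
  proof (rule nn_integral_mono)
    fix \<omega>
    have "(cmod (f \<omega> - h \<omega>))\<^sup>2 \<le> 2 * (cmod (f \<omega> - g \<omega>))\<^sup>2 + 2 * (cmod (g \<omega> - h \<omega>))\<^sup>2"
      using norm_add_sq_le[of "f \<omega> - g \<omega>" "g \<omega> - h \<omega>"] by simp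
    then have "ennreal ((cmod (f \<omega> - h \<omega>))\<^sup>2) \<le> ennreal (2 * (cmod (f \<omega> - g \<omega>))\<^sup>2 + 2 * (cmod (g \<omega> - h \<omega>))\<^sup>2)"
      by (rule ennreal_leI)
    then show "ennreal ((cmod (f \<omega> - h \<omega>))\<^sup>2) \<le> 2 * ennreal ((cmod (f \<omega> - g \<omega>))\<^sup>2) + 2 * ennreal ((cmod (g \<omega> - h \<omega>))\<^sup>2)"
      by (simp add: ennreal_plus ennreal_mult)
  qed
  also have "\<dots> = 2 * sqdist f g + 2 * sqdist g h"
    unfolding sqdist_def by (simp add: nn_integral_add nn_integral_cmult)
  finally show ?thesis .
qed

definition trig_approximable :: "(real^'d \<Rightarrow> complex) \<Rightarrow> bool" where
  "trig_approximable f \<longleftrightarrow> (\<forall>\<epsilon>>0. \<exists>p. trig_poly p \<and> sqdist f p \<le> ennreal \<epsilon>)"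

lemma trig_approximableD:
  assumes "trig_approximable f" "\<epsilon> > 0"
  obtains p where "trig_poly p" "sqdist f p \<le> ennreal \<epsilon>"
  using assms unfolding trig_approximable_def by blast

lemma trig_approximable_zero: "trig_approximable (\<lambda>_. 0)"
  unfolding trig_approximable_def using trig_poly.zero by (fastforce simp: sqdist_def)

lemma ennreal_two_mult_add: "0 \<le> a \<Longrightarrow> 2 * ennreal a + 2 * ennreal a = ennreal (4 * a)"
  by (simp flip: ennreal_plus ennreal_mult' add: ennreal_numeral[symmetric] del: ennreal_numeral)

text \<open>Squared distances satisfy the triangle inequality only up to a factor 2 on each term,
  hence the two errors of size \<epsilon> / 4.\<close>

lemma trig_approximable_limit:
  assumes [measurable]: "f \<in> borel_measurable borel"
    and approx: "\<And>\<epsilon>. \<epsilon> > 0 \<Longrightarrow> \<exists>g. g \<in> borel_measurable borel \<and> trig_approximable g \<and> sqdist f g \<le> ennreal \<epsilon>"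
  shows "trig_approximable f"
  unfolding trig_approximable_def
proof (intro allI impI)
  fix \<epsilon> :: real assume "\<epsilon> > 0"
  then have e: "\<epsilon> / 4 > 0" by simp
  obtain g where g: "g \<in> borel_measurable borel" "trig_approximable g" "sqdist f g \<le> ennreal (\<epsilon> / 4)"
    using approx[OF e] by blast
  obtain p where p: "trig_poly p" "sqdist g p \<le> ennreal (\<epsilon> / 4)" by (rule trig_approximableD[OF g(2) e])
  have "sqdist f p \<le> 2 * sqdist f g + 2 * sqdist g p"
    using g(1) p(1) by (intro sqdist_triangle) (auto intro: trig_poly_measurable)
  also have "\<dots> \<le> 2 * ennreal (\<epsilon> / 4) + 2 * ennreal (\<epsilon> / 4)"
    using g p by (intro add_mono mult_left_mono) auto
  also have "\<dots> = ennreal \<epsilon>" using e by (subst ennreal_two_mult_add) auto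
  finally show "\<exists>p. trig_poly p \<and> sqdist f p \<le> ennreal \<epsilon>" using p(1) by blast
qed

lemma trig_approximable_add:
  assumes [measurable]: "f \<in> borel_measurable borel" "g \<in> borel_measurable borel"
    and "trig_approximable f" "trig_approximable g"
  shows "trig_approximable (\<lambda>\<omega>. f \<omega> + g \<omega>)"
  unfolding trig_approximable_def
proof (intro allI impI)
  fix \<epsilon> :: real assume "\<epsilon> > 0"
  then have e: "\<epsilon> / 4 > 0" by simp
  obtain p where p: "trig_poly p" "sqdist f p \<le> ennreal (\<epsilon> / 4)" by (rule trig_approximableD[OF assms(3) e])
  obtain q where q: "trig_poly q" "sqdist g q \<le> ennreal (\<epsilon> / 4)" by (rule trig_approximableD[OF assms(4) e])
  have [measurable]: "p \<in> borel_measurable borel" "q \<in> borel_measurable borel"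
    using p q by (auto intro: trig_poly_measurable)
  have "sqdist (\<lambda>\<omega>. f \<omega> + g \<omega>) (\<lambda>\<omega>. p \<omega> + q \<omega>)
      \<le> 2 * sqdist (\<lambda>\<omega>. f \<omega> + g \<omega>) (\<lambda>\<omega>. p \<omega> + g \<omega>) + 2 * sqdist (\<lambda>\<omega>. p \<omega> + g \<omega>) (\<lambda>\<omega>. p \<omega> + q \<omega>)"
    by (intro sqdist_triangle) measurable
  also have "\<dots> = 2 * sqdist f p + 2 * sqdist g q" by (simp add: sqdist_def)
  also have "\<dots> \<le> 2 * ennreal (\<epsilon> / 4) + 2 * ennreal (\<epsilon> / 4)"
    using p q by (intro add_mono mult_left_mono) auto
  also have "\<dots> = ennreal \<epsilon>" using e by (subst ennreal_two_mult_add) auto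
  finally show "\<exists>p. trig_poly p \<and> sqdist (\<lambda>\<omega>. f \<omega> + g \<omega>) p \<le> ennreal \<epsilon>"
    using trig_poly_add[OF p(1) q(1)] by blast
qed

lemma trig_approximable_cmult:
  assumes [measurable]: "f \<in> borel_measurable borel" and f: "trig_approximable f"
  shows "trig_approximable (\<lambda>\<omega>. c * f \<omega>)"
proof (cases "c = 0")
  case True
  then show ?thesis using trig_approximable_zero by simp
next
  case False
  show ?thesis
    unfolding trig_approximable_def
  proof (intro allI impI)
    fix \<epsilon> :: real assume \<epsilon>: "\<epsilon> > 0"
    then have e: "\<epsilon> / (cmod c)\<^sup>2 > 0" using False by simp
    obtain p where p: "trig_poly p" "sqdist f p \<le> ennreal (\<epsilon> / (cmod c)\<^sup>2)" by (rule trig_approximableD[OF f e])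
    have [measurable]: "p \<in> borel_measurable borel" using p by (auto intro: trig_poly_measurable)
    have "sqdist (\<lambda>\<omega>. c * f \<omega>) (\<lambda>\<omega>. c * p \<omega>) = ennreal ((cmod c)\<^sup>2) * sqdist f p"
      unfolding sqdist_def
      by (subst nn_integral_cmult[symmetric])
         (auto simp: norm_mult power_mult_distrib ennreal_mult simp flip: right_diff_distrib)
    also have "\<dots> \<le> ennreal ((cmod c)\<^sup>2) * ennreal (\<epsilon> / (cmod c)\<^sup>2)"
      using p by (intro mult_left_mono) auto
    also have "\<dots> = ennreal \<epsilon>" using False \<epsilon> by (simp flip: ennreal_mult)
    finally show "\<exists>p. trig_poly p \<and> sqdist (\<lambda>\<omega>. c * f \<omega>) p \<le> ennreal \<epsilon>"
      using trig_poly_cmult[OF p(1), of c] by blast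
  qed
qed

lemma trig_approximable_sum:
  assumes "finite I" "\<And>i. i \<in> I \<Longrightarrow> f i \<in> borel_measurable borel" "\<And>i. i \<in> I \<Longrightarrow> trig_approximable (f i)"
  shows "trig_approximable (\<lambda>\<omega>. \<Sum>i\<in>I. f i \<omega>)"
  using assms
  by (induction I rule: finite_induct) (auto intro!: trig_approximable_zero trig_approximable_add)

text \<open>Trigonometric polynomials take equal values at opposite faces of the cube. The map glues
  these faces, so that Stone-Weierstrass applies on a compact image where points are
  separated.\<close>

definition torus_map :: "real^'d \<Rightarrow> complex^'d" where
  "torus_map \<omega> = (\<chi> i. cis (2 * pi * \<omega> $ i))"

lemma continuous_on_torus_map: "continuous_on S torus_map"
  unfolding torus_map_def cis_conv_exp by (intro continuous_intros)

lemma torus_map_component: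
  "torus_map \<omega> $ i = chi (axis i 1) \<omega>" "cnj (torus_map \<omega> $ i) = chi (- axis i 1) \<omega>"
  by (simp_all add: torus_map_def chi_def inner_axis' cis_cnj)

lemma axis_int_lattice: "axis i 1 \<in> int_lattice"
  by (simp add: int_lattice_def axis_def)

text \<open>Real Stone-Weierstrass on the torus, for the ring of continuous real functions that pull
  back to trigonometric polynomials. Uniform error sqrt \<epsilon> gives squared L^2 error
  \<epsilon>, since the cube has measure 1.\<close>

lemma trig_approximable_continuous:
  fixes G :: "complex^'d \<Rightarrow> real"
  assumes G: "continuous_on UNIV G"
  shows "trig_approximable (\<lambda>\<omega>. of_real (G (torus_map \<omega>)))"
proof -
  let ?S = "torus_map ` unit_cube :: (complex^'d) set"
  define R where "R = {F :: complex^'d \<Rightarrow> real. continuous_on UNIV F \<and> trig_poly (\<lambda>\<omega>. complex_of_real (F (torus_map \<omega>)))}"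
  interpret function_ring_on R ?S
  proof
    show "compact ?S"
      by (intro compact_continuous_image continuous_on_torus_map) (simp add: unit_cube_def)
    show "continuous_on ?S f" if "f \<in> R" for f
      using that by (auto simp: R_def intro: continuous_on_subset)
    fix f g assume fg: "f \<in> R" "g \<in> R"
    then show "(\<lambda>x. f x + g x) \<in> R"
      using trig_poly_add[of "\<lambda>\<omega>. of_real (f (torus_map \<omega>))" "\<lambda>\<omega>. of_real (g (torus_map \<omega>))"]
      by (simp add: R_def continuous_on_add)
    from fg show "(\<lambda>x. f x * g x) \<in> R"
      using trig_poly_mult[of "\<lambda>\<omega>. of_real (f (torus_map \<omega>))" "\<lambda>\<omega>. of_real (g (torus_map \<omega>))"]
      by (simp add: R_def continuous_on_mult)
  next
    show "(\<lambda>_. c) \<in> R" for c by (simp add: R_def trig_poly_const)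
  next
    \<comment> \<open>Real and imaginary parts of a torus coordinate are combinations of the
      characters at plus and minus a unit vector; they lie in the ring and separate points.\<close>
    have Re_eq: "complex_of_real (Re z) = 1 / 2 * z + 1 / 2 * cnj z" for z by (simp add: complex_eq_iff)
    have Im_eq: "complex_of_real (Im z) = - \<i> / 2 * z + \<i> / 2 * cnj z" for z by (simp add: complex_eq_iff)
    fix z w assume "z \<in> ?S" "w \<in> ?S" "z \<noteq> w"
    then obtain i where i: "z $ i \<noteq> w $ i" by (auto simp: vec_eq_iff)
    have "trig_poly (\<lambda>\<omega>. 1 / 2 * chi (axis i 1) \<omega> + 1 / 2 * chi (- axis i 1) \<omega>)"
      by (intro trig_poly_add trig_poly_monomial axis_int_lattice int_lattice_minus)
    then have "trig_poly (\<lambda>\<omega>. complex_of_real (Re (torus_map \<omega> $ i)))"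
      unfolding torus_map_component[symmetric] Re_eq by (simp add: algebra_simps)
    then have Re: "(\<lambda>z. Re (z $ i)) \<in> R" by (simp add: R_def continuous_intros)
    have "trig_poly (\<lambda>\<omega>. - \<i> / 2 * chi (axis i 1) \<omega> + \<i> / 2 * chi (- axis i 1) \<omega>)"
      by (intro trig_poly_add trig_poly_monomial axis_int_lattice int_lattice_minus)
    then have "trig_poly (\<lambda>\<omega>. complex_of_real (Im (torus_map \<omega> $ i)))"
      unfolding torus_map_component[symmetric] Im_eq by (simp add: algebra_simps)
    then have Im: "(\<lambda>z. Im (z $ i)) \<in> R" by (simp add: R_def continuous_intros)
    from i have "Re (z $ i) \<noteq> Re (w $ i) \<or> Im (z $ i) \<noteq> Im (w $ i)" by (simp add: complex_eq_iff)
    then show "\<exists>f\<in>R. f z \<noteq> f w"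
      using bexI[OF _ Re, of "\<lambda>f. f z \<noteq> f w"] bexI[OF _ Im, of "\<lambda>f. f z \<noteq> f w"] by argo
  qed
  show ?thesis
    unfolding trig_approximable_def
  proof (intro allI impI)
    fix \<epsilon> :: real assume \<epsilon>: "\<epsilon> > 0"
    have "continuous_on ?S G" using G by (rule continuous_on_subset) simp
    then obtain F where F: "F \<in> R" "\<And>z. z \<in> ?S \<Longrightarrow> \<bar>G z - F z\<bar> < sqrt \<epsilon>"
      using Stone_Weierstrass_basic[of G "sqrt \<epsilon>"] \<epsilon> by auto
    let ?p = "\<lambda>\<omega>. complex_of_real (F (torus_map \<omega>))"
    interpret prob_space "cube_measure :: (real^'d) measure" by (rule prob_space_cube_measure)
    have "sqdist (\<lambda>\<omega>. of_real (G (torus_map \<omega>))) ?p \<le> (\<integral>\<^sup>+\<omega>. ennreal \<epsilon> \<partial>(cube_measure :: (real^'d) measure))"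
      unfolding sqdist_def
    proof (rule nn_integral_mono_AE)
      show "AE \<omega> in (cube_measure :: (real^'d) measure).
          ennreal ((cmod (of_real (G (torus_map \<omega>)) - ?p \<omega>))\<^sup>2) \<le> ennreal \<epsilon>"
        using AE_cube_measure_interior
      proof eventually_elim
        case (elim \<omega>)
        then have "\<omega> \<in> unit_cube" by (auto simp: cube_interior_def mem_unit_cube less_imp_le)
        then have "\<bar>G (torus_map \<omega>) - F (torus_map \<omega>)\<bar> < sqrt \<epsilon>" by (intro F) simp
        then have "(cmod (of_real (G (torus_map \<omega>)) - ?p \<omega>))\<^sup>2 \<le> (sqrt \<epsilon>)\<^sup>2"
          by (intro power_mono) (simp_all flip: of_real_diff)
        then show ?case using \<epsilon> by (intro ennreal_leI) simp
      qed
    qed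
    also have "\<dots> = ennreal \<epsilon>" using emeasure_space_1 by simp
    finally show "\<exists>p. trig_poly p \<and> sqdist (\<lambda>\<omega>. of_real (G (torus_map \<omega>))) p \<le> ennreal \<epsilon>"
      using F(1) by (auto simp: R_def)
  qed
qed

lemma torus_map_eq_imp_lattice:
  assumes "torus_map x = torus_map y"
  shows "x - y \<in> int_lattice"
proof -
  have "(x - y) $ i \<in> \<int>" for i
  proof -
    have "cis (2 * pi * x $ i) = cis (2 * pi * y $ i)"
      using assms by (simp add: torus_map_def vec_eq_iff)
    then have "cis (2 * pi * (x $ i - y $ i)) = 1"
      by (simp add: right_diff_distrib cis_divide[symmetric])
    then have "cos (2 * pi * (x $ i - y $ i)) = 1" by (simp add: cis.ctr complex_eq_iff)
    then obtain n :: int where "2 * pi * (x $ i - y $ i) = of_int n * 2 * pi"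
      using cos_one_2pi_int by blast
    then have "x $ i - y $ i = of_int n" by simp
    then show ?thesis by simp
  qed
  then show ?thesis by (simp add: int_lattice_def)
qed

text \<open>Inside the open cube the gluing is injective, so \<open>indicator K\<close> is a
  pointwise limit of continuous functions on the torus, boundedly on a probability space.\<close>

lemma trig_approximable_compact:
  fixes K :: "(real^'d) set"
  assumes K: "compact K" "K \<subseteq> cube_interior"
  shows "trig_approximable (indicator K)"
proof (cases "K = {}")
  case True
  then have "indicator K = (\<lambda>_. 0 :: complex)" by (simp add: fun_eq_iff)
  then show ?thesis using trig_approximable_zero by simp
next
  case False
  let ?K = "torus_map ` K"
  have cK: "compact ?K" by (intro compact_continuous_image continuous_on_torus_map K)
  then have clK: "closed ?K" by (rule compact_imp_closed)
  have [measurable]: "K \<in> sets borel" using K(1) by (simp add: borel_compact)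
  have [measurable]: "torus_map \<in> borel_measurable borel"
    by (intro borel_measurable_continuous_onI continuous_on_torus_map)
  \<comment> \<open>Tent functions of the distance to the image of \<open>K\<close>: equal to 1 on
    the image and 0 at distance at least 1/n for positive n.\<close>
  define G where "G n z = max 0 (1 - real n * infdist z ?K)" for n z
  have contG: "continuous_on UNIV (G n)" for n
    unfolding G_def by (intro continuous_intros)
  have [measurable]: "G n \<in> borel_measurable borel" for n
    by (intro borel_measurable_continuous_onI contG)
  have G01: "0 \<le> G n z" "G n z \<le> 1" for n z
    by (auto simp: G_def infdist_nonneg)
  have lim: "(\<lambda>n. G n (torus_map \<omega>)) \<longlonglongrightarrow> indicator K \<omega>" if \<omega>: "\<omega> \<in> cube_interior" for \<omega>
  proof (cases "\<omega> \<in> K")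
    case True
    then have "G n (torus_map \<omega>) = 1" for n by (simp add: G_def infdist_zero)
    then show ?thesis using True by simp
  next
    case False
    have "torus_map \<omega> \<notin> ?K"
    proof
      assume "torus_map \<omega> \<in> ?K"
      then obtain y where y: "y \<in> K" "torus_map \<omega> = torus_map y" by blast
      have "y \<in> unit_cube"
        using y(1) K(2) by (auto simp: cube_interior_def mem_unit_cube less_imp_le)
      then have "\<omega> = y"
        using cube_interior_lattice_unique(1)[OF \<omega>, of y 0 "\<omega> - y"] torus_map_eq_imp_lattice[OF y(2)]
        by (simp add: zero_int_lattice)
      then show False using False y by simp
    qed
    then have pos: "0 < infdist (torus_map \<omega>) ?K"
      using clK \<open>K \<noteq> {}\<close> in_closed_iff_infdist_zero[of ?K "torus_map \<omega>"] infdist_nonneg[of "torus_map \<omega>" ?K] by auto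
    obtain N :: nat where N: "1 / infdist (torus_map \<omega>) ?K < real N" using reals_Archimedean2 by blast
    have "G n (torus_map \<omega>) = 0" if "N \<le> n" for n
    proof -
      have "1 / infdist (torus_map \<omega>) ?K \<le> real n" using N that by linarith
      then have "1 \<le> real n * infdist (torus_map \<omega>) ?K" using pos by (simp add: divide_le_eq)
      then show ?thesis by (simp add: G_def)
    qed
    then have "eventually (\<lambda>n. G n (torus_map \<omega>) = 0) sequentially"
      unfolding eventually_sequentially by blast
    then show ?thesis using False by (simp add: tendsto_eventually)
  qed
  show ?thesis
  proof (rule trig_approximable_limit)
    show "indicator K \<in> borel_measurable borel" by measurable
    fix \<epsilon> :: real assume "\<epsilon> > 0"
    interpret prob_space "cube_measure :: (real^'d) measure" by (rule prob_space_cube_measure)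
    have "(\<lambda>n. sqdist (indicator K) (\<lambda>\<omega>. of_real (G n (torus_map \<omega>)))) \<longlonglongrightarrow> (\<integral>\<^sup>+\<omega>. 0 \<partial>(cube_measure :: (real^'d) measure))"
      unfolding sqdist_def
    proof (rule nn_integral_dominated_convergence[where w = "\<lambda>_. 1"])
      show "AE \<omega> in (cube_measure :: (real^'d) measure). (\<lambda>n. ennreal ((cmod (indicator K \<omega> - of_real (G n (torus_map \<omega>))))\<^sup>2)) \<longlonglongrightarrow> 0"
        using AE_cube_measure_interior
      proof eventually_elim
        case (elim \<omega>)
        have "(\<lambda>n. (cmod (indicator K \<omega> - of_real (G n (torus_map \<omega>))))\<^sup>2) \<longlonglongrightarrow> (cmod (indicator K \<omega> - of_real (indicator K \<omega>)))\<^sup>2"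
          by (intro tendsto_intros lim elim)
        then have "(\<lambda>n. (cmod (indicator K \<omega> - of_real (G n (torus_map \<omega>))))\<^sup>2) \<longlonglongrightarrow> 0"
          by (simp only: of_real_indicator) simp
        from tendsto_ennrealI[OF this] show ?case by simp
      qed
      show "AE \<omega> in (cube_measure :: (real^'d) measure). ennreal ((cmod (indicator K \<omega> - of_real (G n (torus_map \<omega>))))\<^sup>2) \<le> 1" for n
      proof (rule AE_I2)
        fix \<omega> :: "real^'d"
        have "cmod (indicator K \<omega> - of_real (G n (torus_map \<omega>))) = \<bar>indicator K \<omega> - G n (torus_map \<omega>)\<bar>"
          by (metis norm_of_real of_real_diff of_real_indicator)
        also have "\<dots> \<le> 1" using G01[of n "torus_map \<omega>"] by (auto simp: indicator_def)
        finally show "ennreal ((cmod (indicator K \<omega> - of_real (G n (torus_map \<omega>))))\<^sup>2) \<le> 1"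
          by (simp add: power_le_one)
      qed
      show "(\<integral>\<^sup>+ \<omega>. 1 \<partial>(cube_measure :: (real^'d) measure)) < \<infinity>" using emeasure_space_1 by simp
    qed measurable
    then have "(\<lambda>n. sqdist (indicator K) (\<lambda>\<omega>. of_real (G n (torus_map \<omega>)))) \<longlonglongrightarrow> 0" by simp
    then have "eventually (\<lambda>n. sqdist (indicator K) (\<lambda>\<omega>. of_real (G n (torus_map \<omega>))) < ennreal \<epsilon>) sequentially"
      by (rule order_tendstoD) (use \<open>\<epsilon> > 0\<close> in simp)
    then obtain n where n: "sqdist (indicator K) (\<lambda>\<omega>. of_real (G n (torus_map \<omega>))) < ennreal \<epsilon>"
      by (auto simp: eventually_sequentially)
    show "\<exists>g. g \<in> borel_measurable borel \<and> trig_approximable g \<and> sqdist (indicator K) g \<le> ennreal \<epsilon>"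
      using n by (intro exI[of _ "\<lambda>\<omega>. of_real (G n (torus_map \<omega>))"] conjI trig_approximable_continuous contG)
        (auto intro: less_imp_le)
  qed
qed

text \<open>Inner regularity reduces to compact sets. The boundary of the cube is removed first so
  that these compact sets lie in the open cube.\<close>

lemma trig_approximable_indicator:
  fixes A :: "(real^'d) set"
  assumes [measurable]: "A \<in> sets borel"
  shows "trig_approximable (indicator A)"
proof (rule trig_approximable_limit)
  show "indicator A \<in> borel_measurable borel" by measurable
  fix \<epsilon> :: real assume \<epsilon>: "\<epsilon> > 0"
  let ?U = "cube_measure :: (real^'d) measure"
  interpret prob_space ?U by (rule prob_space_cube_measure)
  let ?A = "A \<inter> cube_interior"
  have [measurable]: "cube_interior \<in> sets (borel :: (real^'d) measure)" by (rule borel_open[OF open_cube_interior])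
  have A: "?A \<in> sets borel" by measurable
  have "emeasure ?U ?A = (SUP K \<in> {K. K \<subseteq> ?A \<and> compact K}. emeasure ?U K)"
    by (rule inner_regular) (use A in simp_all)
  then have sup: "emeasure ?U ?A \<le> c" if "\<And>K. K \<subseteq> ?A \<Longrightarrow> compact K \<Longrightarrow> emeasure ?U K \<le> c" for c
    using that by (auto intro!: SUP_least)
  have "\<exists>K\<subseteq>?A. compact K \<and> measure ?U ?A < measure ?U K + \<epsilon>"
  proof (rule ccontr)
    assume *: "\<not> ?thesis"
    then have le: "measure ?U K \<le> measure ?U ?A - \<epsilon>" if "K \<subseteq> ?A" "compact K" for K
      using that by (auto simp: not_less algebra_simps)
    have nn: "0 \<le> measure ?U ?A - \<epsilon>" using le[of "{}"] by simp
    have "emeasure ?U ?A \<le> ennreal (measure ?U ?A - \<epsilon>)"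
      by (rule sup) (simp add: emeasure_eq_measure le ennreal_leI)
    then have "measure ?U ?A \<le> measure ?U ?A - \<epsilon>" using nn by (simp add: emeasure_eq_measure)
    then show False using \<epsilon> by simp
  qed
  then obtain K where K: "K \<subseteq> ?A" "compact K" "measure ?U ?A < measure ?U K + \<epsilon>" by blast
  have [measurable]: "K \<in> sets borel" using K(2) by (simp add: borel_compact)
  have "sqdist (indicator A) (indicator K) = (\<integral>\<^sup>+\<omega>. indicator (?A - K) \<omega> \<partial>?U)"
    unfolding sqdist_def
  proof (rule nn_integral_cong_AE)
    show "AE \<omega> in ?U. ennreal ((cmod (indicator A \<omega> - indicator K \<omega>))\<^sup>2) = indicator (?A - K) \<omega>"
      using AE_cube_measure_interior
      by eventually_elim (use K(1) in \<open>auto simp: indicator_def\<close>)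
  qed
  also have "\<dots> = emeasure ?U (?A - K)" by (simp add: nn_integral_indicator)
  also have "\<dots> = emeasure ?U ?A - emeasure ?U K"
    by (rule emeasure_Diff) (use K(1) in simp_all)
  also have "\<dots> \<le> ennreal \<epsilon>" using K(3) by (simp add: emeasure_eq_measure ennreal_minus ennreal_leI)
  finally show "\<exists>g. g \<in> borel_measurable borel \<and> trig_approximable g \<and> sqdist (indicator A) g \<le> ennreal \<epsilon>"
    using K by (intro exI[of _ "indicator K"] conjI trig_approximable_compact) auto
qed

lemma trig_approximable_L2:
  assumes h[measurable]: "h \<in> borel_measurable borel"
    and fin: "(\<integral>\<^sup>+\<omega>. ennreal ((cmod (h \<omega>))\<^sup>2) \<partial>cube_measure) < \<infinity>"
  shows "trig_approximable (h :: real^'d \<Rightarrow> complex)"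
proof -
  let ?U = "cube_measure :: (real^'d) measure"
  have "h \<in> borel_measurable ?U" by simp
  from borel_measurable_implies_sequence_metric[OF this, of 0] obtain s where
    s: "\<And>i. simple_function ?U (s i)"
    and lim: "\<And>x. (\<lambda>i. s i x) \<longlonglongrightarrow> h x"
    and bd: "\<And>i x. dist (s i x) 0 \<le> 2 * dist (h x) 0"
    by (auto simp del: dist_0_norm)
  have [measurable]: "s i \<in> borel_measurable borel" for i
    using borel_measurable_simple_function[OF s, of i] by simp
  have approx: "trig_approximable (s i)" for i
  proof -
    have fr: "finite (range (s i))" using simple_functionD(1)[OF s, of i] by simp
    have eq: "s i = (\<lambda>x. \<Sum>y\<in>range (s i). y * indicator (s i -` {y}) x)"
    proof
      fix x
      have "(\<Sum>y\<in>range (s i). y * indicator (s i -` {y}) x) = (\<Sum>y\<in>{s i x}. y * indicator (s i -` {y}) x)"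
        by (rule sum.mono_neutral_right) (use fr in auto)
      then show "s i x = (\<Sum>y\<in>range (s i). y * indicator (s i -` {y}) x)" by simp
    qed
    have [measurable]: "s i -` {y} \<in> sets borel" for y
      using measurable_sets_borel[of "s i" borel "{y}"] by simp
    show ?thesis
      by (subst eq) (intro trig_approximable_sum trig_approximable_cmult trig_approximable_indicator fr; measurable)
  qed
  show ?thesis
  proof (rule trig_approximable_limit[OF h])
    fix \<epsilon> :: real assume "\<epsilon> > 0"
    \<comment> \<open>The simple functions satisfy |s n| <= 2 |h|, so |h - s n| <= 3 |h|; squaring
      gives the dominating factor 9.\<close>
    have "(\<lambda>n. sqdist h (s n)) \<longlonglongrightarrow> (\<integral>\<^sup>+\<omega>. 0 \<partial>?U)"
      unfolding sqdist_def
    proof (rule nn_integral_dominated_convergence[where w = "\<lambda>\<omega>. 9 * ennreal ((cmod (h \<omega>))\<^sup>2)"])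
      show "AE \<omega> in ?U. (\<lambda>n. ennreal ((cmod (h \<omega> - s n \<omega>))\<^sup>2)) \<longlonglongrightarrow> 0"
      proof (rule AE_I2)
        fix \<omega>
        have "(\<lambda>n. (cmod (h \<omega> - s n \<omega>))\<^sup>2) \<longlonglongrightarrow> (cmod (h \<omega> - h \<omega>))\<^sup>2" by (intro tendsto_intros lim)
        then have "(\<lambda>n. (cmod (h \<omega> - s n \<omega>))\<^sup>2) \<longlonglongrightarrow> 0" by simp
        from tendsto_ennrealI[OF this] show "(\<lambda>n. ennreal ((cmod (h \<omega> - s n \<omega>))\<^sup>2)) \<longlonglongrightarrow> 0" by simp
      qed
      show "AE \<omega> in ?U. ennreal ((cmod (h \<omega> - s n \<omega>))\<^sup>2) \<le> 9 * ennreal ((cmod (h \<omega>))\<^sup>2)" for n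
      proof (rule AE_I2)
        fix \<omega>
        have "cmod (h \<omega> - s n \<omega>) \<le> cmod (h \<omega>) + cmod (s n \<omega>)" by (rule norm_triangle_ineq4)
        also have "\<dots> \<le> 3 * cmod (h \<omega>)" using bd[of n \<omega>] by simp
        finally have "(cmod (h \<omega> - s n \<omega>))\<^sup>2 \<le> (3 * cmod (h \<omega>))\<^sup>2" by (rule power_mono) simp
        then have "ennreal ((cmod (h \<omega> - s n \<omega>))\<^sup>2) \<le> ennreal (9 * (cmod (h \<omega>))\<^sup>2)"
          by (intro ennreal_leI) (simp add: power_mult_distrib)
        then show "ennreal ((cmod (h \<omega> - s n \<omega>))\<^sup>2) \<le> 9 * ennreal ((cmod (h \<omega>))\<^sup>2)"
          by (simp add: ennreal_mult)
      qed
      show "(\<integral>\<^sup>+\<omega>. 9 * ennreal ((cmod (h \<omega>))\<^sup>2) \<partial>?U) < \<infinity>"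
        using fin by (simp add: nn_integral_cmult ennreal_mult_less_top)
    qed measurable
    then have "(\<lambda>n. sqdist h (s n)) \<longlonglongrightarrow> 0" by simp
    then have "eventually (\<lambda>n. sqdist h (s n) < ennreal \<epsilon>) sequentially"
      by (rule order_tendstoD) (use \<open>\<epsilon> > 0\<close> in simp)
    then obtain n where "sqdist h (s n) < ennreal \<epsilon>" by (auto simp: eventually_sequentially)
    then show "\<exists>g. g \<in> borel_measurable borel \<and> trig_approximable g \<and> sqdist h g \<le> ennreal \<epsilon>"
      using approx[of n] by (intro exI[of _ "s n"]) (auto intro: less_imp_le)
  qed
qed

section \<open>Bessel's inequality and Parseval's identity\<close>

lemma integrable_of_sq_integrable:
  fixes h :: "'a \<Rightarrow> complex"
  assumes "finite_measure M" "h \<in> borel_measurable M" "integrable M (\<lambda>x. (cmod (h x))\<^sup>2)"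
  shows "integrable M h"
proof -
  interpret finite_measure M by fact
  have "integrable M (\<lambda>x. 1 + (cmod (h x))\<^sup>2)" using assms by simp
  then show ?thesis
  proof (rule Bochner_Integration.integrable_bound)
    show "AE x in M. norm (h x) \<le> norm (1 + (cmod (h x))\<^sup>2)"
    proof (rule AE_I2)
      fix x
      have "0 \<le> (cmod (h x) - 1)\<^sup>2" by simp
      then have "2 * cmod (h x) \<le> 1 + (cmod (h x))\<^sup>2" by (simp add: power2_eq_square algebra_simps)
      moreover have "0 \<le> cmod (h x)" by simp
      ultimately have "cmod (h x) \<le> 1 + (cmod (h x))\<^sup>2" by linarith
      then show "norm (h x) \<le> norm (1 + (cmod (h x))\<^sup>2)" by simp
    qed
  qed (use assms in simp)
qed

text \<open>Expanding the square and using orthonormality of the characters. Choosing a = c gives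
  Bessel, general \<open>a\<close> serves for completeness, and h = 0 gives the norm of a
  polynomial. Nonnegativity is stated separately because \<open>ennreal\<close> would hide a
  negative value.\<close>

lemma sqdist_trig_sum:
  fixes h :: "real^'d \<Rightarrow> complex"
  assumes h[measurable]: "h \<in> borel_measurable borel"
    and int2: "integrable cube_measure (\<lambda>\<omega>. (cmod (h \<omega>))\<^sup>2)"
    and L: "finite L" "L \<subseteq> int_lattice"
    and c: "\<And>l. c l = (LINT \<omega>|cube_measure. h \<omega> * cnj (chi l \<omega>))"
  shows "0 \<le> (LINT \<omega>|cube_measure. (cmod (h \<omega>))\<^sup>2) - (\<Sum>l\<in>L. (cmod (c l))\<^sup>2) + (\<Sum>l\<in>L. (cmod (c l - a l))\<^sup>2)"
    and "sqdist h (\<lambda>\<omega>. \<Sum>l\<in>L. a l * chi l \<omega>)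
    = ennreal ((LINT \<omega>|cube_measure. (cmod (h \<omega>))\<^sup>2) - (\<Sum>l\<in>L. (cmod (c l))\<^sup>2) + (\<Sum>l\<in>L. (cmod (c l - a l))\<^sup>2))"
proof -
  let ?U = "cube_measure :: (real^'d) measure"
  interpret prob_space ?U by (rule prob_space_cube_measure)
  have inth: "integrable ?U h" by (rule integrable_of_sq_integrable[OF _ _ int2]) (simp_all add: finite_measure_axioms)
  have int_chi: "integrable ?U (\<lambda>\<omega>. h \<omega> * cnj (chi l \<omega>))" for l
    using inth by (rule Bochner_Integration.integrable_bound) (auto simp: norm_mult)
  have intcc: "integrable ?U (\<lambda>\<omega>. chi l \<omega>)" for l
    by (rule integrable_const_bound[of _ 1]) auto
  let ?p = "\<lambda>\<omega>. \<Sum>l\<in>L. a l * chi l \<omega>"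
  have pw: "complex_of_real ((cmod (h \<omega> - ?p \<omega>))\<^sup>2) = of_real ((cmod (h \<omega>))\<^sup>2)
      - (\<Sum>l\<in>L. cnj (a l) * (h \<omega> * cnj (chi l \<omega>))) - (\<Sum>l\<in>L. a l * cnj (h \<omega> * cnj (chi l \<omega>)))
      + (\<Sum>l\<in>L. \<Sum>k\<in>L. a l * cnj (a k) * chi (l - k) \<omega>)" for \<omega>
  proof -
    have "complex_of_real ((cmod (h \<omega> - ?p \<omega>))\<^sup>2) = (h \<omega> - ?p \<omega>) * cnj (h \<omega> - ?p \<omega>)"
      by (rule complex_norm_square)
    also have "\<dots> = h \<omega> * cnj (h \<omega>) - h \<omega> * cnj (?p \<omega>) - ?p \<omega> * cnj (h \<omega>) + ?p \<omega> * cnj (?p \<omega>)"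
      by (simp add: algebra_simps)
    also have "h \<omega> * cnj (h \<omega>) = of_real ((cmod (h \<omega>))\<^sup>2)" by (rule complex_norm_square[symmetric])
    also have "h \<omega> * cnj (?p \<omega>) = (\<Sum>l\<in>L. cnj (a l) * (h \<omega> * cnj (chi l \<omega>)))"
      by (simp add: sum_distrib_left mult_ac)
    also have "?p \<omega> * cnj (h \<omega>) = (\<Sum>l\<in>L. a l * cnj (h \<omega> * cnj (chi l \<omega>)))"
      by (simp add: sum_distrib_left sum_distrib_right mult_ac)
    also have "?p \<omega> * cnj (?p \<omega>) = (\<Sum>l\<in>L. \<Sum>k\<in>L. a l * cnj (a k) * chi (l - k) \<omega>)"
    proof -
      have "chi l \<omega> * cnj (chi k \<omega>) = chi (l - k) \<omega>" for l k
        using chi_add_left[of l "- k" \<omega>] by (simp add: cnj_chi)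
      then show ?thesis
        by (simp add: sum_product mult_ac)
    qed
    finally show ?thesis .
  qed
  have intpw: "integrable ?U (\<lambda>\<omega>. complex_of_real ((cmod (h \<omega> - ?p \<omega>))\<^sup>2))"
    unfolding pw using int2 int_chi intcc
    by (intro Bochner_Integration.integrable_add Bochner_Integration.integrable_diff
        Bochner_Integration.integrable_sum integrable_mult_right integrable_cnj integrable_of_real) auto
  have "(LINT \<omega>|?U. complex_of_real ((cmod (h \<omega> - ?p \<omega>))\<^sup>2))
      = of_real (LINT \<omega>|?U. (cmod (h \<omega>))\<^sup>2) - (\<Sum>l\<in>L. cnj (a l) * c l) - (\<Sum>l\<in>L. a l * cnj (c l))
        + (\<Sum>l\<in>L. \<Sum>k\<in>L. a l * cnj (a k) * (LINT \<omega>|?U. chi (l - k) \<omega>))"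
    unfolding pw c
    using int2 int_chi intcc
    by (simp add: Bochner_Integration.integral_sum integrable_of_real del: of_real_power complex_cnj_mult)
  also have "(\<Sum>l\<in>L. \<Sum>k\<in>L. a l * cnj (a k) * (LINT \<omega>|?U. chi (l - k) \<omega>)) = (\<Sum>l\<in>L. a l * cnj (a l))"
  proof (rule sum.cong[OF refl])
    fix l assume l: "l \<in> L"
    have "(LINT \<omega>|?U. chi (l - k) \<omega>) = (if k = l then 1 else 0)" if "k \<in> L" for k
      using integral_cube_chi[OF int_lattice_diff[of l k]] l that L(2) by (auto simp: subset_iff)
    then have "(\<Sum>k\<in>L. a l * cnj (a k) * (LINT \<omega>|?U. chi (l - k) \<omega>))
        = (\<Sum>k\<in>L. if k = l then a l * cnj (a l) else 0)"
      by (intro sum.cong) auto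
    then show "(\<Sum>k\<in>L. a l * cnj (a k) * (LINT \<omega>|?U. chi (l - k) \<omega>)) = a l * cnj (a l)"
      using L l by simp
  qed
  also have "of_real (LINT \<omega>|?U. (cmod (h \<omega>))\<^sup>2) - (\<Sum>l\<in>L. cnj (a l) * c l) - (\<Sum>l\<in>L. a l * cnj (c l)) + (\<Sum>l\<in>L. a l * cnj (a l))
      = of_real (LINT \<omega>|?U. (cmod (h \<omega>))\<^sup>2) - (\<Sum>l\<in>L. c l * cnj (c l)) + (\<Sum>l\<in>L. (c l - a l) * cnj (c l - a l))"
    by (simp add: algebra_simps sum.distrib sum_subtractf)
  also have "\<dots> = of_real ((LINT \<omega>|?U. (cmod (h \<omega>))\<^sup>2) - (\<Sum>l\<in>L. (cmod (c l))\<^sup>2) + (\<Sum>l\<in>L. (cmod (c l - a l))\<^sup>2))"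
    by (simp only: complex_norm_square[symmetric] of_real_sum[symmetric] of_real_diff[symmetric] of_real_add[symmetric])
  finally have eq: "(LINT \<omega>|?U. (cmod (h \<omega> - ?p \<omega>))\<^sup>2)
      = (LINT \<omega>|?U. (cmod (h \<omega>))\<^sup>2) - (\<Sum>l\<in>L. (cmod (c l))\<^sup>2) + (\<Sum>l\<in>L. (cmod (c l - a l))\<^sup>2)"
    by (simp only: integral_complex_of_real of_real_eq_iff)
  have "integrable ?U (\<lambda>\<omega>. (cmod (h \<omega> - ?p \<omega>))\<^sup>2)"
    using integrable_Re[OF intpw] by (simp only: Re_complex_of_real)
  then have "sqdist h ?p = ennreal (LINT \<omega>|?U. (cmod (h \<omega> - ?p \<omega>))\<^sup>2)"
    unfolding sqdist_def by (rule nn_integral_eq_integral) simp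
  then show "sqdist h ?p
    = ennreal ((LINT \<omega>|?U. (cmod (h \<omega>))\<^sup>2) - (\<Sum>l\<in>L. (cmod (c l))\<^sup>2) + (\<Sum>l\<in>L. (cmod (c l - a l))\<^sup>2))"
    by (simp only: eq)
  show "0 \<le> (LINT \<omega>|?U. (cmod (h \<omega>))\<^sup>2) - (\<Sum>l\<in>L. (cmod (c l))\<^sup>2) + (\<Sum>l\<in>L. (cmod (c l - a l))\<^sup>2)"
    unfolding eq[symmetric] by simp
qed

lemma parseval_cube:
  fixes h :: "real^'d \<Rightarrow> complex"
  assumes h[measurable]: "h \<in> borel_measurable borel"
    and fin: "(\<integral>\<^sup>+\<omega>. ennreal ((cmod (h \<omega>))\<^sup>2) \<partial>cube_measure) < \<infinity>"
  shows "(\<Sum>\<^sub>\<infinity>l\<in>int_lattice. ennreal ((cmod (LINT \<omega>|cube_measure. h \<omega> * chi l \<omega>))\<^sup>2))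
    = (\<integral>\<^sup>+\<omega>. ennreal ((cmod (h \<omega>))\<^sup>2) \<partial>cube_measure)"
proof -
  let ?U = "cube_measure :: (real^'d) measure"
  define c where "c l = (LINT \<omega>|?U. h \<omega> * cnj (chi l \<omega>))" for l
  define I where "I = (LINT \<omega>|?U. (cmod (h \<omega>))\<^sup>2)"
  have int2: "integrable ?U (\<lambda>\<omega>. (cmod (h \<omega>))\<^sup>2)"
    using fin by (simp add: integrable_iff_bounded)
  have I: "(\<integral>\<^sup>+\<omega>. ennreal ((cmod (h \<omega>))\<^sup>2) \<partial>?U) = ennreal I"
    unfolding I_def by (rule nn_integral_eq_integral[OF int2]) simp
  note sq_nonneg = sqdist_trig_sum(1)[OF h int2 _ _ c_def, folded I_def]
    and sq = sqdist_trig_sum(2)[OF h int2 _ _ c_def, folded I_def]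
  have "(\<Sum>\<^sub>\<infinity>l\<in>int_lattice. ennreal ((cmod (c l))\<^sup>2)) = ennreal I"
  proof (rule antisym)
    have "(\<Sum>l\<in>L. ennreal ((cmod (c l))\<^sup>2)) \<le> ennreal I" if L: "finite L" "L \<subseteq> int_lattice" for L
      using sq_nonneg[OF L, of c] by (simp add: sum_ennreal ennreal_leI)
    then show "(\<Sum>\<^sub>\<infinity>l\<in>int_lattice. ennreal ((cmod (c l))\<^sup>2)) \<le> ennreal I"
      by (subst nonneg_infsum_complete) (auto intro!: SUP_least)
  next
    show "ennreal I \<le> (\<Sum>\<^sub>\<infinity>l\<in>int_lattice. ennreal ((cmod (c l))\<^sup>2))"
    proof (rule ennreal_le_epsilon)
      fix \<epsilon> :: real assume "0 < \<epsilon>"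
      \<comment> \<open>Completeness: the squared error of any approximating polynomial dominates
        the energy missing from its finitely many coefficients.\<close>
      have "trig_approximable h" by (rule trig_approximable_L2[OF h fin])
      then obtain p where p: "trig_poly p" "sqdist h p \<le> ennreal \<epsilon>"
        using \<open>0 < \<epsilon>\<close> by (rule trig_approximableD)
      obtain L a where L: "finite L" "L \<subseteq> int_lattice" "p = (\<lambda>\<omega>. \<Sum>l\<in>L. a l * chi l \<omega>)"
        by (rule trig_poly_normal_form[OF p(1)])
      have "ennreal (I - (\<Sum>l\<in>L. (cmod (c l))\<^sup>2) + (\<Sum>l\<in>L. (cmod (c l - a l))\<^sup>2)) \<le> ennreal \<epsilon>"
        using p(2) sq[OF L(1,2), of a] L(3) by simp
      then have "I - (\<Sum>l\<in>L. (cmod (c l))\<^sup>2) + (\<Sum>l\<in>L. (cmod (c l - a l))\<^sup>2) \<le> \<epsilon>"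
        using \<open>0 < \<epsilon>\<close> by (simp add: ennreal_le_iff)
      moreover have "0 \<le> (\<Sum>l\<in>L. (cmod (c l - a l))\<^sup>2)" by (simp add: sum_nonneg)
      ultimately have "I \<le> (\<Sum>l\<in>L. (cmod (c l))\<^sup>2) + \<epsilon>" by linarith
      then have "ennreal I \<le> ennreal ((\<Sum>l\<in>L. (cmod (c l))\<^sup>2) + \<epsilon>)" by (rule ennreal_leI)
      also have "\<dots> = (\<Sum>l\<in>L. ennreal ((cmod (c l))\<^sup>2)) + ennreal \<epsilon>"
        using \<open>0 < \<epsilon>\<close> by (subst ennreal_plus) (auto simp: sum_nonneg sum_ennreal)
      also have "(\<Sum>l\<in>L. ennreal ((cmod (c l))\<^sup>2)) \<le> (\<Sum>\<^sub>\<infinity>l\<in>int_lattice. ennreal ((cmod (c l))\<^sup>2))"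
        unfolding nonneg_infsum_complete[of int_lattice "\<lambda>l. ennreal ((cmod (c l))\<^sup>2)", OF zero_le]
        using L by (intro SUP_upper) auto
      finally show "ennreal I \<le> (\<Sum>\<^sub>\<infinity>l\<in>int_lattice. ennreal ((cmod (c l))\<^sup>2)) + ennreal \<epsilon>"
        by (simp add: add_right_mono)
    qed
  qed
  moreover have "(\<Sum>\<^sub>\<infinity>l\<in>int_lattice. ennreal ((cmod (c l))\<^sup>2))
      = (\<Sum>\<^sub>\<infinity>l\<in>int_lattice. ennreal ((cmod (LINT \<omega>|?U. h \<omega> * chi l \<omega>))\<^sup>2))"
  \<comment> \<open>The Fourier coefficients carry a conjugate character while samples carry a plain
    one; l and -l are exchanged.\<close>
  proof (rule infsum_reindex_bij_witness[of _ uminus uminus])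
    fix l :: "real^'d" assume "l \<in> int_lattice"
    then show "ennreal ((cmod (LINT \<omega>|?U. h \<omega> * chi (- l) \<omega>))\<^sup>2) = ennreal ((cmod (c l))\<^sup>2)"
      by (simp add: c_def cnj_chi)
  qed (auto intro: int_lattice_minus)
  ultimately show ?thesis using I by simp
qed

subsection \<open>Gaussian summation of the inverse Fourier transform\<close>

text \<open>Rescaling by \<tau> turns this into the characteristic function of the standard normal
  law at \<tau> c.\<close>

lemma integral_gaussian_cis:
  fixes c \<tau> :: real
  assumes \<tau>: "0 < \<tau>"
  shows "integrable lborel (\<lambda>u. complex_of_real (exp (- (u / \<tau>)\<^sup>2 / 2)) * cis (c * u))"
    and "(LINT u|lborel. complex_of_real (exp (- (u / \<tau>)\<^sup>2 / 2)) * cis (c * u))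
      = of_real (sqrt (2 * pi) * \<tau> * exp (- (\<tau> * c)\<^sup>2 / 2))"
proof -
  let ?F = "\<lambda>u. complex_of_real (exp (- (u / \<tau>)\<^sup>2 / 2)) * cis (c * u)"
  have F: "?F (0 + \<tau> * v) = sqrt (2 * pi) *\<^sub>R (std_normal_density v *\<^sub>R cis (\<tau> * c * v))" for v
    using \<tau> by (simp add: std_normal_density_def scaleR_conv_of_real mult_ac)
  have "integrable lborel (\<lambda>v. std_normal_density v *\<^sub>R cis (\<tau> * c * v))"
  proof (rule Bochner_Integration.integrable_bound)
    show "integrable lborel (std_normal_density)" by (rule integrable_normal_density) simp
    show "(\<lambda>v. std_normal_density v *\<^sub>R cis (\<tau> * c * v)) \<in> borel_measurable lborel"
      unfolding cis_conv_exp by measurable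
  qed (auto simp: normal_density_nonneg)
  then have "integrable lborel (\<lambda>v. ?F (0 + \<tau> * v))" unfolding F by (rule integrable_scaleR_right)
  then show "integrable lborel ?F"
    using lborel_integrable_real_affine_iff[of \<tau> ?F 0] \<tau> by simp
  have "(LINT u|lborel. ?F u) = \<bar>\<tau>\<bar> *\<^sub>R (LINT v|lborel. ?F (0 + \<tau> * v))"
    by (rule lborel_integral_real_affine) (use \<tau> in simp)
  also have "(LINT v|lborel. ?F (0 + \<tau> * v)) = sqrt (2 * pi) *\<^sub>R (LINT v|lborel. std_normal_density v *\<^sub>R cis (\<tau> * c * v))"
    unfolding F by (rule integral_scaleR_right)
  also have "(LINT v|lborel. std_normal_density v *\<^sub>R cis (\<tau> * c * v)) = char std_normal_distribution (\<tau> * c)"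
    unfolding char_def cis_conv_exp
    by (subst integral_density) (auto simp: normal_density_nonneg mult_ac)
  also have "\<dots> = of_real (exp (- (\<tau> * c)\<^sup>2 / 2))" by (simp add: char_std_normal_distribution)
  finally show "(LINT u|lborel. ?F u) = of_real (sqrt (2 * pi) * \<tau> * exp (- (\<tau> * c)\<^sup>2 / 2))"
    using \<tau> by (simp add: scaleR_conv_of_real mult_ac)
qed

text \<open>A cutoff in frequency that tends to 1 as \<tau> grows.\<close>

definition gauss :: "real \<Rightarrow> real^'d \<Rightarrow> real" where
  "gauss \<tau> \<omega> = exp (- (norm \<omega> / \<tau>)\<^sup>2 / 2)"

text \<open>This is the Fourier transform of \<open>gauss \<tau>\<close>: a probability density in
  space that concentrates at 0 as \<tau> grows.\<close>

definition gauss_kernel :: "real \<Rightarrow> real^'d \<Rightarrow> real" where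
  "gauss_kernel \<tau> x = (sqrt (2 * pi) * \<tau>) ^ CARD('d) * exp (- (2 * pi * \<tau> * norm x)\<^sup>2 / 2)"

lemma gauss_prod: "gauss \<tau> \<omega> = (\<Prod>i\<in>UNIV. exp (- (\<omega> $ i / \<tau>)\<^sup>2 / 2))"
proof -
  have "(norm \<omega>)\<^sup>2 = (\<Sum>i\<in>UNIV. (\<omega> $ i)\<^sup>2)"
    by (simp only: power2_norm_eq_inner inner_vec_def) (simp add: power2_eq_square)
  then have "- (norm \<omega> / \<tau>)\<^sup>2 / 2 = (\<Sum>i\<in>UNIV. - (\<omega> $ i / \<tau>)\<^sup>2 / 2)"
    by (simp add: power_divide sum_divide_distrib sum_negf)
  then show ?thesis by (simp add: gauss_def exp_sum)
qed

lemma gauss_kernel_prod: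
  "gauss_kernel \<tau> x = (\<Prod>i\<in>UNIV. sqrt (2 * pi) * \<tau> * exp (- (\<tau> * (2 * pi * x $ i))\<^sup>2 / 2))"
proof -
  have "(norm x)\<^sup>2 = (\<Sum>i\<in>UNIV. (x $ i)\<^sup>2)"
    by (simp only: power2_norm_eq_inner inner_vec_def) (simp add: power2_eq_square)
  then have "- (2 * pi * \<tau> * norm x)\<^sup>2 / 2 = (\<Sum>i\<in>UNIV. - (\<tau> * (2 * pi * x $ i))\<^sup>2 / 2)"
    by (simp add: power_mult_distrib sum_divide_distrib sum_negf sum_distrib_left mult_ac)
  then show ?thesis by (simp add: gauss_kernel_def exp_sum prod.distrib)
qed

lemma gauss_measurable [measurable]: "gauss \<tau> \<in> borel_measurable borel"
  unfolding gauss_def by measurable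

lemma gauss_kernel_measurable [measurable]: "gauss_kernel \<tau> \<in> borel_measurable borel"
  unfolding gauss_kernel_def by measurable

lemma gauss_bounds: "0 \<le> gauss \<tau> \<omega>" "gauss \<tau> \<omega> \<le> 1"
  by (auto simp: gauss_def)

lemma gauss_kernel_bounds:
  assumes "0 < \<tau>"
  shows "0 \<le> gauss_kernel \<tau> (x :: real^'d)" "gauss_kernel \<tau> x \<le> (sqrt (2 * pi) * \<tau>) ^ CARD('d)"
  using assms by (auto simp: gauss_kernel_def intro!: mult_left_le)

lemma integral_gauss_chi:
  fixes a x :: "real^'d"
  assumes \<tau>: "0 < \<tau>"
  shows "(LINT \<omega>|lborel. of_real (gauss \<tau> \<omega>) * chi a \<omega> * cnj (chi x \<omega>)) = of_real (gauss_kernel \<tau> (x - a))"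
proof -
  let ?f = "\<lambda>i u. complex_of_real (exp (- (u / \<tau>)\<^sup>2 / 2)) * cis (2 * pi * (a $ i - x $ i) * u)"
  have "chi a \<omega> * cnj (chi x \<omega>) = chi (a - x) \<omega>" for \<omega>
    using chi_add_left[of a "- x" \<omega>] by (simp add: cnj_chi)
  then have "of_real (gauss \<tau> \<omega>) * chi a \<omega> * cnj (chi x \<omega>) = (\<Prod>i\<in>UNIV. ?f i (\<omega> $ i))" for \<omega>
    by (simp only: mult.assoc) (simp add: gauss_prod chi_prod prod.distrib mult_ac)
  then have "(LINT \<omega>|lborel. of_real (gauss \<tau> \<omega>) * chi a \<omega> * cnj (chi x \<omega>)) = (\<Prod>i\<in>UNIV. LINT u|lborel. ?f i u)"
    by (simp only: lborel_integral_prod_vec(2)[OF integral_gaussian_cis(1)[OF \<tau>]])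
  also have "\<dots> = (\<Prod>i\<in>UNIV. of_real (sqrt (2 * pi) * \<tau> * exp (- (\<tau> * (2 * pi * (a $ i - x $ i)))\<^sup>2 / 2)))"
    by (simp only: integral_gaussian_cis(2)[OF \<tau>])
  also have "\<dots> = of_real (gauss_kernel \<tau> (x - a))"
    unfolding gauss_kernel_prod of_real_prod
    by (intro prod.cong refl arg_cong[of _ _ complex_of_real] arg_cong2[of _ _ _ _ "(*)"] arg_cong[of _ _ exp])
       (simp add: power2_eq_square algebra_simps)
  finally show ?thesis .
qed

lemma gauss_integrable:
  assumes "0 < \<tau>"
  shows "integrable lborel (gauss \<tau> :: real^'d \<Rightarrow> real)"
proof -
  have "integrable lborel (\<lambda>\<omega>::real^'d. \<Prod>i\<in>UNIV. complex_of_real (exp (- (\<omega> $ i / \<tau>)\<^sup>2 / 2)) * cis (0 * \<omega> $ i))"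
    by (rule lborel_integral_prod_vec(1)) (rule integral_gaussian_cis(1)[OF assms])
  also have "(\<lambda>\<omega>::real^'d. \<Prod>i\<in>UNIV. complex_of_real (exp (- (\<omega> $ i / \<tau>)\<^sup>2 / 2)) * cis (0 * \<omega> $ i))
      = (\<lambda>\<omega>. complex_of_real (gauss \<tau> \<omega>))"
    by (simp add: gauss_prod)
  finally have "integrable lborel (\<lambda>\<omega>::real^'d. Re (complex_of_real (gauss \<tau> \<omega>)))" by (rule integrable_Re)
  then show ?thesis by simp
qed

lemma gauss_kernel_integral:
  fixes a :: "real^'d"
  assumes \<tau>: "0 < \<tau>"
  shows "integrable lborel (\<lambda>x. gauss_kernel \<tau> (x - a :: real^'d))"
    and "(LINT x|lborel. gauss_kernel \<tau> (x - a :: real^'d)) = 1"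
proof -
  \<comment> \<open>The kernel is itself an unnormalised Gaussian of width 1 / (2 pi \<tau>), so the
    one-dimensional formula at frequency 0 integrates it.\<close>
  let ?\<mu> = "1 / (2 * pi * \<tau>)"
  have \<mu>: "0 < ?\<mu>" using \<tau> by simp
  let ?f = "\<lambda>(i::'d) u. complex_of_real (sqrt (2 * pi) * \<tau>) * (complex_of_real (exp (- (u / ?\<mu>)\<^sup>2 / 2)) * cis (0 * u))"
  have intf: "integrable lborel (?f i)" for i :: 'd
    by (intro integrable_mult_right integral_gaussian_cis(1)[OF \<mu>])
  have eq: "complex_of_real (gauss_kernel \<tau> x) = (\<Prod>i\<in>UNIV. ?f i (x $ i))" for x :: "real^'d"
    unfolding gauss_kernel_prod by (simp add: mult_ac)
  have "integrable lborel (\<lambda>x::real^'d. complex_of_real (gauss_kernel \<tau> x))"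
    unfolding eq by (rule lborel_integral_prod_vec(1)) (rule intf)
  then have int: "integrable lborel (\<lambda>x::real^'d. gauss_kernel \<tau> x)"
    using integrable_Re by fastforce
  have "(LINT u|lborel. ?f i u) = 1" for i :: 'd
  proof -
    have "(LINT u|lborel. ?f i u) = of_real (sqrt (2 * pi) * \<tau>) * (LINT u|lborel. complex_of_real (exp (- (u / ?\<mu>)\<^sup>2 / 2)) * cis (0 * u))"
      by (rule integral_mult_right_zero)
    also have "\<dots> = of_real (sqrt (2 * pi) * \<tau>) * of_real (sqrt (2 * pi) * ?\<mu> * exp (- (?\<mu> * 0)\<^sup>2 / 2))"
      by (simp only: integral_gaussian_cis(2)[OF \<mu>])
    also have "exp (- (?\<mu> * 0)\<^sup>2 / 2) = 1" by simp
    also have "of_real (sqrt (2 * pi) * \<tau>) * complex_of_real (sqrt (2 * pi) * ?\<mu> * 1)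
        = of_real ((sqrt (2 * pi) * \<tau>) * (sqrt (2 * pi) * ?\<mu>))"
      by (simp only: of_real_mult mult_1_right)
    also have "(sqrt (2 * pi) * \<tau>) * (sqrt (2 * pi) * ?\<mu>) = 1" using \<tau> by simp
    finally show ?thesis by simp
  qed
  then have "(LINT x|lborel. complex_of_real (gauss_kernel \<tau> (x::real^'d))) = 1"
    unfolding eq lborel_integral_prod_vec(2)[OF intf] by simp
  then have one: "(LINT x|lborel. gauss_kernel \<tau> (x::real^'d)) = 1" by simp
  have d: "lborel = distr lborel borel ((+) (- a))" by (rule lborel_distr_plus[symmetric])
  show "integrable lborel (\<lambda>x. gauss_kernel \<tau> (x - a))"
    using int by (subst (asm) d, subst (asm) integrable_distr_eq) (simp_all add: algebra_simps)
  show "(LINT x|lborel. gauss_kernel \<tau> (x - a)) = 1"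
    using one by (subst (asm) d, subst (asm) integral_distr) (simp_all add: algebra_simps)
qed

text \<open>Half of the exponent is spent on a small constant; the other half is, up to
  normalisation, the wider kernel with \<tau> / sqrt 2. Off a ball the kernel is thus a tiny
  multiple of another probability density.\<close>

lemma gauss_kernel_tail:
  assumes \<tau>: "0 < \<tau>" and x: "\<delta> \<le> norm x" "0 < \<delta>"
  shows "gauss_kernel \<tau> (x :: real^'d)
    \<le> sqrt 2 ^ CARD('d) * exp (- (pi * \<tau> * \<delta>)\<^sup>2) * gauss_kernel (\<tau> / sqrt 2) x"
proof -
  have e: "- (2 * pi * \<tau> * norm x)\<^sup>2 / 2 = - (pi * \<tau> * norm x)\<^sup>2 + - (2 * pi * (\<tau> / sqrt 2) * norm x)\<^sup>2 / 2"
    by (simp add: power_mult_distrib power_divide)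
  have "gauss_kernel \<tau> x = sqrt 2 ^ CARD('d) * exp (- (pi * \<tau> * norm x)\<^sup>2) * gauss_kernel (\<tau> / sqrt 2) x"
    unfolding gauss_kernel_def e exp_add by (simp add: power_mult_distrib power_divide)
  also have "\<dots> \<le> sqrt 2 ^ CARD('d) * exp (- (pi * \<tau> * \<delta>)\<^sup>2) * gauss_kernel (\<tau> / sqrt 2) x"
  proof (intro mult_right_mono mult_left_mono)
    have "(pi * \<tau> * \<delta>)\<^sup>2 \<le> (pi * \<tau> * norm x)\<^sup>2" using x \<tau> by (intro power_mono mult_left_mono) auto
    then show "exp (- (pi * \<tau> * norm x)\<^sup>2) \<le> exp (- (pi * \<tau> * \<delta>)\<^sup>2)" by simp
    show "0 \<le> gauss_kernel (\<tau> / sqrt 2) x" using \<tau> by (intro gauss_kernel_bounds) simp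
  qed auto
  finally show ?thesis .
qed

text \<open>Continuity alone gives no control of f far from \<open>a\<close>, so the tail uses |f|
  <= 1 + |f|^2: the constant part is integrated against the wider kernel, and the square part uses
  the maximum of that kernel together with square integrability.\<close>

lemma gauss_kernel_approx:
  fixes f :: "real^'d \<Rightarrow> complex"
  assumes cont: "continuous_on UNIV f" and int2: "integrable lborel (\<lambda>x. (cmod (f x))\<^sup>2)"
  shows "(\<lambda>n. LINT x|lborel. f x * of_real (gauss_kernel (real (Suc n)) (x - a))) \<longlonglongrightarrow> f a"
proof (rule LIMSEQ_I)
  fix \<epsilon> :: real assume \<epsilon>: "0 < \<epsilon>"
  have [measurable]: "f \<in> borel_measurable borel" using cont by (rule borel_measurable_continuous_onI)
  have "isCont f a" using cont by (simp add: continuous_on_eq_continuous_at)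
  then obtain \<delta> where \<delta>: "0 < \<delta>" "\<And>x. norm (x - a) < \<delta> \<Longrightarrow> cmod (f x - f a) < \<epsilon> / 2"
    using \<epsilon> unfolding continuous_at_eps_delta dist_norm by (meson half_gt_zero)
  define I where "I = (LINT x|lborel. (cmod (f x))\<^sup>2)"
  define C where "C n = sqrt 2 ^ CARD('d) * exp (- (pi * real (Suc n) * \<delta>)\<^sup>2)" for n
  define D where "D n = (sqrt (2 * pi) * (real (Suc n) / sqrt 2)) ^ CARD('d)" for n
  have bound: "cmod ((LINT x|lborel. f x * of_real (gauss_kernel (real (Suc n)) (x - a))) - f a)
      \<le> \<epsilon> / 2 + (1 + cmod (f a)) * C n + C n * D n * I" for n
  proof -
    let ?\<tau> = "real (Suc n)" and ?\<mu> = "real (Suc n) / sqrt 2"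
    let ?K = "\<lambda>x. gauss_kernel ?\<tau> (x - a)" and ?M = "\<lambda>x. gauss_kernel ?\<mu> (x - a)"
    have \<tau>: "0 < ?\<tau>" and \<mu>: "0 < ?\<mu>" by auto
    note K = gauss_kernel_integral[OF \<tau>, of a] and M = gauss_kernel_integral[OF \<mu>, of a]
    have K0: "0 \<le> ?K x" "0 \<le> ?M x" "?M x \<le> D n" for x
      using gauss_kernel_bounds[OF \<tau>] gauss_kernel_bounds[OF \<mu>] by (auto simp: D_def)
    have C0: "0 \<le> C n" by (simp add: C_def)
    \<comment> \<open>The three terms are the continuity region, the tail of 1 + |f a|, and the tail
      of |f|^2.\<close>
    let ?B = "\<lambda>x. \<epsilon> / 2 * ?K x + (1 + cmod (f a)) * C n * ?M x + C n * D n * (cmod (f x))\<^sup>2"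
    have intB: "integrable lborel ?B"
      using K(1) M(1) int2 by simp
    have le: "cmod ((f x - f a) * of_real (?K x)) \<le> ?B x" for x
    proof (cases "norm (x - a) < \<delta>")
      case True
      have "cmod ((f x - f a) * of_real (?K x)) = cmod (f x - f a) * ?K x" using K0 by (simp add: norm_mult)
      also have "\<dots> \<le> \<epsilon> / 2 * ?K x" using \<delta>(2)[OF True] K0 by (intro mult_right_mono) auto
      finally show ?thesis using K0 C0 by (auto intro!: add_increasing2 mult_nonneg_nonneg simp: D_def)
    next
      case False
      have "0 \<le> (cmod (f x) - 1)\<^sup>2" by simp
      then have "2 * cmod (f x) \<le> 1 + (cmod (f x))\<^sup>2" by (simp add: power2_eq_square algebra_simps)
      then have f1: "cmod (f x) \<le> 1 + (cmod (f x))\<^sup>2" using norm_ge_zero[of "f x"] by linarith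
      have "cmod ((f x - f a) * of_real (?K x)) = cmod (f x - f a) * ?K x" using K0 by (simp add: norm_mult)
      also have "\<dots> \<le> (1 + (cmod (f x))\<^sup>2 + cmod (f a)) * (C n * ?M x)"
      proof (rule mult_mono)
        show "cmod (f x - f a) \<le> 1 + (cmod (f x))\<^sup>2 + cmod (f a)"
          using norm_triangle_ineq4[of "f x" "f a"] f1 by linarith
        show "?K x \<le> C n * ?M x"
          unfolding C_def by (rule gauss_kernel_tail[OF \<tau>]) (use False \<delta>(1) in auto)
      qed (use K0 in auto)
      also have "\<dots> = (1 + cmod (f a)) * C n * ?M x + C n * (cmod (f x))\<^sup>2 * ?M x"
        by (simp add: algebra_simps)
      also have "\<dots> \<le> (1 + cmod (f a)) * C n * ?M x + C n * (cmod (f x))\<^sup>2 * D n"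
        using K0 C0 by (intro add_left_mono mult_left_mono) auto
      also have "\<dots> = (1 + cmod (f a)) * C n * ?M x + C n * D n * (cmod (f x))\<^sup>2"
        by (simp only: mult_ac)
      finally have "cmod ((f x - f a) * of_real (?K x)) \<le> (1 + cmod (f a)) * C n * ?M x + C n * D n * (cmod (f x))\<^sup>2" .
      moreover have "0 \<le> \<epsilon> / 2 * ?K x" using K0 \<epsilon> by simp
      ultimately show ?thesis by linarith
    qed
    have meas: "(\<lambda>x. (f x - f a) * of_real (?K x)) \<in> borel_measurable lborel" by measurable
    have int1: "integrable lborel (\<lambda>x. (f x - f a) * of_real (?K x))"
      using intB meas
    proof (rule Bochner_Integration.integrable_bound)
      show "AE x in lborel. norm ((f x - f a) * of_real (?K x)) \<le> norm (?B x)"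
        unfolding real_norm_def by (intro AE_I2 order_trans[OF le abs_ge_self])
    qed
    have intK: "integrable lborel (\<lambda>x. f a * complex_of_real (?K x))" using K(1) by simp
    have "(LINT x|lborel. f x * of_real (?K x)) = (LINT x|lborel. (f x - f a) * of_real (?K x) + f a * of_real (?K x))"
      by (simp add: algebra_simps)
    also have "\<dots> = (LINT x|lborel. (f x - f a) * of_real (?K x)) + f a"
      using int1 intK K(2) by (subst Bochner_Integration.integral_add) auto
    finally have "cmod ((LINT x|lborel. f x * of_real (?K x)) - f a) = cmod (LINT x|lborel. (f x - f a) * of_real (?K x))"
      by simp
    also have "\<dots> \<le> (LINT x|lborel. cmod ((f x - f a) * of_real (?K x)))"
      by (rule integral_norm_bound)
    also have "\<dots> \<le> (LINT x|lborel. ?B x)"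
      by (rule integral_mono) (use int1 intB le in \<open>auto intro!: integrable_norm\<close>)
    also have "\<dots> = \<epsilon> / 2 + (1 + cmod (f a)) * C n + C n * D n * I"
      using K M int2 by (simp add: I_def)
    finally show ?thesis .
  qed
  \<comment> \<open>In this variable \<open>D n\<close> is a multiple of X^d and \<open>C n\<close>
    one of exp (-X^2), so their product tends to 0.\<close>
  define X where "X n = pi * real (Suc n) * \<delta>" for n
  have X: "filterlim X at_top sequentially"
  proof -
    have "filterlim (\<lambda>n. (pi * \<delta>) * real (Suc n)) at_top sequentially"
      using \<delta>(1) by (intro filterlim_tendsto_pos_mult_at_top[OF tendsto_const]
          filterlim_compose[OF filterlim_real_sequentially filterlim_Suc]) auto
    then show ?thesis by (simp add: X_def[abs_def] mult_ac)
  qed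
  have lim: "(\<lambda>n. X n ^ k * exp (- (X n)\<^sup>2)) \<longlonglongrightarrow> 0" for k
  proof (rule tendsto_sandwich[of "\<lambda>_. 0"])
    have "eventually (\<lambda>n. 1 \<le> X n) sequentially" using X by (simp add: filterlim_at_top)
    then show "eventually (\<lambda>n. X n ^ k * exp (- (X n)\<^sup>2) \<le> X n ^ k / exp (X n)) sequentially"
    proof eventually_elim
      case (elim n)
      have "X n \<le> (X n)\<^sup>2" using mult_left_mono[of 1 "X n" "X n"] elim by (simp add: power2_eq_square)
      then have "exp (- (X n)\<^sup>2) \<le> exp (- X n)" by simp
      then show ?case using elim
        by (simp add: exp_minus divide_inverse mult_left_mono)
    qed
    show "eventually (\<lambda>n. 0 \<le> X n ^ k * exp (- (X n)\<^sup>2)) sequentially"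
      using \<delta>(1) by (simp add: X_def)
    show "(\<lambda>n. X n ^ k / exp (X n)) \<longlonglongrightarrow> 0"
      by (rule filterlim_compose[OF tendsto_power_div_exp_0 X])
  qed simp
  have CX: "C n = sqrt 2 ^ CARD('d) * (X n ^ 0 * exp (- (X n)\<^sup>2))" for n by (simp add: C_def X_def)
  have DX: "D n = (sqrt (2 * pi) / (sqrt 2 * pi * \<delta>)) ^ CARD('d) * X n ^ CARD('d)" for n
    unfolding D_def X_def power_mult_distrib[symmetric]
    by (rule arg_cong[of _ _ "\<lambda>t. t ^ CARD('d)"]) (use \<delta>(1) in \<open>simp add: field_simps\<close>)
  have "(\<lambda>n. (1 + cmod (f a)) * C n
      + sqrt 2 ^ CARD('d) * (sqrt (2 * pi) / (sqrt 2 * pi * \<delta>)) ^ CARD('d) * I * (X n ^ CARD('d) * exp (- (X n)\<^sup>2)))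
    \<longlonglongrightarrow> (1 + cmod (f a)) * (sqrt 2 ^ CARD('d) * 0)
      + sqrt 2 ^ CARD('d) * (sqrt (2 * pi) / (sqrt 2 * pi * \<delta>)) ^ CARD('d) * I * 0"
    unfolding CX by (intro tendsto_intros lim)
  also have "(\<lambda>n. (1 + cmod (f a)) * C n
      + sqrt 2 ^ CARD('d) * (sqrt (2 * pi) / (sqrt 2 * pi * \<delta>)) ^ CARD('d) * I * (X n ^ CARD('d) * exp (- (X n)\<^sup>2)))
    = (\<lambda>n. (1 + cmod (f a)) * C n + C n * D n * I)"
    unfolding DX CX by (simp add: mult_ac)
  finally have "(\<lambda>n. (1 + cmod (f a)) * C n + C n * D n * I) \<longlonglongrightarrow> 0" by simp
  then have "eventually (\<lambda>n. (1 + cmod (f a)) * C n + C n * D n * I < \<epsilon> / 2) sequentially"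
    using \<epsilon> by (intro order_tendstoD(2)) auto
  then obtain N where N: "\<And>n. N \<le> n \<Longrightarrow> (1 + cmod (f a)) * C n + C n * D n * I < \<epsilon> / 2"
    by (auto simp: eventually_sequentially)
  show "\<exists>N. \<forall>n\<ge>N. norm ((LINT x|lborel. f x * of_real (gauss_kernel (real (Suc n)) (x - a))) - f a) < \<epsilon>"
  proof (intro exI allI impI)
    fix n assume "N \<le> n"
    then show "norm ((LINT x|lborel. f x * of_real (gauss_kernel (real (Suc n)) (x - a))) - f a) < \<epsilon>"
      using N[of n] bound[of n] by linarith
  qed
qed

section \<open>From the L^2 Fourier relation to pointwise inversion\<close>

lemma two_mult_le_squares: "2 * (s * t) \<le> s\<^sup>2 + (t::real)\<^sup>2"
  using zero_le_power2[of "s - t"] by (simp add: power2_eq_square algebra_simps)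

lemma integrable_mult_sq_integrable:
  fixes u v :: "'a \<Rightarrow> complex"
  assumes [measurable]: "u \<in> borel_measurable M" "v \<in> borel_measurable M"
    and "integrable M (\<lambda>x. (cmod (u x))\<^sup>2)" "integrable M (\<lambda>x. (cmod (v x))\<^sup>2)"
  shows "integrable M (\<lambda>x. u x * v x)"
proof (rule Bochner_Integration.integrable_bound)
  show "integrable M (\<lambda>x. (cmod (u x))\<^sup>2 + (cmod (v x))\<^sup>2)" using assms by simp
  show "AE x in M. norm (u x * v x) \<le> norm ((cmod (u x))\<^sup>2 + (cmod (v x))\<^sup>2)"
  proof (rule AE_I2)
    fix x
    have "cmod (u x) * cmod (v x) \<le> 2 * (cmod (u x) * cmod (v x))" by simp
    also have "\<dots> \<le> (cmod (u x))\<^sup>2 + (cmod (v x))\<^sup>2" by (rule two_mult_le_squares)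
    finally show "norm (u x * v x) \<le> norm ((cmod (u x))\<^sup>2 + (cmod (v x))\<^sup>2)" by (simp add: norm_mult)
  qed
qed measurable

lemma L2_pairing_tendsto:
  fixes u :: "nat \<Rightarrow> 'a \<Rightarrow> complex"
  assumes [measurable]: "\<And>n. u n \<in> borel_measurable M" "v \<in> borel_measurable M" "\<phi> \<in> borel_measurable M"
    and lim: "(\<lambda>n. \<integral>\<^sup>+x. ennreal ((cmod (u n x - v x))\<^sup>2) \<partial>M) \<longlonglongrightarrow> 0"
    and \<phi>: "integrable M (\<lambda>x. (cmod (\<phi> x))\<^sup>2)"
    and intu: "\<And>n. integrable M (\<lambda>x. u n x * \<phi> x)" and intv: "integrable M (\<lambda>x. v x * \<phi> x)"
  shows "(\<lambda>n. LINT x|M. u n x * \<phi> x) \<longlonglongrightarrow> (LINT x|M. v x * \<phi> x)"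
proof (rule LIMSEQ_I)
  fix \<epsilon> :: real assume \<epsilon>: "0 < \<epsilon>"
  define b where "b = (LINT x|M. (cmod (\<phi> x))\<^sup>2)"
  have b0: "0 \<le> b" by (simp add: b_def)
  \<comment> \<open>Weight for Young's inequality s t <= K s^2 / 2 + t^2 / (2 K): the \<phi> term
    becomes b \<epsilon> / (2 (b + 1)), strictly below \<epsilon> / 2, and the difference term is at
    most \<epsilon> / 2 once the squared distance drops below \<epsilon> / K.\<close>
  define K where "K = (b + 1) / \<epsilon>"
  have K: "0 < K" using b0 \<epsilon> by (simp add: K_def)
  have "eventually (\<lambda>n. (\<integral>\<^sup>+x. ennreal ((cmod (u n x - v x))\<^sup>2) \<partial>M) < ennreal (\<epsilon> / K)) sequentially"
    using lim by (rule order_tendstoD) (use \<epsilon> K in simp)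
  then obtain N where N: "\<And>n. N \<le> n \<Longrightarrow> (\<integral>\<^sup>+x. ennreal ((cmod (u n x - v x))\<^sup>2) \<partial>M) < ennreal (\<epsilon> / K)"
    by (auto simp: eventually_sequentially)
  have "norm ((LINT x|M. u n x * \<phi> x) - (LINT x|M. v x * \<phi> x)) < \<epsilon>" if n: "N \<le> n" for n
  proof -
    have intd: "integrable M (\<lambda>x. (u n x - v x) * \<phi> x)"
      using Bochner_Integration.integrable_diff[OF intu[of n] intv] by (simp add: left_diff_distrib)
    have "(LINT x|M. u n x * \<phi> x) - (LINT x|M. v x * \<phi> x) = (LINT x|M. (u n x - v x) * \<phi> x)"
      using intu[of n] intv by (simp add: left_diff_distrib)
    then have "ennreal (norm ((LINT x|M. u n x * \<phi> x) - (LINT x|M. v x * \<phi> x)))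
        \<le> (\<integral>\<^sup>+x. ennreal (cmod ((u n x - v x) * \<phi> x)) \<partial>M)"
      using integral_norm_bound_ennreal[OF intd] by simp
    also have "\<dots> \<le> (\<integral>\<^sup>+x. ennreal (K / 2) * ennreal ((cmod (u n x - v x))\<^sup>2)
        + ennreal (1 / (2 * K)) * ennreal ((cmod (\<phi> x))\<^sup>2) \<partial>M)"
    proof (rule nn_integral_mono)
      fix x
      let ?s = "cmod (u n x - v x)" and ?t = "cmod (\<phi> x)"
      have "2 * ((K * ?s) * ?t) \<le> (K * ?s)\<^sup>2 + ?t\<^sup>2" by (rule two_mult_le_squares)
      then have "?s * ?t \<le> K / 2 * ?s\<^sup>2 + 1 / (2 * K) * ?t\<^sup>2"
        using K by (simp add: field_simps power2_eq_square)
      then have "ennreal (?s * ?t) \<le> ennreal (K / 2 * ?s\<^sup>2 + 1 / (2 * K) * ?t\<^sup>2)" by (rule ennreal_leI)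
      also have "\<dots> = ennreal (K / 2) * ennreal (?s\<^sup>2) + ennreal (1 / (2 * K)) * ennreal (?t\<^sup>2)"
      proof -
        have "ennreal (K / 2 * ?s\<^sup>2) = ennreal (K / 2) * ennreal (?s\<^sup>2)"
          by (rule ennreal_mult) (use K in auto)
        moreover have "ennreal (1 / (2 * K) * ?t\<^sup>2) = ennreal (1 / (2 * K)) * ennreal (?t\<^sup>2)"
          by (rule ennreal_mult) (use K in auto)
        moreover have "ennreal (K / 2 * ?s\<^sup>2 + 1 / (2 * K) * ?t\<^sup>2) = ennreal (K / 2 * ?s\<^sup>2) + ennreal (1 / (2 * K) * ?t\<^sup>2)"
          by (rule ennreal_plus) (use K in auto)
        ultimately show ?thesis by (simp only:)
      qed
      finally show "ennreal (cmod ((u n x - v x) * \<phi> x)) \<le> ennreal (K / 2) * ennreal (?s\<^sup>2) + ennreal (1 / (2 * K)) * ennreal (?t\<^sup>2)"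
        by (simp add: norm_mult)
    qed
    also have "\<dots> = ennreal (K / 2) * (\<integral>\<^sup>+x. ennreal ((cmod (u n x - v x))\<^sup>2) \<partial>M)
        + ennreal (1 / (2 * K)) * (\<integral>\<^sup>+x. ennreal ((cmod (\<phi> x))\<^sup>2) \<partial>M)"
      by (simp add: nn_integral_add nn_integral_cmult)
    also have "(\<integral>\<^sup>+x. ennreal ((cmod (\<phi> x))\<^sup>2) \<partial>M) = ennreal b"
      unfolding b_def by (rule nn_integral_eq_integral[OF \<phi>]) simp
    also have "ennreal (K / 2) * (\<integral>\<^sup>+x. ennreal ((cmod (u n x - v x))\<^sup>2) \<partial>M) + ennreal (1 / (2 * K)) * ennreal b
        \<le> ennreal (K / 2) * ennreal (\<epsilon> / K) + ennreal (1 / (2 * K)) * ennreal b"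
      using N[OF n] by (intro add_right_mono mult_left_mono) auto
    also have "\<dots> = ennreal (\<epsilon> / 2 + b / (2 * K))"
      using K b0 \<epsilon> by (simp add: ennreal_mult[symmetric] ennreal_plus[symmetric] del: ennreal_plus)
    finally have *: "ennreal (norm ((LINT x|M. u n x * \<phi> x) - (LINT x|M. v x * \<phi> x))) \<le> ennreal (\<epsilon> / 2 + b / (2 * K))" .
    have "0 \<le> \<epsilon> / 2 + b / (2 * K)" using K b0 \<epsilon> by simp
    from iffD1[OF ennreal_le_iff[OF this] *]
    have "norm ((LINT x|M. u n x * \<phi> x) - (LINT x|M. v x * \<phi> x)) \<le> \<epsilon> / 2 + b / (2 * K)" .
    also have "b / (2 * K) < \<epsilon> / 2"
      using b0 \<epsilon> by (simp add: K_def field_simps)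
    finally show ?thesis by simp
  qed
  then show "\<exists>N. \<forall>n\<ge>N. norm ((LINT x|M. u n x * \<phi> x) - (LINT x|M. v x * \<phi> x)) < \<epsilon>" by blast
qed

lemma fourier_multiplication_formula:
  fixes t \<Phi> :: "real^'d \<Rightarrow> complex"
  assumes t: "integrable lborel t" and \<Phi>: "integrable lborel \<Phi>"
  shows "(LINT \<omega>|lborel. (LINT x|lborel. t x * cnj (chi x \<omega>)) * \<Phi> \<omega>)
    = (LINT x|lborel. t x * (LINT \<omega>|lborel. \<Phi> \<omega> * cnj (chi x \<omega>)))"
proof -
  have [measurable]: "t \<in> borel_measurable borel" "\<Phi> \<in> borel_measurable borel" using t \<Phi> by auto
  have "integrable (lborel \<Otimes>\<^sub>M lborel) (\<lambda>(x, \<omega>). t x * cnj (chi x \<omega>) * \<Phi> \<omega>)"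
  proof (rule lborel_pair.Fubini_integrable)
    show "(\<lambda>(x, \<omega>). t x * cnj (chi x \<omega>) * \<Phi> \<omega>) \<in> borel_measurable (lborel \<Otimes>\<^sub>M lborel)" by measurable
    have "integrable lborel (\<lambda>x. norm (t x) * (LINT \<omega>|lborel. norm (\<Phi> \<omega>)))" using t by simp
    then show "integrable lborel (\<lambda>x. LINT \<omega>|lborel. norm (case (x, \<omega>) of (x, \<omega>) \<Rightarrow> t x * cnj (chi x \<omega>) * \<Phi> \<omega>))"
      by (simp add: norm_mult)
    show "AE x in lborel. integrable lborel (\<lambda>\<omega>. case (x, \<omega>) of (x, \<omega>) \<Rightarrow> t x * cnj (chi x \<omega>) * \<Phi> \<omega>)"
    proof (rule AE_I2)
      fix x
      have "integrable lborel (\<lambda>\<omega>. t x * (cnj (chi x \<omega>) * \<Phi> \<omega>))"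
        by (intro integrable_mult_right Bochner_Integration.integrable_bound[OF \<Phi>]) (auto simp: norm_mult)
      then show "integrable lborel (\<lambda>\<omega>. case (x, \<omega>) of (x, \<omega>) \<Rightarrow> t x * cnj (chi x \<omega>) * \<Phi> \<omega>)"
        by (simp add: mult.assoc)
    qed
  qed
  from lborel_pair.Fubini_integral[OF this]
  have "(LINT \<omega>|lborel. LINT x|lborel. t x * cnj (chi x \<omega>) * \<Phi> \<omega>)
      = (LINT x|lborel. LINT \<omega>|lborel. t x * cnj (chi x \<omega>) * \<Phi> \<omega>)" .
  moreover have "t x * cnj (chi x \<omega>) * \<Phi> \<omega> = t x * (\<Phi> \<omega> * cnj (chi x \<omega>))" for x \<omega>
    by (simp only: mult_ac)
  then have "(LINT x|lborel. LINT \<omega>|lborel. t x * cnj (chi x \<omega>) * \<Phi> \<omega>)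
      = (LINT x|lborel. t x * (LINT \<omega>|lborel. \<Phi> \<omega> * cnj (chi x \<omega>)))"
    by (simp only: integral_mult_right_zero)
  ultimately show ?thesis by (simp only: integral_mult_left_zero)
qed

text \<open>The multiplication formula for each t n against a modulated Gaussian passes to the L^2
  limit on both sides. Then \<tau> tends to infinity: the frequency side converges by dominated
  convergence, the space side by the approximate identity and continuity of f.\<close>

lemma fourier_inversion_continuous:
  fixes f g :: "real^'d \<Rightarrow> complex" and t :: "nat \<Rightarrow> real^'d \<Rightarrow> complex"
  assumes cont: "continuous_on UNIV f" and f2: "integrable lborel (\<lambda>x. (cmod (f x))\<^sup>2)"
    and g: "integrable lborel g" and g2: "integrable lborel (\<lambda>x. (cmod (g x))\<^sup>2)"
    and t: "\<And>n. integrable lborel (t n)"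
    and limf: "(\<lambda>n. \<integral>\<^sup>+x. ennreal ((cmod (t n x - f x))\<^sup>2) \<partial>lborel) \<longlonglongrightarrow> 0"
    and limg: "(\<lambda>n. \<integral>\<^sup>+\<omega>. ennreal ((cmod ((LINT x|lborel. t n x * cnj (chi x \<omega>)) - g \<omega>))\<^sup>2) \<partial>lborel) \<longlonglongrightarrow> 0"
  shows "f a = (LINT \<omega>|lborel. g \<omega> * chi a \<omega>)"
proof -
  have [measurable]: "f \<in> borel_measurable borel" using cont by (rule borel_measurable_continuous_onI)
  have [measurable]: "g \<in> borel_measurable borel" "t n \<in> borel_measurable borel" for n
    using g t[of n] by auto
  let ?F = "\<lambda>n \<omega>. LINT x|lborel. t n x * cnj (chi x \<omega>)"
  have [measurable]: "?F n \<in> borel_measurable borel" for n by measurable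
  have F_bound: "cmod (?F n \<omega>) \<le> (LINT x|lborel. cmod (t n x))" for n \<omega>
    using integral_norm_bound[of lborel "\<lambda>x. t n x * cnj (chi x \<omega>)"] by (simp add: norm_mult)
  have eq: "(LINT \<omega>|lborel. g \<omega> * (of_real (gauss \<tau> \<omega>) * chi a \<omega>)) = (LINT x|lborel. f x * of_real (gauss_kernel \<tau> (x - a)))"
    if \<tau>: "0 < \<tau>" for \<tau>
  proof -
    let ?\<Phi> = "\<lambda>\<omega>. of_real (gauss \<tau> \<omega>) * chi a \<omega>" and ?K = "\<lambda>x. complex_of_real (gauss_kernel \<tau> (x - a))"
    have int\<Phi>: "integrable lborel ?\<Phi>"
      by (rule Bochner_Integration.integrable_bound[OF gauss_integrable[OF \<tau>]]) (auto simp: norm_mult)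
    have sq\<Phi>: "integrable lborel (\<lambda>\<omega>. (cmod (?\<Phi> \<omega>))\<^sup>2)"
    proof (rule Bochner_Integration.integrable_bound[OF gauss_integrable[OF \<tau>]])
      show "AE \<omega> in lborel. norm ((cmod (?\<Phi> \<omega>))\<^sup>2) \<le> norm (gauss \<tau> \<omega>)"
        by (intro AE_I2) (simp add: norm_mult power2_eq_square mult_left_le gauss_bounds)
    qed measurable
    let ?D = "(sqrt (2 * pi) * \<tau>) ^ CARD('d)"
    have K0: "0 \<le> gauss_kernel \<tau> (x - a)" "gauss_kernel \<tau> (x - a) \<le> ?D" for x
      using gauss_kernel_bounds[OF \<tau>] by auto
    have sqK: "integrable lborel (\<lambda>x. (cmod (?K x))\<^sup>2)"
    proof (rule Bochner_Integration.integrable_bound)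
      show "integrable lborel (\<lambda>x. ?D * gauss_kernel \<tau> (x - a))"
        using gauss_kernel_integral(1)[OF \<tau>, of a] by simp
      show "AE x in lborel. norm ((cmod (?K x))\<^sup>2) \<le> norm (?D * gauss_kernel \<tau> (x - a))"
        using K0 \<tau> by (intro AE_I2) (simp add: power2_eq_square mult_right_mono)
    qed measurable
    have "(\<lambda>n. LINT \<omega>|lborel. ?F n \<omega> * ?\<Phi> \<omega>) \<longlonglongrightarrow> (LINT \<omega>|lborel. g \<omega> * ?\<Phi> \<omega>)"
    proof (rule L2_pairing_tendsto[OF _ _ _ limg sq\<Phi>])
      show "integrable lborel (\<lambda>\<omega>. ?F n \<omega> * ?\<Phi> \<omega>)" for n
      proof (rule Bochner_Integration.integrable_bound)
        show "integrable lborel (\<lambda>\<omega>. (LINT x|lborel. cmod (t n x)) * gauss \<tau> \<omega>)"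
          by (intro integrable_mult_right gauss_integrable \<tau>)
        show "AE \<omega> in lborel. norm (?F n \<omega> * ?\<Phi> \<omega>) \<le> norm ((LINT x|lborel. cmod (t n x)) * gauss \<tau> \<omega>)"
          using F_bound[of n] by (intro AE_I2) (simp add: norm_mult abs_mult mult_right_mono gauss_bounds)
      qed measurable
      show "integrable lborel (\<lambda>\<omega>. g \<omega> * ?\<Phi> \<omega>)"
        by (rule integrable_mult_sq_integrable[OF _ _ g2 sq\<Phi>]) measurable
    qed measurable
    moreover have "(\<lambda>n. LINT x|lborel. t n x * ?K x) \<longlonglongrightarrow> (LINT x|lborel. f x * ?K x)"
    proof (rule L2_pairing_tendsto[OF _ _ _ limf sqK])
      show "integrable lborel (\<lambda>x. t n x * ?K x)" for n
      proof (rule Bochner_Integration.integrable_bound)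
        show "integrable lborel (\<lambda>x. ?D * cmod (t n x))" using t[of n] by simp
        show "AE x in lborel. norm (t n x * ?K x) \<le> norm (?D * cmod (t n x))"
          using K0 \<tau> by (intro AE_I2) (auto simp: norm_mult abs_mult mult.commute[of "cmod _"] intro!: mult_right_mono)
      qed measurable
      show "integrable lborel (\<lambda>x. f x * ?K x)"
        by (rule integrable_mult_sq_integrable[OF _ _ f2 sqK]) measurable
    qed measurable
    \<comment> \<open>Modulation by \<open>chi a\<close> centres the transformed Gaussian at
      \<open>a\<close>.\<close>
    moreover have "(LINT \<omega>|lborel. ?F n \<omega> * ?\<Phi> \<omega>) = (LINT x|lborel. t n x * ?K x)" for n
      unfolding fourier_multiplication_formula[OF t int\<Phi>] integral_gauss_chi[OF \<tau>] ..
    ultimately show ?thesis using LIMSEQ_unique by simp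
  qed
  have "(\<lambda>n. LINT \<omega>|lborel. g \<omega> * (of_real (gauss (real (Suc n)) \<omega>) * chi a \<omega>)) \<longlonglongrightarrow> (LINT \<omega>|lborel. g \<omega> * chi a \<omega>)"
  proof (rule integral_dominated_convergence[where w = "\<lambda>\<omega>. cmod (g \<omega>)"])
    show "AE \<omega> in lborel. (\<lambda>n. g \<omega> * (of_real (gauss (real (Suc n)) \<omega>) * chi a \<omega>)) \<longlonglongrightarrow> g \<omega> * chi a \<omega>"
    proof (rule AE_I2)
      fix \<omega> :: "real^'d"
      have "(\<lambda>n. norm \<omega> * inverse (real (Suc n))) \<longlonglongrightarrow> norm \<omega> * 0"
        by (intro tendsto_mult tendsto_const LIMSEQ_inverse_real_of_nat)
      then have "(\<lambda>n. norm \<omega> / real (Suc n)) \<longlonglongrightarrow> 0" by (simp add: divide_inverse)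
      then have "(\<lambda>n. exp (- (norm \<omega> / real (Suc n))\<^sup>2 / 2)) \<longlonglongrightarrow> exp (- 0\<^sup>2 / 2)" by (intro tendsto_intros) auto
      then have "(\<lambda>n. gauss (real (Suc n)) \<omega>) \<longlonglongrightarrow> 1" by (simp add: gauss_def)
      then have "(\<lambda>n. g \<omega> * (of_real (gauss (real (Suc n)) \<omega>) * chi a \<omega>)) \<longlonglongrightarrow> g \<omega> * (of_real 1 * chi a \<omega>)"
        by (intro tendsto_intros)
      then show "(\<lambda>n. g \<omega> * (of_real (gauss (real (Suc n)) \<omega>) * chi a \<omega>)) \<longlonglongrightarrow> g \<omega> * chi a \<omega>" by simp
    qed
    show "AE \<omega> in lborel. norm (g \<omega> * (of_real (gauss (real (Suc n)) \<omega>) * chi a \<omega>)) \<le> cmod (g \<omega>)" for n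
      by (intro AE_I2) (simp add: norm_mult mult_left_le gauss_bounds)
  qed (use g in \<open>auto intro: integrable_norm\<close>)
  moreover have "(\<lambda>n. LINT \<omega>|lborel. g \<omega> * (of_real (gauss (real (Suc n)) \<omega>) * chi a \<omega>)) \<longlonglongrightarrow> f a"
    unfolding eq[OF of_nat_0_less_iff[THEN iffD2, OF zero_less_Suc]] by (rule gauss_kernel_approx[OF cont f2])
  ultimately show ?thesis using LIMSEQ_unique by blast
qed

subsection \<open>Paley-Wiener functions and their samples\<close>

lemma completion_ex_borel_measurable_complex:
  fixes g :: "'a \<Rightarrow> complex"
  assumes "g \<in> borel_measurable (completion M)"
  shows "\<exists>g'\<in>borel_measurable M. AE x in M. g x = g' x"
proof -
  have "(\<lambda>x. Re (g x)) \<in> borel_measurable (completion M)" "(\<lambda>x. Im (g x)) \<in> borel_measurable (completion M)"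
    using assms by (auto intro: borel_measurable_Re borel_measurable_Im)
  from this[THEN completion_ex_borel_measurable_real]
  obtain r i where r: "r \<in> borel_measurable M" "AE x in M. Re (g x) = r x"
    and i: "i \<in> borel_measurable M" "AE x in M. Im (g x) = i x" by blast
  have "(\<lambda>x. complex_of_real (r x) + \<i> * complex_of_real (i x)) \<in> borel_measurable M"
    using r(1) i(1) by measurable
  then show ?thesis
    by (rule bexI[rotated]) (use r(2) i(2) in eventually_elim, simp add: complex_eq_iff)
qed

text \<open>The complement of the support is an uncountable union of open sets; Lindelof reduces it
  to a countable union, for which null sets add up.\<close>

lemma AE_zero_outside_ess_support:
  fixes g :: "real^'d \<Rightarrow> complex"
  shows "AE \<omega> in lebesgue. \<omega> \<notin> ess_support g \<longrightarrow> g \<omega> = 0"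
proof -
  let ?\<U> = "{U. open U \<and> (AE \<omega> in lebesgue. \<omega> \<in> U \<longrightarrow> g \<omega> = 0)}"
  obtain \<V> where \<V>: "\<V> \<subseteq> ?\<U>" "countable \<V>" "\<Union>\<V> = \<Union>?\<U>"
  proof (rule Lindelof[of ?\<U>])
    show "open S" if "S \<in> ?\<U>" for S using that by simp
  qed
  have "AE \<omega> in lebesgue. \<forall>U\<in>\<V>. \<omega> \<in> U \<longrightarrow> g \<omega> = 0"
    unfolding AE_ball_countable[OF \<V>(2)] using \<V>(1) by blast
  then show ?thesis
  proof eventually_elim
    case (elim \<omega>)
    show ?case
    proof
      assume "\<omega> \<notin> ess_support g"
      then have "\<omega> \<in> \<Union>\<V>" by (simp only: \<V>(3) ess_support_def Compl_iff not_not)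
      then obtain U where "U \<in> \<V>" "\<omega> \<in> U" by (rule UnionE)
      then show "g \<omega> = 0" using elim by auto
    qed
  qed
qed

lemma nn_integral_lebesgue_cong_borel:
  fixes F G :: "real^'d \<Rightarrow> ennreal"
  assumes "AE x in lborel. F x = G x"
  shows "(\<integral>\<^sup>+x. F x \<partial>lebesgue) = (\<integral>\<^sup>+x. G x \<partial>lborel)"
proof -
  have "(\<integral>\<^sup>+x. F x \<partial>lebesgue) = (\<integral>\<^sup>+x. F x \<partial>lborel)" by (rule nn_integral_completion)
  also have "\<dots> = (\<integral>\<^sup>+x. G x \<partial>lborel)" using assms by (rule nn_integral_cong_AE)
  finally show ?thesis .
qed

text \<open>The L^2 transform is replaced by a Borel version that vanishes at every point outside
  \<Omega>, so that later fibre sums are finite exactly and not only almost everywhere. Compactness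
  makes it integrable, hence the inversion integral is an ordinary one.\<close>

lemma Paley_Wiener_representation:
  fixes f :: "real^'d \<Rightarrow> complex"
  assumes \<Omega>: "compact \<Omega>" and f: "f \<in> Paley_Wiener \<Omega>"
  obtains g where "g \<in> borel_measurable borel" "\<And>\<omega>. \<omega> \<notin> \<Omega> \<Longrightarrow> g \<omega> = 0"
    "integrable lborel g" "integrable lborel (\<lambda>\<omega>. (cmod (g \<omega>))\<^sup>2)"
    "\<And>a. f a = (LINT \<omega>|lborel. g \<omega> * chi a \<omega>)"
proof -
  obtain g0 s where cont: "continuous_on UNIV f" and f2: "square_integrable f" and g0: "square_integrable g0"
    and supp: "ess_support g0 \<subseteq> \<Omega>" and s: "\<And>n. integrable lebesgue (s n)"
    and limf: "L2_tendsto s f" and limg: "L2_tendsto (\<lambda>n. fourier (s n)) g0"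
    using f unfolding Paley_Wiener_def has_L2_fourier_def by blast
  have [measurable]: "f \<in> borel_measurable borel" using cont by (rule borel_measurable_continuous_onI)
  have [measurable]: "\<Omega> \<in> sets borel" using \<Omega> by (simp add: borel_compact)
  obtain g1 where g1[measurable]: "g1 \<in> borel_measurable borel" and eq1: "AE \<omega> in lborel. g0 \<omega> = g1 \<omega>"
    using completion_ex_borel_measurable_complex[of g0 lborel] g0 by (auto simp: square_integrable_def)
  define g where "g \<omega> = indicator \<Omega> \<omega> * g1 \<omega>" for \<omega>
  have [measurable]: "g \<in> borel_measurable borel" unfolding g_def by measurable
  have "AE \<omega> in lebesgue. \<omega> \<notin> \<Omega> \<longrightarrow> g0 \<omega> = 0"
    using AE_zero_outside_ess_support[of g0] by eventually_elim (use supp in auto)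
  then have "AE \<omega> in lborel. \<omega> \<notin> \<Omega> \<longrightarrow> g0 \<omega> = 0" by (simp add: AE_completion_iff)
  then have eq: "AE \<omega> in lborel. g0 \<omega> = g \<omega>"
    using eq1 by eventually_elim (auto simp: g_def indicator_def)
  have fin: "(\<integral>\<^sup>+\<omega>. ennreal ((cmod (g0 \<omega>))\<^sup>2) \<partial>lebesgue) < \<infinity>"
    using g0 by (simp add: square_integrable_def integrable_iff_bounded)
  have g2: "integrable lborel (\<lambda>\<omega>. (cmod (g \<omega>))\<^sup>2)"
  proof (rule integrableI_bounded)
    have "(\<integral>\<^sup>+\<omega>. ennreal ((cmod (g0 \<omega>))\<^sup>2) \<partial>lebesgue) = (\<integral>\<^sup>+\<omega>. ennreal ((cmod (g \<omega>))\<^sup>2) \<partial>lborel)"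
      by (rule nn_integral_lebesgue_cong_borel) (use eq in eventually_elim, simp)
    then show "(\<integral>\<^sup>+\<omega>. ennreal (norm ((cmod (g \<omega>))\<^sup>2)) \<partial>lborel) < \<infinity>" using fin by simp
  qed measurable
  have g: "integrable lborel g"
  proof -
    have "integrable lborel (indicator \<Omega> :: real^'d \<Rightarrow> real)"
      using emeasure_bounded_finite[OF compact_imp_bounded[OF \<Omega>]] by (intro integrable_real_indicator) auto
    also have "(indicator \<Omega> :: real^'d \<Rightarrow> real) = (\<lambda>\<omega>. (cmod (indicator \<Omega> \<omega>))\<^sup>2)"
      by (auto simp: fun_eq_iff indicator_def)
    finally have "integrable lborel (\<lambda>\<omega>. (cmod (indicator \<Omega> \<omega>))\<^sup>2)" .
    from integrable_mult_sq_integrable[OF _ _ this g2]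
    have "integrable lborel (\<lambda>\<omega>. indicator \<Omega> \<omega> * g \<omega>)" by simp
    also have "(\<lambda>\<omega>. indicator \<Omega> \<omega> * g \<omega>) = g" by (auto simp: g_def indicator_def)
    finally show ?thesis .
  qed
  \<comment> \<open>The approximating sequence is also replaced by Borel versions, which leaves its
    pointwise Fourier transforms unchanged.\<close>
  have "\<forall>n. \<exists>t\<in>borel_measurable lborel. AE x in lborel. s n x = t x"
    using s by (intro allI completion_ex_borel_measurable_complex) (auto dest: borel_measurable_integrable)
  then obtain t where t: "\<And>n. t n \<in> borel_measurable lborel" "\<And>n. AE x in lborel. s n x = t n x" by metis
  have [measurable]: "t n \<in> borel_measurable borel" for n using t(1)[of n] by simp
  have intt: "integrable lborel (t n)" for n
  proof -
    have "AE x in lebesgue. s n x = t n x" using t(2)[of n] by (rule AE_completion)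
    then have "integrable lebesgue (t n)"
      using s[of n] borel_measurable_integrable[OF s[of n]]
      by (subst (asm) integrable_cong_AE) (auto intro: measurable_completion)
    then show ?thesis by (simp add: integrable_completion)
  qed
  have fou: "fourier (s n) \<omega> = (LINT x|lborel. t n x * cnj (chi x \<omega>))" for n \<omega>
  proof -
    have "fourier (s n) \<omega> = (LINT x|lebesgue. t n x * cnj (chi x \<omega>))"
      unfolding fourier_eq
    proof (rule integral_cong_AE)
      show "AE x in lebesgue. s n x * cnj (chi x \<omega>) = t n x * cnj (chi x \<omega>)"
        using AE_completion[OF t(2)[of n]] by eventually_elim simp
      have [measurable]: "s n \<in> borel_measurable lebesgue" using s[of n] by auto
      have [measurable]: "(\<lambda>x. cnj (chi x \<omega>)) \<in> borel_measurable lebesgue"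
        by (rule measurable_completion) measurable
      show "(\<lambda>x. s n x * cnj (chi x \<omega>)) \<in> borel_measurable lebesgue" by measurable
      show "(\<lambda>x. t n x * cnj (chi x \<omega>)) \<in> borel_measurable lebesgue" by (rule measurable_completion) measurable
    qed
    also have "\<dots> = (LINT x|lborel. t n x * cnj (chi x \<omega>))"
      by (rule integral_completion) measurable
    finally show ?thesis .
  qed
  have "f a = (LINT \<omega>|lborel. g \<omega> * chi a \<omega>)" for a
  proof (rule fourier_inversion_continuous[OF cont _ g g2 intt])
    have "integrable lebesgue (\<lambda>x. (cmod (f x))\<^sup>2)" using f2 by (simp add: square_integrable_def)
    then show "integrable lborel (\<lambda>x. (cmod (f x))\<^sup>2)" by (subst (asm) integrable_completion) measurable
    have "(\<integral>\<^sup>+x. ennreal ((cmod (s n x - f x))\<^sup>2) \<partial>lebesgue) = (\<integral>\<^sup>+x. ennreal ((cmod (t n x - f x))\<^sup>2) \<partial>lborel)" for n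
      by (rule nn_integral_lebesgue_cong_borel) (use t(2)[of n] in eventually_elim, simp)
    then show "(\<lambda>n. \<integral>\<^sup>+x. ennreal ((cmod (t n x - f x))\<^sup>2) \<partial>lborel) \<longlonglongrightarrow> 0"
      using limf by (simp add: L2_tendsto_def)
    have "(\<integral>\<^sup>+\<omega>. ennreal ((cmod (fourier (s n) \<omega> - g0 \<omega>))\<^sup>2) \<partial>lebesgue)
        = (\<integral>\<^sup>+\<omega>. ennreal ((cmod ((LINT x|lborel. t n x * cnj (chi x \<omega>)) - g \<omega>))\<^sup>2) \<partial>lborel)" for n
      by (rule nn_integral_lebesgue_cong_borel) (use eq in eventually_elim, simp add: fou)
    then show "(\<lambda>n. \<integral>\<^sup>+\<omega>. ennreal ((cmod ((LINT x|lborel. t n x * cnj (chi x \<omega>)) - g \<omega>))\<^sup>2) \<partial>lborel) \<longlonglongrightarrow> 0"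
      using limg by (simp add: L2_tendsto_def)
  qed
  then show ?thesis using g g2 by (intro that[of g]) (auto simp: g_def)
qed

text \<open>The shifts that can carry a point of the cube into \<Omega>. There are finitely many for
  compact \<Omega>, so periodization becomes a finite sum with a fixed index set.\<close>

definition active_shifts :: "(real^'d) set \<Rightarrow> (real^'d) set" where
  "active_shifts \<Omega> = {j \<in> int_lattice. \<exists>\<omega>\<in>unit_cube. \<omega> + j \<in> \<Omega>}"

lemma active_shifts_subset: "active_shifts \<Omega> \<subseteq> int_lattice"
  by (auto simp: active_shifts_def)

lemma finite_bounded_int_lattice:
  fixes S :: "(real^'d) set"
  assumes "bounded S" "S \<subseteq> int_lattice"
  shows "finite S"
proof -
  obtain b where b: "\<And>x. x \<in> S \<Longrightarrow> norm x \<le> b" using assms(1) by (auto simp: bounded_iff)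
  have "S \<subseteq> (\<lambda>k. \<chi> i. real_of_int (k i)) ` (UNIV \<rightarrow>\<^sub>E {- \<lceil>b\<rceil>..\<lceil>b\<rceil>})"
  proof
    fix x assume x: "x \<in> S"
    have "x $ i \<in> \<int>" for i using x assms(2) by (auto simp: int_lattice_def)
    then have fl: "real_of_int \<lfloor>x $ i\<rfloor> = x $ i" for i by simp
    have "\<lfloor>x $ i\<rfloor> \<in> {- \<lceil>b\<rceil>..\<lceil>b\<rceil>}" for i
    proof -
      have "\<bar>x $ i\<bar> \<le> b" using component_le_norm_cart[of x i] b[OF x] by linarith
      then show ?thesis using fl[of i] by simp linarith
    qed
    then show "x \<in> (\<lambda>k. \<chi> i. real_of_int (k i)) ` (UNIV \<rightarrow>\<^sub>E {- \<lceil>b\<rceil>..\<lceil>b\<rceil>})"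
      by (intro image_eqI[of _ _ "\<lambda>i. \<lfloor>x $ i\<rfloor>"]) (auto simp: vec_eq_iff fl)
  qed
  moreover have "finite ((UNIV :: 'd set) \<rightarrow>\<^sub>E {- \<lceil>b\<rceil>..\<lceil>b\<rceil>})" by (rule finite_PiE) auto
  ultimately show ?thesis by (meson finite_imageI finite_subset)
qed

lemma finite_active_shifts:
  fixes \<Omega> :: "(real^'d) set"
  assumes "compact \<Omega>"
  shows "finite (active_shifts \<Omega>)"
proof (rule finite_bounded_int_lattice)
  have "active_shifts \<Omega> \<subseteq> (\<lambda>p. fst p - snd p) ` (\<Omega> \<times> unit_cube)"
    by (force simp: active_shifts_def)
  moreover have "bounded ((\<lambda>p. fst p - snd p) ` (\<Omega> \<times> unit_cube))"
    by (intro compact_imp_bounded compact_continuous_image compact_Times assms continuous_intros)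
       (simp add: unit_cube_def)
  ultimately show "bounded (active_shifts \<Omega>)" by (rule bounded_subset[rotated])
qed (rule active_shifts_subset)

lemma AE_active_shifts_partition:
  fixes \<Omega> :: "(real^'d) set"
  assumes "compact \<Omega>"
  shows "AE \<omega> in lborel. \<omega> \<in> \<Omega> \<longrightarrow> (\<Sum>j\<in>active_shifts \<Omega>. indicator unit_cube (\<omega> - j)) = (1 :: real)"
  using AE_lattice_translate_unique
proof eventually_elim
  case (elim \<omega>)
  then obtain l where l: "l \<in> int_lattice" "\<And>k. k \<in> int_lattice \<Longrightarrow> \<omega> - k \<in> unit_cube \<longleftrightarrow> k = l" by blast
  show ?case
  proof
    assume "\<omega> \<in> \<Omega>"
    then have lJ: "l \<in> active_shifts \<Omega>"
      using l(1) l(2)[of l] by (auto simp: active_shifts_def intro!: bexI[of _ "\<omega> - l"])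
    have "(\<Sum>j\<in>active_shifts \<Omega>. indicator unit_cube (\<omega> - j)) = (\<Sum>j\<in>{l}. indicator unit_cube (\<omega> - j) :: real)"
    proof (rule sum.mono_neutral_right)
      show "\<forall>j\<in>active_shifts \<Omega> - {l}. indicator unit_cube (\<omega> - j) = (0::real)"
        using l(2) active_shifts_subset[of \<Omega>] by (auto simp: indicator_def)
    qed (use finite_active_shifts[OF assms] lJ in auto)
    then show "(\<Sum>j\<in>active_shifts \<Omega>. indicator unit_cube (\<omega> - j)) = (1 :: real)"
      using l(1) l(2)[of l] by simp
  qed
qed

text \<open>The indicators of the translated cubes form a partition of unity on \<Omega> almost
  everywhere; each piece of F is shifted back to the cube.\<close>

lemma integral_periodize:
  fixes F :: "real^'d \<Rightarrow> complex"
  assumes \<Omega>: "compact \<Omega>" and F: "integrable lborel F" and F0: "\<And>\<omega>. \<omega> \<notin> \<Omega> \<Longrightarrow> F \<omega> = 0"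
  shows "(LINT \<omega>|lborel. F \<omega>) = (LINT \<omega>|cube_measure. (\<Sum>j\<in>active_shifts \<Omega>. F (\<omega> + j)))"
proof -
  have [measurable]: "F \<in> borel_measurable borel" using F by auto
  have shift: "(LINT \<omega>|lborel. G (\<omega> + j)) = (LINT \<omega>|lborel. G \<omega>)" "integrable lborel (\<lambda>\<omega>. G (\<omega> + j)) \<longleftrightarrow> integrable lborel G"
    if [measurable]: "G \<in> borel_measurable borel" for G :: "real^'d \<Rightarrow> complex" and j
  proof -
    have "lborel = distr lborel borel ((+) j)" by (rule lborel_distr_plus[symmetric])
    then show "(LINT \<omega>|lborel. G (\<omega> + j)) = (LINT \<omega>|lborel. G \<omega>)" "integrable lborel (\<lambda>\<omega>. G (\<omega> + j)) \<longleftrightarrow> integrable lborel G"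
      using integral_distr[of "(+) j" lborel borel G] integrable_distr_eq[of "(+) j" lborel borel G]
      by (simp_all add: add.commute)
  qed
  have int1: "integrable lborel (\<lambda>\<omega>. indicator unit_cube (\<omega> - j) *\<^sub>R F \<omega>)" for j
    by (rule Bochner_Integration.integrable_bound[OF F]) (auto simp: indicator_def)
  have "(LINT \<omega>|cube_measure. (\<Sum>j\<in>active_shifts \<Omega>. F (\<omega> + j)))
      = (LINT \<omega>|lborel. (\<Sum>j\<in>active_shifts \<Omega>. indicator unit_cube \<omega> *\<^sub>R F (\<omega> + j)))"
    by (subst integral_cube_measure) (auto simp: scaleR_sum_right)
  also have "\<dots> = (\<Sum>j\<in>active_shifts \<Omega>. LINT \<omega>|lborel. indicator unit_cube \<omega> *\<^sub>R F (\<omega> + j))"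
  proof (rule Bochner_Integration.integral_sum)
    fix j
    show "integrable lborel (\<lambda>\<omega>. indicator unit_cube \<omega> *\<^sub>R F (\<omega> + j))"
      using shift(2)[of "\<lambda>\<omega>. indicator unit_cube (\<omega> - j) *\<^sub>R F \<omega>" j] int1[of j] by simp
  qed
  also have "\<dots> = (\<Sum>j\<in>active_shifts \<Omega>. LINT \<omega>|lborel. indicator unit_cube (\<omega> - j) *\<^sub>R F \<omega>)"
  proof (rule sum.cong[OF refl])
    fix j
    show "(LINT \<omega>|lborel. indicator unit_cube \<omega> *\<^sub>R F (\<omega> + j)) = (LINT \<omega>|lborel. indicator unit_cube (\<omega> - j) *\<^sub>R F \<omega>)"
      using shift(1)[of "\<lambda>\<omega>. indicator unit_cube (\<omega> - j) *\<^sub>R F \<omega>" j] by simp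
  qed
  also have "\<dots> = (LINT \<omega>|lborel. (\<Sum>j\<in>active_shifts \<Omega>. indicator unit_cube (\<omega> - j) *\<^sub>R F \<omega>))"
    by (rule Bochner_Integration.integral_sum[symmetric]) (rule int1)
  also have "\<dots> = (LINT \<omega>|lborel. F \<omega>)"
  proof (rule integral_cong_AE)
    show "AE \<omega> in lborel. (\<Sum>j\<in>active_shifts \<Omega>. indicator unit_cube (\<omega> - j) *\<^sub>R F \<omega>) = F \<omega>"
      using AE_active_shifts_partition[OF \<Omega>]
      by eventually_elim (use F0 in \<open>fastforce simp flip: scaleR_sum_left\<close>)
  qed measurable
  finally show ?thesis by simp
qed

text \<open>The periodization of g times \<open>chi x\<close>, up to the unimodular factor
  \<open>chi x \<omega>\<close>; at fixed \<omega> it is a trigonometric polynomial in x.\<close>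

definition fiber_sum :: "(real^'d) set \<Rightarrow> (real^'d \<Rightarrow> complex) \<Rightarrow> real^'d \<Rightarrow> real^'d \<Rightarrow> complex" where
  "fiber_sum \<Omega> g x \<omega> = (\<Sum>j\<in>active_shifts \<Omega>. g (\<omega> + j) * chi j x)"

lemma fiber_sum_sq_le:
  assumes "compact \<Omega>"
  shows "(cmod (fiber_sum \<Omega> g x \<omega>))\<^sup>2 \<le> real (card (active_shifts \<Omega>)) * (\<Sum>j\<in>active_shifts \<Omega>. (cmod (g (\<omega> + j)))\<^sup>2)"
proof -
  have "cmod (fiber_sum \<Omega> g x \<omega>) \<le> (\<Sum>j\<in>active_shifts \<Omega>. cmod (g (\<omega> + j)))"
    unfolding fiber_sum_def by (intro sum_norm_le) (simp add: norm_mult)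
  then have "(cmod (fiber_sum \<Omega> g x \<omega>))\<^sup>2 \<le> (\<Sum>j\<in>active_shifts \<Omega>. 1 * cmod (g (\<omega> + j)))\<^sup>2"
    by (intro power_mono) auto
  also have "\<dots> \<le> (\<Sum>j\<in>active_shifts \<Omega>. 1\<^sup>2) * (\<Sum>j\<in>active_shifts \<Omega>. (cmod (g (\<omega> + j)))\<^sup>2)"
    by (rule Cauchy_Schwarz_ineq_sum)
  finally show ?thesis by simp
qed

lemma nn_integral_fiber_sq_finite:
  fixes \<Omega> :: "(real^'d) set"
  assumes [measurable]: "g \<in> borel_measurable borel" and g2: "integrable lborel (\<lambda>\<omega>. (cmod (g \<omega>))\<^sup>2)"
  shows "(\<integral>\<^sup>+\<omega>. ennreal (\<Sum>j\<in>active_shifts \<Omega>. (cmod (g (\<omega> + j)))\<^sup>2) \<partial>cube_measure) < \<infinity>"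
proof -
  have fin: "(\<integral>\<^sup>+\<omega>. ennreal ((cmod (g \<omega>))\<^sup>2) \<partial>lborel) < \<infinity>"
    using g2 by (simp add: integrable_iff_bounded)
  have le: "(\<integral>\<^sup>+\<omega>. ennreal ((cmod (g (\<omega> + j)))\<^sup>2) \<partial>cube_measure) < \<infinity>" for j
  proof -
    have "(\<integral>\<^sup>+\<omega>. ennreal ((cmod (g (\<omega> + j)))\<^sup>2) \<partial>cube_measure) \<le> (\<integral>\<^sup>+\<omega>. ennreal ((cmod (g (\<omega> + j)))\<^sup>2) \<partial>lborel)"
      by (subst nn_integral_cube_measure) (auto intro!: nn_integral_mono simp: indicator_def)
    also have "\<dots> = (\<integral>\<^sup>+\<omega>. ennreal ((cmod (g \<omega>))\<^sup>2) \<partial>lborel)"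
      by (rule nn_integral_lborel_translate) measurable
    finally show ?thesis using fin by (rule le_less_trans)
  qed
  have "(\<integral>\<^sup>+\<omega>. ennreal (\<Sum>j\<in>active_shifts \<Omega>. (cmod (g (\<omega> + j)))\<^sup>2) \<partial>cube_measure)
      = (\<Sum>j\<in>active_shifts \<Omega>. \<integral>\<^sup>+\<omega>. ennreal ((cmod (g (\<omega> + j)))\<^sup>2) \<partial>cube_measure)"
    by (simp flip: sum_ennreal add: nn_integral_sum)
  also have "\<dots> < \<infinity>" using le by (cases "finite (active_shifts \<Omega>)") (auto simp: ennreal_sum_less_top)
  finally show ?thesis .
qed

lemma fiber_sum_sq_finite:
  fixes \<Omega> :: "(real^'d) set"
  assumes \<Omega>: "compact \<Omega>" and [measurable]: "g \<in> borel_measurable borel"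
    and g2: "integrable lborel (\<lambda>\<omega>. (cmod (g \<omega>))\<^sup>2)"
  shows "(\<integral>\<^sup>+\<omega>. ennreal ((cmod (fiber_sum \<Omega> g x \<omega>))\<^sup>2) \<partial>cube_measure) < \<infinity>"
proof -
  have "(\<integral>\<^sup>+\<omega>. ennreal ((cmod (fiber_sum \<Omega> g x \<omega>))\<^sup>2) \<partial>cube_measure)
      \<le> (\<integral>\<^sup>+\<omega>. ennreal (real (card (active_shifts \<Omega>))) * ennreal (\<Sum>j\<in>active_shifts \<Omega>. (cmod (g (\<omega> + j)))\<^sup>2) \<partial>cube_measure)"
    by (intro nn_integral_mono) (simp add: ennreal_mult[symmetric] sum_nonneg ennreal_leI fiber_sum_sq_le[OF \<Omega>])
  also have "\<dots> = ennreal (real (card (active_shifts \<Omega>))) * (\<integral>\<^sup>+\<omega>. ennreal (\<Sum>j\<in>active_shifts \<Omega>. (cmod (g (\<omega> + j)))\<^sup>2) \<partial>cube_measure)"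
    by (rule nn_integral_cmult) measurable
  also have "\<dots> < \<infinity>" using nn_integral_fiber_sq_finite[OF assms(2) g2, of \<Omega>] by (simp add: ennreal_mult_less_top)
  finally show ?thesis .
qed

text \<open>Since \<open>chi l j = 1\<close> on the lattice, f (x + l) is a Fourier coefficient of
  the single function \<open>?h\<close> on the cube, for all l simultaneously. Parseval then sums
  them.\<close>

lemma sample_sum_eq:
  fixes f g :: "real^'d \<Rightarrow> complex"
  assumes \<Omega>: "compact \<Omega>" and g[measurable]: "g \<in> borel_measurable borel" and g0: "\<And>\<omega>. \<omega> \<notin> \<Omega> \<Longrightarrow> g \<omega> = 0"
    and g1: "integrable lborel g" and g2: "integrable lborel (\<lambda>\<omega>. (cmod (g \<omega>))\<^sup>2)"
    and f: "\<And>a. f a = (LINT \<omega>|lborel. g \<omega> * chi a \<omega>)"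
  shows "(\<Sum>\<^sub>\<infinity>l\<in>int_lattice. ennreal ((cmod (f (x + l)))\<^sup>2))
    = (\<integral>\<^sup>+\<omega>. ennreal ((cmod (fiber_sum \<Omega> g x \<omega>))\<^sup>2) \<partial>cube_measure)"
proof -
  let ?h = "\<lambda>\<omega>. chi x \<omega> * fiber_sum \<Omega> g x \<omega>"
  have h: "cmod (?h \<omega>) = cmod (fiber_sum \<Omega> g x \<omega>)" for \<omega> by (simp add: norm_mult)
  have [measurable]: "?h \<in> borel_measurable borel" unfolding fiber_sum_def by measurable
  have fx: "f (x + l) = (LINT \<omega>|cube_measure. ?h \<omega> * chi l \<omega>)" if l: "l \<in> int_lattice" for l
  proof -
    have int: "integrable lborel (\<lambda>\<omega>. g \<omega> * chi (x + l) \<omega>)"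
      by (rule Bochner_Integration.integrable_bound[OF g1]) (auto simp: norm_mult)
    have "f (x + l) = (LINT \<omega>|cube_measure. (\<Sum>j\<in>active_shifts \<Omega>. g (\<omega> + j) * chi (x + l) (\<omega> + j)))"
      unfolding f by (rule integral_periodize[OF \<Omega> int]) (simp add: g0)
    also have "(\<lambda>\<omega>. \<Sum>j\<in>active_shifts \<Omega>. g (\<omega> + j) * chi (x + l) (\<omega> + j)) = (\<lambda>\<omega>. ?h \<omega> * chi l \<omega>)"
    proof
      fix \<omega>
      have "g (\<omega> + j) * chi (x + l) (\<omega> + j) = chi x \<omega> * (g (\<omega> + j) * chi j x) * chi l \<omega>" if j: "j \<in> active_shifts \<Omega>" for j
      proof -
        have "chi l j = 1" using l j active_shifts_subset by (intro chi_lattice) auto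
        then show ?thesis by (simp add: chi_add_left chi_add_right chi_commute[of x j])
      qed
      then show "(\<Sum>j\<in>active_shifts \<Omega>. g (\<omega> + j) * chi (x + l) (\<omega> + j)) = ?h \<omega> * chi l \<omega>"
        unfolding fiber_sum_def sum_distrib_left sum_distrib_right by (rule sum.cong[OF refl])
    qed
    finally show ?thesis .
  qed
  have "(\<Sum>\<^sub>\<infinity>l\<in>int_lattice. ennreal ((cmod (f (x + l)))\<^sup>2))
      = (\<Sum>\<^sub>\<infinity>l\<in>int_lattice. ennreal ((cmod (LINT \<omega>|cube_measure. ?h \<omega> * chi l \<omega>))\<^sup>2))"
    by (rule infsum_cong) (simp add: fx)
  also have "\<dots> = (\<integral>\<^sup>+\<omega>. ennreal ((cmod (?h \<omega>))\<^sup>2) \<partial>cube_measure)"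
    by (rule parseval_cube) (use fiber_sum_sq_finite[OF \<Omega> g g2] in \<open>simp_all add: h\<close>)
  finally show ?thesis by (simp only: h)
qed

lemma nn_integral_trig_sum_sq:
  fixes L :: "(real^'d) set"
  assumes "finite L" "L \<subseteq> int_lattice"
  shows "(\<integral>\<^sup>+x. ennreal ((cmod (\<Sum>j\<in>L. a j * chi j x))\<^sup>2) \<partial>cube_measure) = ennreal (\<Sum>j\<in>L. (cmod (a j))\<^sup>2)"
  using sqdist_trig_sum(2)[of "\<lambda>_. 0" L "\<lambda>_. 0" a] assms by (simp add: sqdist_def)

text \<open>Plancherel obtained from the sampling identity: the norm of f is the average of the
  sample sums over the cube, and after exchanging integrals the x-integral is Parseval for a finite
  trigonometric sum.\<close>

lemma Paley_Wiener_norm_eq: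
  fixes f g :: "real^'d \<Rightarrow> complex"
  assumes \<Omega>: "compact \<Omega>" and g[measurable]: "g \<in> borel_measurable borel" and g0: "\<And>\<omega>. \<omega> \<notin> \<Omega> \<Longrightarrow> g \<omega> = 0"
    and g1: "integrable lborel g" and g2: "integrable lborel (\<lambda>\<omega>. (cmod (g \<omega>))\<^sup>2)"
    and f: "\<And>a. f a = (LINT \<omega>|lborel. g \<omega> * chi a \<omega>)" and pw: "f \<in> Paley_Wiener \<Omega>"
  shows "ennreal ((L2_norm f)\<^sup>2) = (\<integral>\<^sup>+\<omega>. ennreal (\<Sum>j\<in>active_shifts \<Omega>. (cmod (g (\<omega> + j)))\<^sup>2) \<partial>cube_measure)"
proof -
  let ?U = "cube_measure :: (real^'d) measure"
  interpret U: prob_space ?U by (rule prob_space_cube_measure)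
  interpret UU: pair_sigma_finite ?U ?U ..
  have sq: "integrable lebesgue (\<lambda>x. (cmod (f x))\<^sup>2)" and cont: "continuous_on UNIV f"
    using pw by (auto simp: Paley_Wiener_def square_integrable_def)
  have [measurable]: "f \<in> borel_measurable borel" using cont by (rule borel_measurable_continuous_onI)
  have "(L2_norm f)\<^sup>2 = (LINT x|lebesgue. (cmod (f x))\<^sup>2)" by (simp add: L2_norm_def)
  then have "ennreal ((L2_norm f)\<^sup>2) = (\<integral>\<^sup>+x. ennreal ((cmod (f x))\<^sup>2) \<partial>lebesgue)"
    using nn_integral_eq_integral[OF sq] by simp
  also have "\<dots> = (\<integral>\<^sup>+x. ennreal ((cmod (f x))\<^sup>2) \<partial>lborel)" by (rule nn_integral_completion)
  also have "\<dots> = (\<integral>\<^sup>+x. (\<Sum>\<^sub>\<infinity>l\<in>int_lattice. ennreal ((cmod (f (x + l)))\<^sup>2)) \<partial>?U)"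
    by (rule nn_integral_lattice_tiling) measurable
  also have "\<dots> = (\<integral>\<^sup>+x. \<integral>\<^sup>+\<omega>. ennreal ((cmod (fiber_sum \<Omega> g x \<omega>))\<^sup>2) \<partial>?U \<partial>?U)"
    by (rule nn_integral_cong) (rule sample_sum_eq[of \<Omega> g f, OF \<Omega> g g0 g1 g2 f])
  also have "\<dots> = (\<integral>\<^sup>+\<omega>. \<integral>\<^sup>+x. ennreal ((cmod (fiber_sum \<Omega> g x \<omega>))\<^sup>2) \<partial>?U \<partial>?U)"
    unfolding fiber_sum_def by (rule UU.Fubini'[symmetric]) measurable
  also have "\<dots> = (\<integral>\<^sup>+\<omega>. ennreal (\<Sum>j\<in>active_shifts \<Omega>. (cmod (g (\<omega> + j)))\<^sup>2) \<partial>?U)"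
    unfolding fiber_sum_def
    by (simp only: nn_integral_trig_sum_sq[OF finite_active_shifts[OF \<Omega>] active_shifts_subset])
  finally show ?thesis .
qed

subsection \<open>Tiling decompositions\<close>

text \<open>One piece for each subset of the active shifts, consisting of the points whose fibre is
  that subset. This guarantees that the minimum defining \<open>tiling_complexity\<close> is
  attained.\<close>

lemma tiling_decomposition_exists:
  fixes \<Omega> :: "(real^'d) set"
  assumes "compact \<Omega>"
  shows "\<exists>N\<ge>1. tiling_decomposition \<Omega> N"
proof -
  let ?J = "active_shifts \<Omega>"
  have fin: "finite (Pow ?J)" using finite_active_shifts[OF assms] by simp
  obtain h where h: "bij_betw h {1..card (Pow ?J)} (Pow ?J)"
    using ex_bij_betw_nat_finite_1[OF fin] by blast
  have [measurable]: "\<Omega> \<in> sets borel" using assms by (simp add: borel_compact)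
  define Q where "Q n = {\<omega> \<in> unit_cube. \<forall>j\<in>?J. \<omega> + j \<in> \<Omega> \<longleftrightarrow> j \<in> h n}" for n
  have hJ: "h n \<subseteq> ?J" if "n \<in> {1..card (Pow ?J)}" for n
    using bspec[OF bij_betwE[OF h] that] by simp
  have "disjoint_family_on Q {1..card (Pow ?J)}"
    unfolding disjoint_family_on_def
  proof (intro ballI impI)
    fix m n assume mn: "m \<in> {1..card (Pow ?J)}" "n \<in> {1..card (Pow ?J)}" "m \<noteq> n"
    have ne: "h m \<noteq> h n"
      using inj_on_eq_iff[OF bij_betw_imp_inj_on[OF h] mn(1,2)] mn(3) by simp
    show "Q m \<inter> Q n = {}"
    proof (rule ccontr)
      assume "Q m \<inter> Q n \<noteq> {}"
      then obtain \<omega> where "\<omega> \<in> Q m" "\<omega> \<in> Q n" by blast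
      then have "j \<in> h m \<longleftrightarrow> j \<in> h n" if "j \<in> ?J" for j using that by (simp add: Q_def)
      then have "h m = h n" using hJ[OF mn(1)] hJ[OF mn(2)] by (intro set_eqI) (meson subsetD)
      then show False using ne by simp
    qed
  qed
  moreover have "Q n \<in> sets lebesgue" for n
  proof -
    have [measurable]: "Measurable.pred borel (\<lambda>\<omega>. \<omega> + j \<in> \<Omega>)" for j :: "real^'d" by measurable
    have "{\<omega> \<in> space borel. \<omega> \<in> unit_cube \<and> (\<forall>j\<in>?J. \<omega> + j \<in> \<Omega> \<longleftrightarrow> j \<in> h n)} \<in> sets borel"
      using finite_active_shifts[OF assms] by measurable
    then show ?thesis by (simp add: Q_def sets_completionI_sets)
  qed
  moreover have "(\<Union>n\<in>{1..card (Pow ?J)}. {q + b | q b. q \<in> Q n \<and> b \<in> h n}) = \<Omega>"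
  proof (intro equalityI subsetI)
    fix x assume "x \<in> (\<Union>n\<in>{1..card (Pow ?J)}. {q + b | q b. q \<in> Q n \<and> b \<in> h n})"
    then obtain n q b where n: "n \<in> {1..card (Pow ?J)}" and x: "x = q + b" and q: "q \<in> Q n" and b: "b \<in> h n"
      by blast
    have "b \<in> ?J" using hJ[OF n] b by (rule subsetD)
    then show "x \<in> \<Omega>" using q b by (simp add: Q_def x)
  next
    fix x assume x: "x \<in> \<Omega>"
    obtain l where l: "l \<in> int_lattice" "x - l \<in> unit_cube" by (rule lattice_translate_exists)
    have "{j \<in> ?J. x - l + j \<in> \<Omega>} \<in> Pow ?J" by auto
    then have "{j \<in> ?J. x - l + j \<in> \<Omega>} \<in> h ` {1..card (Pow ?J)}" unfolding bij_betw_imp_surj_on[OF h] .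
    then obtain n where n: "n \<in> {1..card (Pow ?J)}" "h n = {j \<in> ?J. x - l + j \<in> \<Omega>}" by (auto simp del: card_Pow)
    have "l \<in> ?J" using l x by (auto simp: active_shifts_def intro!: bexI[of _ "x - l"])
    then have "x - l \<in> Q n" "l \<in> h n" using l x by (auto simp: Q_def n(2))
    then have "x \<in> {q + b | q b. q \<in> Q n \<and> b \<in> h n}" by (intro CollectI exI[of _ "x - l"] exI[of _ l]) simp
    then show "x \<in> (\<Union>n\<in>{1..card (Pow ?J)}. {q + b | q b. q \<in> Q n \<and> b \<in> h n})" using n(1) by blast
  qed
  moreover have "Q n \<subseteq> unit_cube" for n by (auto simp: Q_def)
  moreover have "h n \<subseteq> int_lattice" if "n \<in> {1..card (Pow ?J)}" for n
    using hJ[OF that] active_shifts_subset by blast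
  ultimately have "tiling_decomposition \<Omega> (card (Pow ?J))"
    unfolding tiling_decomposition_def by (intro exI[of _ Q] exI[of _ h]) simp
  moreover have "1 \<le> card (Pow ?J)" using fin by (simp add: Suc_le_eq card_gt_0_iff Pow_not_empty)
  ultimately show ?thesis by blast
qed

lemma tiling_complexity_attained:
  assumes "compact \<Omega>"
  shows "1 \<le> tiling_complexity \<Omega>" "tiling_decomposition \<Omega> (tiling_complexity \<Omega>)"
proof -
  from tiling_decomposition_exists[OF assms] obtain N where "1 \<le> N \<and> tiling_decomposition \<Omega> N" by blast
  from LeastI[of "\<lambda>N. 1 \<le> N \<and> tiling_decomposition \<Omega> N", OF this]
  show "1 \<le> tiling_complexity \<Omega>" "tiling_decomposition \<Omega> (tiling_complexity \<Omega>)"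
    by (simp_all add: tiling_complexity_def)
qed

lemma AE_lborel_translate:
  fixes D :: "(real^'d) set"
  assumes "D \<in> null_sets lebesgue"
  shows "AE \<omega> in lborel. \<omega> + l \<notin> D"
proof -
  have "negligible ((+) (- l) ` D)"
    by (rule negligible_translation) (use assms in \<open>simp add: negligible_iff_null_sets\<close>)
  then have "(+) (- l) ` D \<in> null_sets lebesgue" by (simp add: negligible_iff_null_sets)
  then have "AE \<omega> in lebesgue. \<omega> \<notin> (+) (- l) ` D" by (rule AE_not_in)
  then have "AE \<omega> in lborel. \<omega> \<notin> (+) (- l) ` D" by (simp add: AE_completion_iff)
  then show ?thesis
  proof eventually_elim
    case (elim \<omega>)
    then show ?case by (metis add.commute add_minus_cancel image_eqI minus_add_cancel)
  qed
qed

locale tiling =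
  fixes \<Omega> :: "(real^'d) set" and N :: nat and Q B :: "nat \<Rightarrow> (real^'d) set"
  assumes compact_\<Omega>: "compact \<Omega>"
    and disjoint_Q: "disjoint_family_on Q {1..N}"
    and Q: "\<And>n. n \<in> {1..N} \<Longrightarrow> Q n \<in> sets lebesgue" "\<And>n. n \<in> {1..N} \<Longrightarrow> Q n \<subseteq> unit_cube"
    and B: "\<And>n. n \<in> {1..N} \<Longrightarrow> B n \<subseteq> int_lattice"
    and null_diff: "sym_diff \<Omega> (\<Union>n\<in>{1..N}. {q + b | q b. q \<in> Q n \<and> b \<in> B n}) \<in> null_sets lebesgue"
begin

text \<open>At such points the decomposition describes the fibre of \<Omega> exactly. Null
  differences and coincidences on cube faces can spoil this only on a null set.\<close>

definition regular_point :: "real^'d \<Rightarrow> bool" where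
  "regular_point \<omega> \<longleftrightarrow> (\<forall>l\<in>int_lattice. \<omega> + l \<in> \<Omega> \<longleftrightarrow> (\<exists>n\<in>{1..N}. \<omega> \<in> Q n \<and> l \<in> B n))"

lemma AE_regular_point: "AE \<omega> in lborel. \<omega> \<in> unit_cube \<longrightarrow> regular_point \<omega>"
proof -
  let ?T = "\<Union>n\<in>{1..N}. {q + b | q b. q \<in> Q n \<and> b \<in> B n}"
  have "AE \<omega> in lborel. \<forall>l\<in>int_lattice. \<omega> + l \<notin> sym_diff \<Omega> ?T"
    unfolding AE_ball_countable[OF countable_int_lattice] using AE_lborel_translate[OF null_diff] by blast
  then show ?thesis using AE_not_half_integer
  proof eventually_elim
    case (elim \<omega>)
    show ?case
      unfolding regular_point_def
    proof (intro impI ballI)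
      fix l :: "real^'d" assume \<omega>: "\<omega> \<in> unit_cube" and l: "l \<in> int_lattice"
      have int: "\<omega> \<in> cube_interior"
      proof (rule cube_interior_if_not_boundary[OF \<omega>])
        show "\<omega> $ i \<noteq> - 1 / 2" "\<omega> $ i \<noteq> 1 / 2" for i
          using elim(2)[rule_format, of i "- 1"] elim(2)[rule_format, of i 0] by auto
      qed
      have "\<omega> + l \<in> \<Omega> \<longleftrightarrow> \<omega> + l \<in> ?T" using elim(1) l by blast
      also have "\<dots> \<longleftrightarrow> (\<exists>n\<in>{1..N}. \<omega> \<in> Q n \<and> l \<in> B n)"
      proof
        assume "\<omega> + l \<in> ?T"
        then obtain n q b where n: "n \<in> {1..N}" "\<omega> + l = q + b" "q \<in> Q n" "b \<in> B n" by blast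
        have "\<omega> = q" "l = b"
          using cube_interior_lattice_unique[OF int _ n(2) l] n Q(2)[OF n(1)] B[OF n(1)] by auto
        then show "\<exists>n\<in>{1..N}. \<omega> \<in> Q n \<and> l \<in> B n" using n by blast
      qed blast
      finally show "\<omega> + l \<in> \<Omega> \<longleftrightarrow> (\<exists>n\<in>{1..N}. \<omega> \<in> Q n \<and> l \<in> B n)" .
    qed
  qed
qed

text \<open>Disjointness of the pieces matters here: it prevents a fibre from being a union of
  several shift sets.\<close>

lemma regular_point_fiber:
  assumes "regular_point \<omega>" "n \<in> {1..N}" "\<omega> \<in> Q n"
  shows "{l \<in> int_lattice. \<omega> + l \<in> \<Omega>} = B n"
proof -
  have uniq: "n' = n" if "n' \<in> {1..N}" "\<omega> \<in> Q n'" for n'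
  proof (rule ccontr)
    assume "n' \<noteq> n"
    then have "Q n' \<inter> Q n = {}" using disjoint_Q that(1) assms(2) unfolding disjoint_family_on_def by blast
    then show False using that(2) assms(3) by blast
  qed
  have "(\<exists>n'\<in>{1..N}. \<omega> \<in> Q n' \<and> l \<in> B n') \<longleftrightarrow> l \<in> B n" for l
  proof
    assume "\<exists>n'\<in>{1..N}. \<omega> \<in> Q n' \<and> l \<in> B n'"
    then obtain n' where "n' \<in> {1..N}" "\<omega> \<in> Q n'" "l \<in> B n'" by blast
    then show "l \<in> B n" using uniq[of n'] by simp
  next
    assume "l \<in> B n"
    then show "\<exists>n'\<in>{1..N}. \<omega> \<in> Q n' \<and> l \<in> B n'" using assms(2,3) by (intro bexI[of _ n]) simp_all
  qed
  then have "\<omega> + l \<in> \<Omega> \<longleftrightarrow> l \<in> B n" if "l \<in> int_lattice" for l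
    using assms(1) that unfolding regular_point_def by simp
  then show ?thesis using B[OF assms(2)] by (intro set_eqI) (simp, meson subsetD)
qed

lemma fiber_subset_active: "\<omega> \<in> unit_cube \<Longrightarrow> {l \<in> int_lattice. \<omega> + l \<in> \<Omega>} \<subseteq> active_shifts \<Omega>"
  by (auto simp: active_shifts_def)

text \<open>Over a null piece the shift set is arbitrary, even infinite, so only non-null pieces can
  be bounded by the multiplicity.\<close>

lemma nonnull_piece_card_le:
  assumes n: "n \<in> {1..N}" and nonnull: "Q n \<notin> null_sets lebesgue"
  shows "B n \<subseteq> active_shifts \<Omega>" "finite (B n)" "real (card (B n)) \<le> tiling_multiplicity \<Omega>"
proof -
  let ?R = "restrict_space lebesgue (unit_cube :: (real^'d) set)"
  let ?F = "\<lambda>\<omega>. (\<Sum>\<^sub>\<infinity>l\<in>int_lattice. indicator \<Omega> (\<omega> + l)) :: ennreal"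
  have [measurable]: "\<Omega> \<in> sets borel" using compact_\<Omega> by (simp add: borel_compact)
  have F: "?F \<omega> = of_nat (card {l \<in> int_lattice. \<omega> + l \<in> \<Omega>})" if "\<omega> \<in> unit_cube" for \<omega>
  proof -
    let ?S = "{l \<in> int_lattice. \<omega> + l \<in> \<Omega>}"
    have fin: "finite ?S" using fiber_subset_active[OF that] finite_active_shifts[OF compact_\<Omega>] by (rule finite_subset)
    have "?F \<omega> = (\<Sum>\<^sub>\<infinity>l\<in>?S. 1)"
      by (rule infsum_cong_neutral) (auto simp: indicator_def)
    also have "\<dots> = of_nat (card ?S)" using fin by simp
    finally show ?thesis .
  qed
  have cube: "unit_cube \<inter> space lebesgue \<in> sets (lebesgue :: (real^'d) measure)"
    by (simp add: sets_completionI_sets)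
  have meas: "?F \<in> borel_measurable ?R"
  proof (rule measurable_restrict_space1, rule measurable_completion)
    show "?F \<in> borel_measurable lborel"
      by (rule infsum_ennreal_measurable[OF countable_int_lattice]) measurable
  qed
  \<comment> \<open>Finiteness must be settled first, because \<open>enn2real\<close> would turn an
    infinite essential supremum into 0.\<close>
  have "AE \<omega> in ?R. ?F \<omega> \<le> of_nat (card (active_shifts \<Omega>))"
  proof (rule AE_I2)
    fix \<omega> assume "\<omega> \<in> space ?R"
    then have \<omega>: "\<omega> \<in> unit_cube" by (simp add: space_restrict_space)
    show "?F \<omega> \<le> of_nat (card (active_shifts \<Omega>))"
      unfolding F[OF \<omega>] using card_mono[OF finite_active_shifts[OF compact_\<Omega>] fiber_subset_active[OF \<omega>]]
      by (simp add: of_nat_le_iff)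
  qed
  then have "esssup ?R ?F \<le> of_nat (card (active_shifts \<Omega>))" by (rule esssup_I[OF meas])
  then have "esssup ?R ?F < \<top>" by (rule le_less_trans) (simp add: of_nat_less_top)
  then have k: "ennreal (tiling_multiplicity \<Omega>) = esssup ?R ?F"
    unfolding tiling_multiplicity_def by (simp add: less_top)
  have "AE \<omega> in ?R. ?F \<omega> \<le> ennreal (tiling_multiplicity \<Omega>)" unfolding k by (rule esssup_AE)
  then have "AE \<omega> in lebesgue. \<omega> \<in> unit_cube \<longrightarrow> ?F \<omega> \<le> ennreal (tiling_multiplicity \<Omega>)"
    by (subst (asm) AE_restrict_space_iff[OF cube])
  moreover have "AE \<omega> in lebesgue. \<omega> \<in> unit_cube \<longrightarrow> regular_point \<omega>"
    using AE_regular_point by (rule AE_completion)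
  ultimately have AE: "AE \<omega> in lebesgue. \<omega> \<in> unit_cube \<longrightarrow> ?F \<omega> \<le> ennreal (tiling_multiplicity \<Omega>) \<and> regular_point \<omega>"
    by eventually_elim simp
  \<comment> \<open>A non-null piece contains a point with every almost sure property of the cube.
    One such point suffices, since its fibre is all of \<open>B n\<close>.\<close>
  have "\<exists>\<omega>\<in>Q n. ?F \<omega> \<le> ennreal (tiling_multiplicity \<Omega>) \<and> regular_point \<omega>"
  proof (rule ccontr)
    assume *: "\<not> ?thesis"
    have "AE \<omega> in lebesgue. \<omega> \<notin> Q n"
      using AE by eventually_elim (use * Q(2)[OF n] in auto)
    then have "Q n \<in> null_sets lebesgue" using Q(1)[OF n] by (simp add: AE_iff_null_sets)
    then show False using nonnull by simp
  qed
  then obtain \<omega> where \<omega>: "\<omega> \<in> Q n" "?F \<omega> \<le> ennreal (tiling_multiplicity \<Omega>)" "regular_point \<omega>" by blast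
  have \<omega>c: "\<omega> \<in> unit_cube" using \<omega>(1) Q(2)[OF n] by blast
  have fib: "{l \<in> int_lattice. \<omega> + l \<in> \<Omega>} = B n" by (rule regular_point_fiber[OF \<omega>(3) n \<omega>(1)])
  show sub: "B n \<subseteq> active_shifts \<Omega>" using fiber_subset_active[OF \<omega>c] by (simp only: fib)
  then show "finite (B n)" by (rule finite_subset) (rule finite_active_shifts[OF compact_\<Omega>])
  have "ennreal (real (card (B n))) \<le> ennreal (tiling_multiplicity \<Omega>)"
    using \<omega>(2) unfolding F[OF \<omega>c] fib by (simp add: ennreal_of_nat_eq_real_of_nat)
  then show "real (card (B n)) \<le> tiling_multiplicity \<Omega>"
    by (subst (asm) ennreal_le_iff) (simp_all add: tiling_multiplicity_def)
qed

text \<open>The first alternative covers points outside all pieces, whose fibre is empty; null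
  pieces are avoided almost surely.\<close>

lemma AE_fiber_cases:
  "AE \<omega> in cube_measure. (\<forall>j\<in>active_shifts \<Omega>. \<omega> + j \<notin> \<Omega>) \<or>
     (\<exists>n\<in>{1..N}. Q n \<notin> null_sets lebesgue \<and> (\<forall>j\<in>active_shifts \<Omega>. \<omega> + j \<in> \<Omega> \<longrightarrow> j \<in> B n))"
proof -
  have "AE \<omega> in lborel. \<forall>n\<in>{1..N}. Q n \<in> null_sets lebesgue \<longrightarrow> \<omega> \<notin> Q n"
  proof (subst AE_ball_countable)
    show "\<forall>n\<in>{1..N}. AE \<omega> in lborel. Q n \<in> null_sets lebesgue \<longrightarrow> \<omega> \<notin> Q n"
    proof
      fix n
      show "AE \<omega> in lborel. Q n \<in> null_sets lebesgue \<longrightarrow> \<omega> \<notin> Q n"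
      proof (cases "Q n \<in> null_sets lebesgue")
        case True
        from AE_lborel_translate[OF this, of 0] show ?thesis by simp
      qed simp
    qed
  qed simp
  then have "AE \<omega> in lborel. \<omega> \<in> unit_cube \<longrightarrow> (\<forall>j\<in>active_shifts \<Omega>. \<omega> + j \<notin> \<Omega>) \<or>
     (\<exists>n\<in>{1..N}. Q n \<notin> null_sets lebesgue \<and> (\<forall>j\<in>active_shifts \<Omega>. \<omega> + j \<in> \<Omega> \<longrightarrow> j \<in> B n))"
    using AE_regular_point
  proof eventually_elim
    case (elim \<omega>)
    show ?case
    proof
      assume \<omega>: "\<omega> \<in> unit_cube"
      then have reg: "regular_point \<omega>" using elim(2) by simp
      show "(\<forall>j\<in>active_shifts \<Omega>. \<omega> + j \<notin> \<Omega>) \<or>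
        (\<exists>n\<in>{1..N}. Q n \<notin> null_sets lebesgue \<and> (\<forall>j\<in>active_shifts \<Omega>. \<omega> + j \<in> \<Omega> \<longrightarrow> j \<in> B n))"
      proof (cases "\<exists>n\<in>{1..N}. \<omega> \<in> Q n")
        case True
        then obtain n where n: "n \<in> {1..N}" "\<omega> \<in> Q n" by blast
        have "\<forall>j\<in>active_shifts \<Omega>. \<omega> + j \<in> \<Omega> \<longrightarrow> j \<in> B n"
          using regular_point_fiber[OF reg n] active_shifts_subset by blast
        then show ?thesis using n elim(1) by blast
      next
        case False
        then have "\<forall>j\<in>active_shifts \<Omega>. \<omega> + j \<notin> \<Omega>"
          using reg active_shifts_subset unfolding regular_point_def by blast
        then show ?thesis ..
      qed
    qed
  qed
  then show ?thesis
    unfolding cube_measure_density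
    by (subst AE_density) (auto simp: indicator_def elim!: eventually_mono)
qed

end

text \<open>Isotropy is orthonormality of characters on the cube. The conjugate makes
  \<open>ip u a\<close> equal to the sum of \<open>u b * chi b x\<close>, the form in which fibre
  sums occur.\<close>

lemma isotropic_vectors_characters:
  fixes B :: "(real^'d) set"
  assumes "finite B" "B \<subseteq> int_lattice"
  shows "isotropic_vectors B cube_measure (\<lambda>x b. cnj (chi b x))"
proof -
  interpret prob_space "cube_measure :: (real^'d) measure" by (rule prob_space_cube_measure)
  show ?thesis
  proof
    show "(\<lambda>x. cnj (chi b x)) \<in> borel_measurable cube_measure" for b :: "real^'d" by measurable
    fix b c assume bc: "b \<in> B" "c \<in> B"
    have "cnj (chi b x) * cnj (cnj (chi c x)) = chi (c - b) x" for x
      using chi_add_left[of c "- b" x] by (simp add: cnj_chi mult.commute)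
    then show "(LINT x|cube_measure. cnj (chi b x) * cnj (cnj (chi c x))) = (if b = c then 1 else 0)"
      using integral_cube_chi[of "c - b"] int_lattice_diff[of c b] bc assms(2) by (auto simp: subset_iff)
  qed (use assms in simp_all)
qed

subsection \<open>Sampling inequalities\<close>

definition sample_sum :: "(real^'d \<Rightarrow> complex) \<Rightarrow> real^'d \<Rightarrow> ennreal" where
  "sample_sum f x = (\<Sum>\<^sub>\<infinity>l\<in>int_lattice. ennreal ((cmod (f (x + l)))\<^sup>2))"

text \<open>In the integral representation the integrand is continuous in x at each \<omega> and
  dominated by a bound independent of x.\<close>

lemma continuous_sample_sum:
  fixes f :: "real^'d \<Rightarrow> complex"
  assumes \<Omega>: "compact \<Omega>" and f: "f \<in> Paley_Wiener \<Omega>"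
  shows "continuous_on UNIV (sample_sum f)"
proof -
  obtain g where g: "g \<in> borel_measurable borel" "\<And>\<omega>. \<omega> \<notin> \<Omega> \<Longrightarrow> g \<omega> = 0"
    "integrable lborel g" "integrable lborel (\<lambda>\<omega>. (cmod (g \<omega>))\<^sup>2)"
    "\<And>a. f a = (LINT \<omega>|lborel. g \<omega> * chi a \<omega>)"
    by (rule Paley_Wiener_representation[OF \<Omega> f]) (rule that)
  have [measurable]: "g \<in> borel_measurable borel" by (rule g(1))
  let ?c = "real (card (active_shifts \<Omega>))"
  let ?w = "\<lambda>\<omega>. ?c * (\<Sum>j\<in>active_shifts \<Omega>. (cmod (g (\<omega> + j)))\<^sup>2)"
  have S: "sample_sum f = (\<lambda>x. \<integral>\<^sup>+\<omega>. ennreal ((cmod (fiber_sum \<Omega> g x \<omega>))\<^sup>2) \<partial>cube_measure)"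
    unfolding sample_sum_def by (rule ext) (rule sample_sum_eq[of \<Omega> g f, OF \<Omega> g])
  have fin: "(\<integral>\<^sup>+\<omega>. ennreal (?w \<omega>) \<partial>cube_measure) < \<infinity>"
    using nn_integral_fiber_sq_finite[OF g(1) g(4), of \<Omega>]
    by (simp add: ennreal_mult sum_nonneg nn_integral_cmult ennreal_mult_less_top)
  show ?thesis
    unfolding continuous_on_sequentially
  proof (intro allI ballI impI)
    fix u :: "nat \<Rightarrow> real^'d" and x assume u: "(\<forall>n. u n \<in> UNIV) \<and> u \<longlonglongrightarrow> x"
    have "(\<lambda>n. \<integral>\<^sup>+\<omega>. ennreal ((cmod (fiber_sum \<Omega> g (u n) \<omega>))\<^sup>2) \<partial>cube_measure)
        \<longlonglongrightarrow> (\<integral>\<^sup>+\<omega>. ennreal ((cmod (fiber_sum \<Omega> g x \<omega>))\<^sup>2) \<partial>cube_measure)"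
    proof (rule nn_integral_dominated_convergence[where w = "\<lambda>\<omega>. ennreal (?w \<omega>)"])
      show "(\<lambda>\<omega>. ennreal ((cmod (fiber_sum \<Omega> g (u n) \<omega>))\<^sup>2)) \<in> borel_measurable cube_measure" for n
        unfolding fiber_sum_def by measurable
      show "(\<lambda>\<omega>. ennreal ((cmod (fiber_sum \<Omega> g x \<omega>))\<^sup>2)) \<in> borel_measurable cube_measure"
        unfolding fiber_sum_def by measurable
      show "AE \<omega> in cube_measure. ennreal ((cmod (fiber_sum \<Omega> g (u n) \<omega>))\<^sup>2) \<le> ennreal (?w \<omega>)" for n
        by (intro AE_I2 ennreal_leI fiber_sum_sq_le[OF \<Omega>])
      show "AE \<omega> in cube_measure. (\<lambda>n. ennreal ((cmod (fiber_sum \<Omega> g (u n) \<omega>))\<^sup>2)) \<longlonglongrightarrow> ennreal ((cmod (fiber_sum \<Omega> g x \<omega>))\<^sup>2)"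
      proof (rule AE_I2)
        fix \<omega> :: "real^'d"
        have "continuous_on UNIV (\<lambda>x. fiber_sum \<Omega> g x \<omega>)"
          unfolding fiber_sum_def by (intro continuous_intros)
        then have "(\<lambda>n. fiber_sum \<Omega> g (u n) \<omega>) \<longlonglongrightarrow> fiber_sum \<Omega> g x \<omega>"
          using u by (auto simp: continuous_on_sequentially comp_def)
        then show "(\<lambda>n. ennreal ((cmod (fiber_sum \<Omega> g (u n) \<omega>))\<^sup>2)) \<longlonglongrightarrow> ennreal ((cmod (fiber_sum \<Omega> g x \<omega>))\<^sup>2)"
          by (intro tendsto_ennrealI tendsto_intros)
      qed
      show "(\<lambda>\<omega>. ennreal (?w \<omega>)) \<in> borel_measurable cube_measure" by measurable
    qed (rule fin)
    then show "(sample_sum f \<circ> u) \<longlonglongrightarrow> sample_sum f x" by (simp add: S comp_def)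
  qed
qed

text \<open>Sample points form a total sequence, so that the stable ones are a subset of a function
  space with the product topology; only indices 1 to m enter.\<close>

definition sampling_stable :: "(real^'d) set \<Rightarrow> nat \<Rightarrow> real \<Rightarrow> (nat \<Rightarrow> real^'d) \<Rightarrow> bool" where
  "sampling_stable \<Omega> m \<alpha> X \<longleftrightarrow> (\<forall>f\<in>Paley_Wiener \<Omega>.
     ennreal (real m * (1 - \<alpha>) * (L2_norm f)\<^sup>2) \<le> (\<Sum>r=1..m. sample_sum f (X r)) \<and>
     (\<Sum>r=1..m. sample_sum f (X r)) \<le> ennreal (real m * (1 + \<alpha>) * (L2_norm f)\<^sup>2))"

text \<open>An intersection over uncountably many f need not be measurable, but an intersection of
  closed sets is closed.\<close>

lemma closed_sampling_stable:
  fixes \<Omega> :: "(real^'d) set"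
  assumes "compact \<Omega>"
  shows "closed {X. sampling_stable \<Omega> m \<alpha> X}"
proof -
  have cont: "continuous_on UNIV (\<lambda>X. \<Sum>r=1..m. sample_sum f (X r))" if "f \<in> Paley_Wiener \<Omega>" for f
  proof (rule continuous_on_sum)
    fix r
    show "continuous_on UNIV (\<lambda>X. sample_sum f (X r))"
      by (rule continuous_on_compose2[OF continuous_sample_sum[OF assms that] continuous_on_product_coordinates]) simp
  qed
  have *: "{X. sampling_stable \<Omega> m \<alpha> X} = (\<Inter>f\<in>Paley_Wiener \<Omega>.
      {X. ennreal (real m * (1 - \<alpha>) * (L2_norm f)\<^sup>2) \<le> (\<Sum>r=1..m. sample_sum f (X r))} \<inter>
      {X. (\<Sum>r=1..m. sample_sum f (X r)) \<le> ennreal (real m * (1 + \<alpha>) * (L2_norm f)\<^sup>2)})"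
    by (intro set_eqI) (simp add: sampling_stable_def)
  show ?thesis
    unfolding * by (intro closed_INT ballI closed_Int closed_Collect_le continuous_on_const cont)
qed

context tiling
begin

definition nonnull_pieces :: "nat set" where
  "nonnull_pieces = {n \<in> {1..N}. Q n \<notin> null_sets lebesgue}"

text \<open>At almost every \<omega> the fibre sum is supported on one non-null shift set, where the
  matrix bound applies to the vector of values g (\<omega> + b). Integrating over \<omega> yields
  the sampling bounds for f, with the same m and \<alpha>.\<close>

lemma sampling_stable_of_fibers:
  assumes \<alpha>: "0 < \<alpha>" "\<alpha> < 1"
    and bounds: "\<And>n u. n \<in> nonnull_pieces \<Longrightarrow>
      real m * (1 - \<alpha>) * (\<Sum>b\<in>B n. (cmod (u b))\<^sup>2) \<le> (\<Sum>r=1..m. (cmod (\<Sum>b\<in>B n. u b * chi b (X r)))\<^sup>2) \<and>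
      (\<Sum>r=1..m. (cmod (\<Sum>b\<in>B n. u b * chi b (X r)))\<^sup>2) \<le> real m * (1 + \<alpha>) * (\<Sum>b\<in>B n. (cmod (u b))\<^sup>2)"
  shows "sampling_stable \<Omega> m \<alpha> X"
  unfolding sampling_stable_def
proof
  fix f assume f: "f \<in> Paley_Wiener \<Omega>"
  obtain g where g: "g \<in> borel_measurable borel" "\<And>\<omega>. \<omega> \<notin> \<Omega> \<Longrightarrow> g \<omega> = 0"
    "integrable lborel g" "integrable lborel (\<lambda>\<omega>. (cmod (g \<omega>))\<^sup>2)"
    "\<And>a. f a = (LINT \<omega>|lborel. g \<omega> * chi a \<omega>)"
    by (rule Paley_Wiener_representation[OF compact_\<Omega> f]) (rule that)
  have [measurable]: "g \<in> borel_measurable borel" by (rule g(1))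
  let ?J = "active_shifts \<Omega>"
  let ?s = "\<lambda>\<omega>. \<Sum>j\<in>?J. (cmod (g (\<omega> + j)))\<^sup>2"
  let ?S = "\<lambda>\<omega>. \<Sum>r=1..m. (cmod (fiber_sum \<Omega> g (X r) \<omega>))\<^sup>2"
  have norm: "ennreal ((L2_norm f)\<^sup>2) = (\<integral>\<^sup>+\<omega>. ennreal (?s \<omega>) \<partial>cube_measure)"
    by (rule Paley_Wiener_norm_eq[OF compact_\<Omega> g f])
  have "(\<Sum>r=1..m. sample_sum f (X r)) = (\<Sum>r=1..m. \<integral>\<^sup>+\<omega>. ennreal ((cmod (fiber_sum \<Omega> g (X r) \<omega>))\<^sup>2) \<partial>cube_measure)"
    unfolding sample_sum_def by (intro sum.cong refl sample_sum_eq[of \<Omega> g f, OF compact_\<Omega> g])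
  also have "\<dots> = (\<integral>\<^sup>+\<omega>. (\<Sum>r=1..m. ennreal ((cmod (fiber_sum \<Omega> g (X r) \<omega>))\<^sup>2)) \<partial>cube_measure)"
    unfolding fiber_sum_def by (rule nn_integral_sum[symmetric]) measurable
  also have "\<dots> = (\<integral>\<^sup>+\<omega>. ennreal (?S \<omega>) \<partial>cube_measure)"
    by (simp add: sum_ennreal)
  finally have sample: "(\<Sum>r=1..m. sample_sum f (X r)) = (\<integral>\<^sup>+\<omega>. ennreal (?S \<omega>) \<partial>cube_measure)" .
  have AE: "AE \<omega> in cube_measure. real m * (1 - \<alpha>) * ?s \<omega> \<le> ?S \<omega> \<and> ?S \<omega> \<le> real m * (1 + \<alpha>) * ?s \<omega>"
    using AE_fiber_cases
  proof eventually_elim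
    case (elim \<omega>)
    then show ?case
    proof
      assume "\<forall>j\<in>?J. \<omega> + j \<notin> \<Omega>"
      then have "g (\<omega> + j) = 0" if "j \<in> ?J" for j using that g(2) by simp
      then show ?thesis by (simp add: fiber_sum_def)
    next
      assume "\<exists>n\<in>{1..N}. Q n \<notin> null_sets lebesgue \<and> (\<forall>j\<in>?J. \<omega> + j \<in> \<Omega> \<longrightarrow> j \<in> B n)"
      then obtain n where n: "n \<in> {1..N}" "Q n \<notin> null_sets lebesgue" "\<And>j. j \<in> ?J \<Longrightarrow> \<omega> + j \<in> \<Omega> \<Longrightarrow> j \<in> B n"
        by blast
      have z: "g (\<omega> + j) = 0" if "j \<in> ?J - B n" for j
        using that n(3)[of j] g(2)[of "\<omega> + j"] by auto
      note sub = nonnull_piece_card_le(1)[OF n(1,2)]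
      have s: "?s \<omega> = (\<Sum>b\<in>B n. (cmod (g (\<omega> + b)))\<^sup>2)"
        by (rule sum.mono_neutral_right[OF finite_active_shifts[OF compact_\<Omega>] sub]) (use z in simp)
      have fib: "fiber_sum \<Omega> g x \<omega> = (\<Sum>b\<in>B n. g (\<omega> + b) * chi b x)" for x
        unfolding fiber_sum_def
        by (rule sum.mono_neutral_right[OF finite_active_shifts[OF compact_\<Omega>] sub]) (use z in simp)
      show ?thesis
        unfolding s fib using bounds[of n "\<lambda>b. g (\<omega> + b)"] n by (simp add: nonnull_pieces_def)
    qed
  qed
  have scale: "ennreal (c * (L2_norm f)\<^sup>2) = (\<integral>\<^sup>+\<omega>. ennreal (c * ?s \<omega>) \<partial>cube_measure)" if "0 \<le> c" for c
    using that by (simp add: ennreal_mult sum_nonneg nn_integral_cmult norm)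
  have "ennreal (real m * (1 - \<alpha>) * (L2_norm f)\<^sup>2) = (\<integral>\<^sup>+\<omega>. ennreal (real m * (1 - \<alpha>) * ?s \<omega>) \<partial>cube_measure)"
    using \<alpha> by (intro scale) simp
  also have "\<dots> \<le> (\<integral>\<^sup>+\<omega>. ennreal (?S \<omega>) \<partial>cube_measure)"
    by (rule nn_integral_mono_AE) (use AE in eventually_elim, simp add: ennreal_leI)
  finally have 1: "ennreal (real m * (1 - \<alpha>) * (L2_norm f)\<^sup>2) \<le> (\<integral>\<^sup>+\<omega>. ennreal (?S \<omega>) \<partial>cube_measure)" .
  have "(\<integral>\<^sup>+\<omega>. ennreal (?S \<omega>) \<partial>cube_measure) \<le> (\<integral>\<^sup>+\<omega>. ennreal (real m * (1 + \<alpha>) * ?s \<omega>) \<partial>cube_measure)"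
    by (rule nn_integral_mono_AE) (use AE in eventually_elim, simp add: ennreal_leI)
  also have "\<dots> = ennreal (real m * (1 + \<alpha>) * (L2_norm f)\<^sup>2)"
    using \<alpha> by (intro scale[symmetric]) simp
  finally show "ennreal (real m * (1 - \<alpha>) * (L2_norm f)\<^sup>2) \<le> (\<Sum>r=1..m. sample_sum f (X r)) \<and>
     (\<Sum>r=1..m. sample_sum f (X r)) \<le> ennreal (real m * (1 + \<alpha>) * (L2_norm f)\<^sup>2)"
    unfolding sample using 1 by simp
qed

text \<open>A union bound over the non-null pieces; the fibrewise exceptional sets depend on the
  piece but not on f.\<close>

lemma sampling_stable_probability:
  assumes \<alpha>: "0 < \<alpha>" "\<alpha> < 1"
  obtains Bad where "Bad \<in> sets (PiM {1..m} (\<lambda>_. cube_measure :: (real^'d) measure))"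
    and "measure (PiM {1..m} (\<lambda>_. cube_measure)) Bad
      \<le> (\<Sum>n\<in>nonnull_pieces. 2 * real (card (B n)) * exp (- (real m * \<alpha>\<^sup>2 / (10 * real (card (B n))))))"
    and "\<And>X. X \<in> space (PiM {1..m} (\<lambda>_. cube_measure)) \<Longrightarrow> X \<notin> Bad \<Longrightarrow> sampling_stable \<Omega> m \<alpha> X"
proof -
  let ?P = "PiM {1..m} (\<lambda>_. cube_measure :: (real^'d) measure)"
  interpret P: prob_space ?P by (rule prob_space_PiM) (rule prob_space_cube_measure)
  have fin: "finite nonnull_pieces" by (simp add: nonnull_pieces_def)
  let ?good = "\<lambda>n Bad. Bad \<in> sets ?P \<and>
      measure ?P Bad \<le> 2 * real (card (B n)) * exp (- (real m * \<alpha>\<^sup>2 / (10 * real (card (B n))))) \<and>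
      (\<forall>X u. X \<in> space ?P \<longrightarrow> X \<notin> Bad \<longrightarrow>
        real m * (1 - \<alpha>) * (\<Sum>b\<in>B n. (cmod (u b))\<^sup>2) \<le> (\<Sum>r=1..m. (cmod (\<Sum>b\<in>B n. u b * chi b (X r)))\<^sup>2) \<and>
        (\<Sum>r=1..m. (cmod (\<Sum>b\<in>B n. u b * chi b (X r)))\<^sup>2) \<le> real m * (1 + \<alpha>) * (\<Sum>b\<in>B n. (cmod (u b))\<^sup>2))"
  have "\<exists>Bad. ?good n Bad"
    if n: "n \<in> nonnull_pieces" for n
  proof -
    have n': "n \<in> {1..N}" "Q n \<notin> null_sets lebesgue" using n by (auto simp: nonnull_pieces_def)
    interpret isotropic_vectors "B n" cube_measure "\<lambda>x b. cnj (chi b x)"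
      by (rule isotropic_vectors_characters) (use nonnull_piece_card_le[OF n'] B[OF n'(1)] in auto)
    obtain Bad where Bad: "Bad \<in> sets ?P"
      "measure ?P Bad \<le> 2 * real (card (B n)) * exp (- (real m * \<alpha>\<^sup>2 / (10 * real (card (B n)))))"
      "\<And>X u. X \<in> space ?P \<Longrightarrow> X \<notin> Bad \<Longrightarrow>
        real m * (1 - \<alpha>) * sqnorm u \<le> (\<Sum>r=1..m. (cmod (ip u (\<lambda>b. cnj (chi b (X r)))))\<^sup>2) \<and>
        (\<Sum>r=1..m. (cmod (ip u (\<lambda>b. cnj (chi b (X r)))))\<^sup>2) \<le> real m * (1 + \<alpha>) * sqnorm u"
      by (rule frame_concentration[OF \<alpha>, of m]) (rule that)
    show ?thesis
      by (rule exI[of _ Bad]) (use Bad in \<open>simp add: sqnorm_def ip_def\<close>)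
  qed
  then have "\<forall>n\<in>nonnull_pieces. \<exists>Bad. ?good n Bad" by (intro ballI)
  from bchoice[OF this] obtain Bad where Bad: "\<forall>n\<in>nonnull_pieces. ?good n (Bad n)" ..
  then have meas: "Bad n \<in> sets ?P" if "n \<in> nonnull_pieces" for n using that by simp
  show ?thesis
  proof (rule that[of "\<Union>n\<in>nonnull_pieces. Bad n"])
    show "(\<Union>n\<in>nonnull_pieces. Bad n) \<in> sets ?P" using meas fin by (intro sets.finite_UN) auto
    have "measure ?P (\<Union>n\<in>nonnull_pieces. Bad n) \<le> (\<Sum>n\<in>nonnull_pieces. measure ?P (Bad n))"
      by (rule measure_UNION_le) (use meas fin in auto)
    also have "\<dots> \<le> (\<Sum>n\<in>nonnull_pieces. 2 * real (card (B n)) * exp (- (real m * \<alpha>\<^sup>2 / (10 * real (card (B n))))))"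
      by (rule sum_mono) (use Bad in simp)
    finally show "measure ?P (\<Union>n\<in>nonnull_pieces. Bad n)
      \<le> (\<Sum>n\<in>nonnull_pieces. 2 * real (card (B n)) * exp (- (real m * \<alpha>\<^sup>2 / (10 * real (card (B n))))))" .
    fix X assume X: "X \<in> space ?P" "X \<notin> (\<Union>n\<in>nonnull_pieces. Bad n)"
    show "sampling_stable \<Omega> m \<alpha> X"
    proof (rule sampling_stable_of_fibers[OF \<alpha>])
      fix n u assume n: "n \<in> nonnull_pieces"
      then have "X \<notin> Bad n" using X(2) by simp
      then show "real m * (1 - \<alpha>) * (\<Sum>b\<in>B n. (cmod (u b))\<^sup>2) \<le> (\<Sum>r=1..m. (cmod (\<Sum>b\<in>B n. u b * chi b (X r)))\<^sup>2) \<and>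
        (\<Sum>r=1..m. (cmod (\<Sum>b\<in>B n. u b * chi b (X r)))\<^sup>2) \<le> real m * (1 + \<alpha>) * (\<Sum>b\<in>B n. (cmod (u b))\<^sup>2)"
        using bspec[OF Bad n] X(1) by simp
    qed
  qed
qed

text \<open>Each piece receives the share \<epsilon> / N. The bound \<open>card (B n)\<close> <= k
  is used twice, in the prefactor and in the exponent.\<close>

lemma failure_bound:
  assumes \<alpha>: "0 < \<alpha>" and \<epsilon>: "0 < \<epsilon>" and N1: "1 \<le> N" and k: "k = tiling_multiplicity \<Omega>"
    and m: "real m \<ge> 10 / \<alpha>\<^sup>2 * k * ln (2 * real N * k / \<epsilon>)"
  shows "(\<Sum>n\<in>nonnull_pieces. 2 * real (card (B n)) * exp (- (real m * \<alpha>\<^sup>2 / (10 * real (card (B n)))))) \<le> \<epsilon>"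
proof -
  have "2 * real (card (B n)) * exp (- (real m * \<alpha>\<^sup>2 / (10 * real (card (B n))))) \<le> \<epsilon> / real N"
    if n: "n \<in> nonnull_pieces" for n
  \<comment> \<open>An empty shift set contributes 0. In the other case k is positive, so the
    logarithm has a positive argument.\<close>
  proof (cases "B n = {}")
    case True
    then show ?thesis using \<epsilon> by simp
  next
    case False
    have n': "n \<in> {1..N}" "Q n \<notin> null_sets lebesgue" using n by (auto simp: nonnull_pieces_def)
    have c0: "0 < real (card (B n))" using False nonnull_piece_card_le(2)[OF n'] by (simp add: card_gt_0_iff)
    have ck: "real (card (B n)) \<le> k" unfolding k by (rule nonnull_piece_card_le(3)[OF n'])
    have k0: "0 < k" using c0 ck by linarith
    have pos: "0 < 2 * real N * k / \<epsilon>" using k0 \<epsilon> N1 by simp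
    have "ln (2 * real N * k / \<epsilon>) \<le> real m * \<alpha>\<^sup>2 / (10 * k)"
      using m \<alpha> k0 by (simp add: field_simps)
    also have "\<dots> \<le> real m * \<alpha>\<^sup>2 / (10 * real (card (B n)))"
      using ck c0 by (intro divide_left_mono) (auto simp: k0)
    finally have "exp (- (real m * \<alpha>\<^sup>2 / (10 * real (card (B n))))) \<le> exp (- ln (2 * real N * k / \<epsilon>))" by simp
    also have "\<dots> = \<epsilon> / (2 * real N * k)" using pos by (simp add: exp_minus)
    finally have "2 * real (card (B n)) * exp (- (real m * \<alpha>\<^sup>2 / (10 * real (card (B n))))) \<le> 2 * k * (\<epsilon> / (2 * real N * k))"
      using ck k0 by (intro mult_mono) auto
    also have "\<dots> = \<epsilon> / real N" using k0 by simp
    finally show ?thesis .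
  qed
  then have "(\<Sum>n\<in>nonnull_pieces. 2 * real (card (B n)) * exp (- (real m * \<alpha>\<^sup>2 / (10 * real (card (B n))))))
      \<le> real (card nonnull_pieces) * (\<epsilon> / real N)"
    by (rule sum_bounded_above)
  also have "\<dots> \<le> real N * (\<epsilon> / real N)"
  proof (rule mult_right_mono)
    have "card nonnull_pieces \<le> card {1..N}" by (rule card_mono) (auto simp: nonnull_pieces_def)
    then show "real (card nonnull_pieces) \<le> real N" by simp
  qed (use \<epsilon> in simp)
  also have "\<dots> = \<epsilon>" using N1 by simp
  finally show ?thesis .
qed

end

theorem mainTheorem3:
  fixes \<Omega> :: "(real ^ 'd) set"
    and M :: "'w measure"
    and x :: "nat \<Rightarrow> 'w \<Rightarrow> real ^ 'd"
    and m :: nat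
    and \<epsilon> \<alpha> k :: real
  assumes "compact \<Omega>"
    and "k = tiling_multiplicity \<Omega>"
    and "prob_space M"
    and "prob_space.indep_vars M (\<lambda>_. borel) x {1..m}"
    and "\<And>r. r \<in> {1..m} \<Longrightarrow> distr M borel (x r) = uniform_measure lborel unit_cube"
    and "\<epsilon> > 0"
    and "0 < \<alpha>" and "\<alpha> < 1"
    and "real m \<ge> 10 / \<alpha>\<^sup>2 * k * ln (2 * real (tiling_complexity \<Omega>) * k / \<epsilon>)"
  shows "\<P>(w in M. \<forall>f\<in>Paley_Wiener \<Omega>.
           ennreal (real m * (1 - \<alpha>) * (L2_norm f)\<^sup>2)
             \<le> (\<Sum>r=1..m. \<Sum>\<^sub>\<infinity>l\<in>int_lattice. ennreal ((cmod (f (x r w + l)))\<^sup>2)) \<and>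
           (\<Sum>r=1..m. \<Sum>\<^sub>\<infinity>l\<in>int_lattice. ennreal ((cmod (f (x r w + l)))\<^sup>2))
             \<le> ennreal (real m * (1 + \<alpha>) * (L2_norm f)\<^sup>2)) \<ge> 1 - \<epsilon>"
proof -
  interpret prob_space M by fact
  let ?P = "PiM {1..m} (\<lambda>_. cube_measure :: (real^'d) measure)"
  define E where "E = {w \<in> space M. sampling_stable \<Omega> m \<alpha> (\<lambda>r. x r w)}"
  have goal: "{w \<in> space M. \<forall>f\<in>Paley_Wiener \<Omega>.
           ennreal (real m * (1 - \<alpha>) * (L2_norm f)\<^sup>2)
             \<le> (\<Sum>r=1..m. \<Sum>\<^sub>\<infinity>l\<in>int_lattice. ennreal ((cmod (f (x r w + l)))\<^sup>2)) \<and>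
           (\<Sum>r=1..m. \<Sum>\<^sub>\<infinity>l\<in>int_lattice. ennreal ((cmod (f (x r w + l)))\<^sup>2))
             \<le> ennreal (real m * (1 + \<alpha>) * (L2_norm f)\<^sup>2)} = E"
    by (simp add: E_def sampling_stable_def sample_sum_def)
  have rv: "random_variable borel (x r)" if "r \<in> {1..m}" for r
    using assms(4) that by (auto simp: indep_vars_def)
  \<comment> \<open>Coordinates outside 1 to m are irrelevant to stability; this allows padding by 0
    for measurability and restriction for the joint law.\<close>
  have cong: "sampling_stable \<Omega> m \<alpha> X \<longleftrightarrow> sampling_stable \<Omega> m \<alpha> Y" if "\<And>r. r \<in> {1..m} \<Longrightarrow> X r = Y r" for X Y
  proof -
    have "(\<Sum>r=1..m. sample_sum f (X r)) = (\<Sum>r=1..m. sample_sum f (Y r))" for f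
      using that by (intro sum.cong) auto
    then show ?thesis by (simp add: sampling_stable_def)
  qed
  have E_sets: "E \<in> events"
  proof -
    \<comment> \<open>Padding with 0 makes every coordinate measurable, including those about which
      nothing is assumed.\<close>
    let ?Y = "\<lambda>w r. if r \<in> {1..m} then x r w else 0"
    have "?Y \<in> borel_measurable M"
    proof (rule measurable_coordinatewise_then_product)
      show "(\<lambda>w. ?Y w r) \<in> borel_measurable M" for r
        using rv[of r] by (cases "r \<in> {1..m}") auto
    qed
    then have "?Y -` {X. sampling_stable \<Omega> m \<alpha> X} \<inter> space M \<in> events"
      by (rule measurable_sets) (rule borel_closed[OF closed_sampling_stable[OF assms(1)]])
    also have "?Y -` {X. sampling_stable \<Omega> m \<alpha> X} \<inter> space M = E"
    proof -
      have "sampling_stable \<Omega> m \<alpha> (?Y w) \<longleftrightarrow> sampling_stable \<Omega> m \<alpha> (\<lambda>r. x r w)" for w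
        by (rule cong) simp
      then show ?thesis by (auto simp: E_def)
    qed
    finally show ?thesis .
  qed
  show ?thesis
  proof (cases "m = 0")
    \<comment> \<open>With no samples both bounds read 0 = 0. The case is separated because the
      joint-law characterisation of independence is applied to a nonempty index set.\<close>
    case True
    then have "E = space M" by (auto simp: E_def sampling_stable_def)
    then show ?thesis unfolding goal using prob_space assms(6) by simp
  next
    case False
    obtain Q B where QB: "disjoint_family_on Q {1..tiling_complexity \<Omega>}"
      "\<forall>n\<in>{1..tiling_complexity \<Omega>}. Q n \<in> sets lebesgue \<and> Q n \<subseteq> unit_cube \<and> B n \<subseteq> int_lattice"
      "sym_diff \<Omega> (\<Union>n\<in>{1..tiling_complexity \<Omega>}. {q + b | q b. q \<in> Q n \<and> b \<in> B n}) \<in> null_sets lebesgue"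
      using tiling_complexity_attained(2)[OF assms(1)] unfolding tiling_decomposition_def
      by (elim exE conjE) (rule that)
    interpret tiling \<Omega> "tiling_complexity \<Omega>" Q B
      by (rule tiling.intro) (use assms(1) QB in simp_all)
    obtain Bad where Bad: "Bad \<in> sets ?P"
      "measure ?P Bad \<le> (\<Sum>n\<in>nonnull_pieces. 2 * real (card (B n)) * exp (- (real m * \<alpha>\<^sup>2 / (10 * real (card (B n))))))"
      "\<And>X. X \<in> space ?P \<Longrightarrow> X \<notin> Bad \<Longrightarrow> sampling_stable \<Omega> m \<alpha> X"
      by (rule sampling_stable_probability[OF assms(7,8), of m]) (rule that)
    have "measure ?P Bad \<le> \<epsilon>"
      using Bad(2) failure_bound[OF assms(7,6) tiling_complexity_attained(1)[OF assms(1)] assms(2,9)] by linarith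
    let ?X = "\<lambda>w. \<lambda>r\<in>{1..m}. x r w"
    have X: "?X \<in> measurable M (PiM {1..m} (\<lambda>_. borel))"
      by (rule measurable_restrict) (rule rv)
    have sets_eq: "sets (PiM {1..m} (\<lambda>_. borel :: (real^'d) measure)) = sets ?P"
      by (rule sets_PiM_cong) simp_all
    have "distr M (PiM {1..m} (\<lambda>_. borel)) ?X = PiM {1..m} (\<lambda>r. distr M borel (x r))"
      using assms(4) False by (subst (asm) indep_vars_iff_distr_eq_PiM') (auto intro: rv)
    also have "\<dots> = ?P" by (rule PiM_cong) (simp_all add: assms(5) cube_measure_def)
    finally have distr: "distr M (PiM {1..m} (\<lambda>_. borel)) ?X = ?P" .
    have Bad_sets: "Bad \<in> sets (PiM {1..m} (\<lambda>_. borel))" using Bad(1) unfolding sets_eq .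
    have "measure ?P Bad = prob (?X -` Bad \<inter> space M)"
      unfolding distr[symmetric] by (rule measure_distr[OF X Bad_sets])
    \<comment> \<open>Only this inclusion is required: failure implies that the sample vector lands
      in \<open>Bad\<close>, whose probability is computed from the product law.\<close>
    moreover have "space M - E \<subseteq> ?X -` Bad \<inter> space M"
    proof
      fix w assume w: "w \<in> space M - E"
      then have "\<not> sampling_stable \<Omega> m \<alpha> (\<lambda>r. x r w)" by (simp add: E_def)
      then have "\<not> sampling_stable \<Omega> m \<alpha> (?X w)"
        using cong[of "?X w" "\<lambda>r. x r w"] by simp
      moreover have "?X w \<in> space ?P" by (simp add: space_PiM)
      ultimately have "?X w \<in> Bad" using Bad(3) by blast
      then show "w \<in> ?X -` Bad \<inter> space M" using w by simp
    qed
    moreover have "?X -` Bad \<inter> space M \<in> events"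
      by (rule measurable_sets[OF X Bad_sets])
    ultimately have "prob (space M - E) \<le> \<epsilon>"
      using finite_measure_mono[of "space M - E" "?X -` Bad \<inter> space M"] \<open>measure ?P Bad \<le> \<epsilon>\<close> by linarith
    then show ?thesis unfolding goal using prob_compl[OF E_sets] by linarith
  qed
qed

end
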